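(* Let $F$ be a non-Archimedean local field of characteristic zero. For any irreducible smooth representation $\pi$ of $\mathrm{GL}_n(F)$, as a distribution on $F^\times$, the $\pi$-kernel function $$k_{\pi,\psi}(x)=\lim_{\ell\to\infty}\int_{\det g=x}(\Phi_{\mathrm{GJ}}*\mathfrak{c}_\ell^\vee)(g)\,\varphi_{\widetilde\pi}(g)\,d_xg$$ is independent of the choice of the matrix coefficient $\varphi_{\widetilde\pi}$ of the contragredient $\widetilde\pi$ with $\varphi_{\widetilde\pi}(\mathrm{I}_n)=1$ and of the chosen sequence $\{\mathfrak{c}_\ell\}_{\ell=1}^\infty$ that tends to the delta mass supported at $\mathrm{I}_n$.
   Context: $\mathfrak{o}_F$ is the ring of integers of $F$, $\mathfrak{p}$ its maximal ideal, $\varpi$ a uniformizer, $|\cdot|_F$ the normalized absolute value. $\psi$ is an additive character of $F$ trivial on $\mathfrak{o}_F$ and non-trivial on $\varpi^{-1}\mathfrak{o}_F$. $d^+x$ is the self-dual Haar measure on $F$ for $\psi$, $d^+g$ the induced measure on $\mathrm{M}_n(F)$, $dg=|\det g|_F^{-n}d^+g$ on $\mathrm{GL}_n(F)$, $d^\times x=|x|_F^{-1}d^+x$. For $x\in F^\times$, $d_xg$ is the $\mathrm{SL}_n(F)$-invariant measure on $\{g\in\mathrm{GL}_n(F):\det g=x\}$ with $\int_{\mathrm{GL}_n(F)}f\,dg=\int_{F^\times}\int_{\det g=x}f(g)\,d_xg\,d^\times x$. Put $f^\vee(g)=f(g^{-1})$ and $(f_1*f_2)(g)=\int_{\mathrm{GL}_n(F)}f_1(h)f_2(h^{-1}g)\,dh$.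 $\Phi_{\mathrm{GJ}}(g)=\psi(\mathrm{tr}\,g)|\det g|_F^{n/2}$. The standard choice of sequence is $\mathfrak{c}_\ell=\mathrm{vol}(K_\ell)^{-1}\mathbf{1}_{K_\ell}$ with $K_\ell=\mathrm{I}_n+\mathrm{M}_n(\mathfrak{p}^\ell)$. In general, a sequence tending to the delta mass at $\mathrm{I}_n$ is a sequence $\{\mathfrak{c}_\ell\}\subset\mathcal{C}_c^\infty(\mathrm{GL}_n(F))$ with supports in a fixed compact neighborhood of $\mathrm{I}_n$ and $\lim_\ell\int\mathfrak{c}_\ell(g)h(g)\,dg=h(\mathrm{I}_n)$ for every $h\in\mathcal{C}^\infty(\mathrm{GL}_n(F))$. As a distribution, $k_{\pi,\psi}$ is $f\mapsto\int_{F^\times}k_{\pi,\psi}(x)f(x)\,d^\times x$ for $f\in\mathcal{C}_c^\infty(F^\times)$. *)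

theory Defs
  imports "HOL-Analysis.Analysis" "HOL-Library.Function_Algebras"
begin

section \<open>Non-Archimedean local fields of characteristic zero\<close>

text \<open>
  \<open>absv\<close> is the normalized absolute value: the residue field is the set of cosets
  of the maximal ideal in the ring of integers, and a generator of the maximal ideal has absolute
  value equal to the inverse of its cardinality. Finiteness of the residue field makes this inverse lie
  strictly between 0 and 1, so the valuation is discrete and non-trivial. The topology (and hence
  the one on matrices) is the one it defines.
\<close>

class nonarch_local_field_0 = field_char_0 + complete_space +
  fixes absv :: "'a \<Rightarrow> real"
  assumes dist_absv: "dist x y = absv (x - y)"
    and absv_eq_zero_iff: "absv x = 0 \<longleftrightarrow> x = 0"
    and absv_mult: "absv (x * y) = absv x * absv y"
    and absv_ultrametric: "absv (x + y) \<le> max (absv x) (absv y)"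
    and finite_residue_field: "finite ((\<lambda>x. {y. absv (y - x) < 1}) ` {x. absv x \<le> 1})"
    and absv_normalized: "\<exists>w. absv w = 1 / real (card ((\<lambda>x. {y. absv (y - x) < 1}) ` {x. absv x \<le> 1})) \<and>
           (\<forall>x. absv x < 1 \<longrightarrow> absv x \<le> absv w)"

definition ring_of_integers :: "'f::nonarch_local_field_0 set"
  where "ring_of_integers = {x. absv x \<le> 1}"

definition uniformizer :: "'f::nonarch_local_field_0 \<Rightarrow> bool"
  where "uniformizer w \<longleftrightarrow> w \<noteq> 0 \<and> absv w < 1 \<and> (\<forall>x::'f. absv x < 1 \<longrightarrow> absv x \<le> absv w)"

definition unramified_additive_character :: "('f::nonarch_local_field_0 \<Rightarrow> complex) \<Rightarrow> bool"
  where "unramified_additive_character \<psi> \<longleftrightarrow>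
    continuous_on UNIV \<psi> \<and> (\<forall>x. cmod (\<psi> x) = 1) \<and> (\<forall>x y. \<psi> (x + y) = \<psi> x * \<psi> y) \<and>
    (\<forall>x\<in>ring_of_integers. \<psi> x = 1) \<and>
    (\<forall>w. uniformizer w \<longrightarrow> (\<exists>x\<in>ring_of_integers. \<psi> (inverse w * x) \<noteq> 1))"

section \<open>Smooth functions\<close>

text \<open>
  Smooth means locally constant. A function on an open subset \<open>S\<close> of an ambient type is given by a
  function on the whole type; values off \<open>S\<close> are irrelevant for \<open>smooth_fun S\<close> and zero for
  \<open>test_fun S\<close>, the space of smooth functions with compact support contained in \<open>S\<close>.
\<close>

definition smooth_fun :: "'a::topological_space set \<Rightarrow> ('a \<Rightarrow> complex) set"
  where "smooth_fun S = {f. \<forall>x\<in>S. \<exists>U. open U \<and> x \<in> U \<and> (\<forall>y\<in>U \<inter> S. f y = f x)}"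

definition test_fun :: "'a::topological_space set \<Rightarrow> ('a \<Rightarrow> complex) set"
  where "test_fun S = {f \<in> smooth_fun S. \<exists>K. compact K \<and> K \<subseteq> S \<and> (\<forall>x. x \<notin> K \<longrightarrow> f x = 0)}"

section \<open>Measures\<close>

definition haar_measure_field :: "'f::nonarch_local_field_0 measure \<Rightarrow> bool"
  where "haar_measure_field \<mu> \<longleftrightarrow>
    sets \<mu> = sets borel \<and> emeasure \<mu> UNIV \<noteq> 0 \<and>
    (\<forall>K. compact K \<longrightarrow> emeasure \<mu> K < \<infinity>) \<and> (\<forall>a. distr \<mu> \<mu> (\<lambda>x. a + x) = \<mu>)"

definition fourier_field ::
    "('f::nonarch_local_field_0 \<Rightarrow> complex) \<Rightarrow> 'f measure \<Rightarrow> ('f \<Rightarrow> complex) \<Rightarrow> 'f \<Rightarrow> complex"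
  where "fourier_field \<psi> \<mu> f y = (\<integral>x. f x * \<psi> (x * y) \<partial>\<mu>)"

definition self_dual_haar :: "('f::nonarch_local_field_0 \<Rightarrow> complex) \<Rightarrow> 'f measure \<Rightarrow> bool"
  where "self_dual_haar \<psi> \<mu> \<longleftrightarrow> haar_measure_field \<mu> \<and>
    (\<forall>f\<in>test_fun UNIV. \<forall>x. fourier_field \<psi> \<mu> (fourier_field \<psi> \<mu> f) x = f (- x))"

definition GL :: "('f::nonarch_local_field_0^'n^'n) set"
  where "GL = {g. invertible g}"

definition haar_units :: "'f::nonarch_local_field_0 measure \<Rightarrow> 'f measure"
  where "haar_units \<mu> = density (restrict_space \<mu> (- {0})) (\<lambda>x. ennreal (inverse (absv x)))"

definition haar_mat :: "'f::nonarch_local_field_0 measure \<Rightarrow> ('f^'n^'n) measure"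
  where "haar_mat \<mu> = distr (Pi\<^sub>M (UNIV :: ('n \<times> 'n) set) (\<lambda>_. \<mu>)) borel (\<lambda>X. \<chi> i j. X (i, j))"

definition haar_GL :: "'f::nonarch_local_field_0 measure \<Rightarrow> ('f^'n^'n) measure"
  where "haar_GL \<mu> = density (restrict_space (haar_mat \<mu>) GL)
                        (\<lambda>g. ennreal (inverse (absv (det g) ^ CARD('n))))"

definition det_fibre :: "'f \<Rightarrow> ('f::nonarch_local_field_0^'n^'n) set"
  where "det_fibre x = {g. det g = x}"

text \<open>
  \<open>det_fibre_measures \<mu> \<nu>\<close>: the family \<open>\<nu> x\<close>, for nonzero \<open>x\<close>, consists of invariant
  Radon measures on the fibres of the determinant which disintegrate the Haar measure of \<open>GL\<close>
  along the determinant. These properties pin down the family for almost every \<open>x\<close>.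
\<close>

definition det_fibre_measures ::
    "'f::nonarch_local_field_0 measure \<Rightarrow> ('f \<Rightarrow> ('f^'n^'n) measure) \<Rightarrow> bool"
  where "det_fibre_measures \<mu> \<nu> \<longleftrightarrow>
    (\<forall>x. x \<noteq> 0 \<longrightarrow>
       sets (\<nu> x) = sets (restrict_space borel (det_fibre x)) \<and>
       (\<forall>K. compact K \<and> K \<subseteq> det_fibre x \<longrightarrow> emeasure (\<nu> x) K < \<infinity>) \<and>
       (\<forall>s. det s = 1 \<longrightarrow> distr (\<nu> x) (\<nu> x) (\<lambda>g. s ** g) = \<nu> x \<and>
                            distr (\<nu> x) (\<nu> x) (\<lambda>g. g ** s) = \<nu> x)) \<and>
    (\<forall>f\<in>test_fun GL. (\<integral>g. f g \<partial>haar_GL \<mu>) = (\<integral>x. (\<integral>g. f g \<partial>\<nu> x) \<partial>haar_units \<mu>))"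

section \<open>Representations of \<open>GL\<close>\<close>

text \<open>
  A representation is given by a scalar multiplication of the complex numbers on an abelian group
  type, a subspace \<open>V\<close> and an action \<open>\<rho>\<close>; only the values of \<open>\<rho> g\<close> on \<open>V\<close> for invertible \<open>g\<close>
  matter. The carrier \<open>V\<close> is explicit because that of the contragredient is a proper subset of a
  function type.
\<close>

definition GL_rep ::
    "(complex \<Rightarrow> 'v \<Rightarrow> 'v::ab_group_add) \<Rightarrow> 'v set \<Rightarrow>
     ('f::nonarch_local_field_0^'n^'n \<Rightarrow> 'v \<Rightarrow> 'v) \<Rightarrow> bool"
  where "GL_rep sc V \<rho> \<longleftrightarrow>
    vector_space sc \<and> module.subspace sc V \<and>
    (\<forall>g\<in>GL. \<forall>v\<in>V. \<rho> g v \<in> V) \<and>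
    (\<forall>g\<in>GL. \<forall>v\<in>V. \<forall>w\<in>V. \<rho> g (v + w) = \<rho> g v + \<rho> g w) \<and>
    (\<forall>g\<in>GL. \<forall>a. \<forall>v\<in>V. \<rho> g (sc a v) = sc a (\<rho> g v)) \<and>
    (\<forall>v\<in>V. \<rho> (mat 1) v = v) \<and>
    (\<forall>g\<in>GL. \<forall>h\<in>GL. \<forall>v\<in>V. \<rho> (g ** h) v = \<rho> g (\<rho> h v))"

definition smooth_GL_rep ::
    "(complex \<Rightarrow> 'v \<Rightarrow> 'v::ab_group_add) \<Rightarrow> 'v set \<Rightarrow>
     ('f::nonarch_local_field_0^'n^'n \<Rightarrow> 'v \<Rightarrow> 'v) \<Rightarrow> bool"
  where "smooth_GL_rep sc V \<rho> \<longleftrightarrow>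
    GL_rep sc V \<rho> \<and> (\<forall>v\<in>V. open {g \<in> GL. \<rho> g v = v})"

definition irreducible_GL_rep ::
    "(complex \<Rightarrow> 'v \<Rightarrow> 'v::ab_group_add) \<Rightarrow> 'v set \<Rightarrow>
     ('f::nonarch_local_field_0^'n^'n \<Rightarrow> 'v \<Rightarrow> 'v) \<Rightarrow> bool"
  where "irreducible_GL_rep sc V \<rho> \<longleftrightarrow>
    GL_rep sc V \<rho> \<and> V \<noteq> {0} \<and>
    (\<forall>W. module.subspace sc W \<and> W \<subseteq> V \<and> (\<forall>g\<in>GL. \<forall>w\<in>W. \<rho> g w \<in> W) \<longrightarrow> W = {0} \<or> W = V)"

text \<open>
  Linear functionals on \<open>V\<close> are extended by zero off \<open>V\<close>, so that equality of functionals is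
  equality of functions. The contragredient is the subrepresentation of smooth vectors in the
  algebraic dual; its addition is the pointwise one on the function type.
\<close>

definition dual_space ::
    "(complex \<Rightarrow> 'v \<Rightarrow> 'v::ab_group_add) \<Rightarrow> 'v set \<Rightarrow> ('v \<Rightarrow> complex) set"
  where "dual_space sc V = {\<xi>. (\<forall>v. v \<notin> V \<longrightarrow> \<xi> v = 0) \<and>
    (\<forall>v\<in>V. \<forall>w\<in>V. \<xi> (v + w) = \<xi> v + \<xi> w) \<and> (\<forall>a. \<forall>v\<in>V. \<xi> (sc a v) = a * \<xi> v)}"

definition dual_scale :: "complex \<Rightarrow> ('v \<Rightarrow> complex) \<Rightarrow> 'v \<Rightarrow> complex"
  where "dual_scale a \<xi> = (\<lambda>v. a * \<xi> v)"

definition dual_action ::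
    "'v set \<Rightarrow> ('f::nonarch_local_field_0^'n^'n \<Rightarrow> 'v \<Rightarrow> 'v) \<Rightarrow>
     'f^'n^'n \<Rightarrow> ('v \<Rightarrow> complex) \<Rightarrow> 'v \<Rightarrow> complex"
  where "dual_action V \<rho> g \<xi> = (\<lambda>v. if v \<in> V then \<xi> (\<rho> (matrix_inv g) v) else 0)"

definition contragredient_space ::
    "(complex \<Rightarrow> 'v \<Rightarrow> 'v::ab_group_add) \<Rightarrow> 'v set \<Rightarrow>
     ('f::nonarch_local_field_0^'n^'n \<Rightarrow> 'v \<Rightarrow> 'v) \<Rightarrow> ('v \<Rightarrow> complex) set"
  where "contragredient_space sc V \<rho> =
    {\<xi> \<in> dual_space sc V. open {g \<in> GL. dual_action V \<rho> g \<xi> = \<xi>}}"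

definition matrix_coefficient ::
    "(complex \<Rightarrow> 'v \<Rightarrow> 'v::ab_group_add) \<Rightarrow> 'v set \<Rightarrow>
     ('f::nonarch_local_field_0^'n^'n \<Rightarrow> 'v \<Rightarrow> 'v) \<Rightarrow> ('f^'n^'n \<Rightarrow> complex) \<Rightarrow> bool"
  where "matrix_coefficient sc V \<rho> \<phi> \<longleftrightarrow>
    (\<exists>v\<in>V. \<exists>\<xi>\<in>contragredient_space sc V \<rho>. \<forall>g\<in>GL. \<phi> g = \<xi> (\<rho> g v))"

definition contragredient_coefficient ::
    "(complex \<Rightarrow> 'v \<Rightarrow> 'v::ab_group_add) \<Rightarrow> 'v set \<Rightarrow>
     ('f::nonarch_local_field_0^'n^'n \<Rightarrow> 'v \<Rightarrow> 'v) \<Rightarrow> ('f^'n^'n \<Rightarrow> complex) \<Rightarrow> bool"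
  where "contragredient_coefficient sc V \<rho> =
    matrix_coefficient dual_scale (contragredient_space sc V \<rho>) (dual_action V \<rho>)"

section \<open>The kernel function\<close>

definition inv_fun :: "('f::nonarch_local_field_0^'n^'n \<Rightarrow> complex) \<Rightarrow> 'f^'n^'n \<Rightarrow> complex"
  where "inv_fun f g = f (matrix_inv g)"

definition convolution ::
    "'f::nonarch_local_field_0 measure \<Rightarrow> ('f^'n^'n \<Rightarrow> complex) \<Rightarrow> ('f^'n^'n \<Rightarrow> complex) \<Rightarrow>
     'f^'n^'n \<Rightarrow> complex"
  where "convolution \<mu> f1 f2 g = (\<integral>h. f1 h * f2 (matrix_inv h ** g) \<partial>haar_GL \<mu>)"

definition Phi_GJ :: "('f::nonarch_local_field_0 \<Rightarrow> complex) \<Rightarrow> 'f^'n^'n \<Rightarrow> complex"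
  where "Phi_GJ \<psi> g = \<psi> (trace g) * of_real (absv (det g) powr (real CARD('n) / 2))"

definition delta_sequence ::
    "'f::nonarch_local_field_0 measure \<Rightarrow> (nat \<Rightarrow> 'f^'n^'n \<Rightarrow> complex) \<Rightarrow> bool"
  where "delta_sequence \<mu> c \<longleftrightarrow>
    (\<forall>l. c l \<in> test_fun GL) \<and>
    (\<exists>K. compact K \<and> K \<subseteq> GL \<and> mat 1 \<in> interior K \<and> (\<forall>l g. g \<notin> K \<longrightarrow> c l g = 0)) \<and>
    (\<forall>h\<in>smooth_fun GL. (\<lambda>l. \<integral>g. c l g * h g \<partial>haar_GL \<mu>) \<longlonglongrightarrow> h (mat 1))"

definition kernel_integrand ::
    "('f::nonarch_local_field_0 \<Rightarrow> complex) \<Rightarrow> 'f measure \<Rightarrow> ('f^'n^'n \<Rightarrow> complex) \<Rightarrow>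
     ('f^'n^'n \<Rightarrow> complex) \<Rightarrow> 'f^'n^'n \<Rightarrow> complex"
  where "kernel_integrand \<psi> \<mu> c \<phi> g = convolution \<mu> (Phi_GJ \<psi>) (inv_fun c) g * \<phi> g"

definition pi_kernel ::
    "('f::nonarch_local_field_0 \<Rightarrow> complex) \<Rightarrow> 'f measure \<Rightarrow> ('f \<Rightarrow> ('f^'n^'n) measure) \<Rightarrow>
     (nat \<Rightarrow> 'f^'n^'n \<Rightarrow> complex) \<Rightarrow> ('f^'n^'n \<Rightarrow> complex) \<Rightarrow> 'f \<Rightarrow> complex"
  where "pi_kernel \<psi> \<mu> \<nu> c \<phi> x = lim (\<lambda>l. \<integral>g. kernel_integrand \<psi> \<mu> (c l) \<phi> g \<partial>\<nu> x)"

text \<open>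
  The limit defining the kernel exists at every point, through absolutely convergent integrals,
  and the kernel is integrable against test functions; without this the values of \<open>lim\<close> and of
  the Bochner integral would be meaningless.
\<close>

definition pi_kernel_well_defined ::
    "('f::nonarch_local_field_0 \<Rightarrow> complex) \<Rightarrow> 'f measure \<Rightarrow> ('f \<Rightarrow> ('f^'n^'n) measure) \<Rightarrow>
     (nat \<Rightarrow> 'f^'n^'n \<Rightarrow> complex) \<Rightarrow> ('f^'n^'n \<Rightarrow> complex) \<Rightarrow> bool"
  where "pi_kernel_well_defined \<psi> \<mu> \<nu> c \<phi> \<longleftrightarrow>
    (\<forall>x. x \<noteq> 0 \<longrightarrow> (\<forall>l. integrable (\<nu> x) (kernel_integrand \<psi> \<mu> (c l) \<phi>)) \<and>
                     convergent (\<lambda>l. \<integral>g. kernel_integrand \<psi> \<mu> (c l) \<phi> g \<partial>\<nu> x)) \<and>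
    (\<forall>f\<in>test_fun (- {0}). integrable (haar_units \<mu>) (\<lambda>x. pi_kernel \<psi> \<mu> \<nu> c \<phi> x * f x))"

definition pi_kernel_distribution ::
    "('f::nonarch_local_field_0 \<Rightarrow> complex) \<Rightarrow> 'f measure \<Rightarrow> ('f \<Rightarrow> ('f^'n^'n) measure) \<Rightarrow>
     (nat \<Rightarrow> 'f^'n^'n \<Rightarrow> complex) \<Rightarrow> ('f^'n^'n \<Rightarrow> complex) \<Rightarrow> ('f \<Rightarrow> complex) \<Rightarrow> complex"
  where "pi_kernel_distribution \<psi> \<mu> \<nu> c \<phi> f = (\<integral>x. pi_kernel \<psi> \<mu> \<nu> c \<phi> x * f x \<partial>haar_units \<mu>)"

end

theory Submission
  imports Defs "HOL-Computational_Algebra.Fundamental_Theorem_Algebra"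
begin

text \<open>
  Write \<open>\<Phi>\<close> for \<open>Phi_GJ \<psi>\<close> and \<open>|g|\<close> for the largest absolute value of an entry of \<open>g\<close>. Left invariance
  turns the convolution into \<open>g \<mapsto> \<integral> \<Phi>(g u) c(u) du\<close>, essentially the Fourier transform of a test function
  on the matrix space, hence of bounded support. The kernel is thus a limit of absolutely
  convergent integrals over a fibre of the determinant, and exchanging the integrations leads to
  \<open>H(u) = \<integral> \<Phi>(g u) \<phi>(g) d\<^sub>xg\<close>, whose integral does not converge absolutely.

  The way out is cancellation. A matrix coefficient \<open>\<phi>\<close> is invariant under right translation by
  matrices close to the identity. If \<open>|y|\<close> is large while \<open>det y\<close> is bounded, then \<open>y\<close> is not nearly
  scalar, so some \<open>N\<close> with \<open>N ** N = 0\<close> from a bounded family satisfies \<open>|tr (y N)| = |y|\<close>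
  (\<open>nilp_detects\<close>). Translation by \<open>mat 1 + t N\<close> with small \<open>t\<close> preserves the fibre, its measure and
  \<open>\<phi>\<close>, and multiplies \<open>\<psi>(tr y)\<close> by \<open>\<psi>(t tr (y N))\<close>, which differs from 1 for a suitable \<open>t\<close>. Hence the part
  of the integral over the matrices \<open>g\<close> of large norm is zero (\<open>fibre_cancellation\<close>), and \<open>H\<close> may be computed by a
  truncated integral. The truncated \<open>H\<close> is locally constant, so a delta sequence turns it into
  \<open>H(mat 1)\<close> (\<open>kernel_limit\<close>). Neither the existence of the limit nor its value depends on the sequence.

  Integrating over the determinant, the kernel tested against \<open>f\<close> becomes
  \<open>\<integral> \<Phi>(g) f(det g) \<phi>(g) dg\<close> over the matrices with \<open>|g| \<le> R\<close>, for any large \<open>R\<close> (\<open>pi_kernel_properties\<close>). The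
  function \<open>\<Phi>(g) f(det g)\<close> is invariant under conjugation. Integrated against the operators of \<open>g^-1\<close> in
  the representation, again with a truncation that does not matter because of cancellation, it
  defines an operator that commutes with the group. An irreducible smooth representation has
  countable dimension, so by Schur's lemma this operator is a scalar \<open>z\<close> (\<open>represents_scalar\<close>). On the
  contragredient the same function acts by the transposed operator, hence by \<open>z\<close> too, and every
  coefficient of the contragredient gives the value \<open>z * \<phi> (mat 1)\<close> (\<open>coefficient_integral\<close>).

  The measure on the group is only accessible through its disintegration and through products of the
  measure of the field. Invariance under matrices of determinant one is inherited from the
  fibres; for one diagonal matrix of each determinant it follows from volumes of boxes.
\<close>

section \<open>Local fields as metric spaces\<close>

lemma absv_0 [simp]: "absv (0::'f::nonarch_local_field_0) = 0"
  by (simp add: absv_eq_zero_iff)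

lemma absv_nonneg [simp]: "absv (x::'f::nonarch_local_field_0) \<ge> 0"
  using zero_le_dist[of x 0] by (simp add: dist_absv del: zero_le_dist)

lemma absv_pos_iff [simp]: "absv (x::'f::nonarch_local_field_0) > 0 \<longleftrightarrow> x \<noteq> 0"
  using absv_nonneg[of x] absv_eq_zero_iff[of x] by linarith

lemma absv_1 [simp]: "absv (1::'f::nonarch_local_field_0) = 1"
  using absv_mult[of "1::'f" 1] absv_eq_zero_iff[of "1::'f"] by simp

lemma absv_minus [simp]: "absv (- x) = absv (x::'f::nonarch_local_field_0)"
  using dist_commute[of x 0] by (simp add: dist_absv)

lemma absv_minus_commute: "absv (x - y) = absv (y - x::'f::nonarch_local_field_0)"
  using dist_commute[of x y] by (simp add: dist_absv)

lemma absv_inverse [simp]: "absv (inverse x) = inverse (absv (x::'f::nonarch_local_field_0))"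
proof (cases "x = 0")
  case False
  have "absv x * absv (inverse x) = 1" using False by (simp flip: absv_mult)
  then show ?thesis by (metis inverse_unique)
qed simp

lemma absv_divide: "absv (x / y) = absv x / absv (y::'f::nonarch_local_field_0)"
  by (simp add: divide_inverse absv_mult)

lemma absv_power: "absv (x ^ n) = absv (x::'f::nonarch_local_field_0) ^ n"
  by (induction n) (auto simp: absv_mult)

lemma absv_prod: "absv (prod f A) = (\<Prod>i\<in>A. absv (f i :: 'f::nonarch_local_field_0))"
  by (induction A rule: infinite_finite_induct) (auto simp: absv_mult)

lemma absv_add_le: "absv x \<le> r \<Longrightarrow> absv y \<le> r \<Longrightarrow> absv (x + y::'f::nonarch_local_field_0) \<le> r"
  using absv_ultrametric[of x y] by simp

lemma absv_diff_le: "absv x \<le> r \<Longrightarrow> absv y \<le> r \<Longrightarrow> absv (x - y::'f::nonarch_local_field_0) \<le> r"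
  using absv_add_le[of x r "-y"] by simp

lemma absv_add_less: "absv x < r \<Longrightarrow> absv y < r \<Longrightarrow> absv (x + y::'f::nonarch_local_field_0) < r"
  using absv_ultrametric[of x y] by simp

lemma absv_add_eq: "absv y < absv x \<Longrightarrow> absv (x + y) = absv (x::'f::nonarch_local_field_0)"
  using absv_ultrametric[of x y] absv_ultrametric[of "x + y" "- y"] by auto

lemma absv_sum_le:
  "(\<And>i. i \<in> A \<Longrightarrow> absv (f i :: 'f::nonarch_local_field_0) \<le> r) \<Longrightarrow> 0 \<le> r \<Longrightarrow> absv (sum f A) \<le> r"
  by (induction A rule: infinite_finite_induct) (auto intro: absv_add_le)

lemma absv_sum_less:
  "(\<And>i. i \<in> A \<Longrightarrow> absv (f i :: 'f::nonarch_local_field_0) < r) \<Longrightarrow> 0 < r \<Longrightarrow> absv (sum f A) < r"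
  by (induction A rule: infinite_finite_induct) (auto intro: absv_add_less)

lemma absv_power_int: "absv (x powi k) = absv (x::'f::nonarch_local_field_0) powi k"
  by (simp add: power_int_def absv_power)

definition residue_card :: "'f::nonarch_local_field_0 itself \<Rightarrow> nat"
  where "residue_card _ = card ((\<lambda>x::'f. {y. absv (y - x) < 1}) ` {x. absv x \<le> 1})"

lemma residue_card_ge_2: "residue_card TYPE('f::nonarch_local_field_0) \<ge> 2"
proof -
  let ?c = "\<lambda>x::'f. {y. absv (y - x) < 1}"
  have "?c 0 \<noteq> ?c 1" by (auto simp: set_eq_iff intro!: exI[of _ 0])
  then have "card {?c 0, ?c 1} = 2" by simp
  moreover have "card {?c 0, ?c 1} \<le> residue_card TYPE('f)"
    unfolding residue_card_def
    by (rule card_mono[OF finite_residue_field]) (auto simp: image_iff intro: exI[of _ 0] exI[of _ 1])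
  ultimately show ?thesis by simp
qed

lemma uniformizer_exists:
  obtains w :: "'f::nonarch_local_field_0" where "uniformizer w"
    "absv w = 1 / real (residue_card TYPE('f))"
proof -
  obtain w :: 'f where w: "absv w = 1 / real (residue_card TYPE('f))"
      "\<forall>x::'f. absv x < 1 \<longrightarrow> absv x \<le> absv w"
    using absv_normalized[where 'a = 'f] unfolding residue_card_def by blast
  have q: "real (residue_card TYPE('f)) \<ge> 2" using residue_card_ge_2[where 'f = 'f] by linarith
  then have "absv w > 0" "absv w < 1" unfolding w(1) by (simp_all add: divide_less_eq)
  moreover have "w \<noteq> 0" using \<open>absv w > 0\<close> by simp
  ultimately have "uniformizer w" using w by (simp add: uniformizer_def)
  then show ?thesis using that[of w] w(1) by blast
qed

lemma power_int_bracket: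
  fixes q r :: real
  assumes "q > 1" "r > 0"
  obtains k where "q powi k \<le> r" "r < q powi (k + 1)"
proof (rule that)
  let ?k = "\<lfloor>log q r\<rfloor>"
  have eq: "q powi m = q powr real_of_int m" for m
    using assms by (simp add: powr_real_of_int')
  show "q powi ?k \<le> r" "r < q powi (?k + 1)"
    using assms floor_correct[of "log q r"] unfolding eq
    by (auto simp: powr_le_iff le_log_iff less_powr_iff log_less_iff)
qed

text \<open>A generator \<open>w\<close> of the maximal ideal has the largest absolute value \<open>1 / q\<close> below 1. Multiplying
  \<open>x\<close> by the power of \<open>w\<close> that brings its absolute value into \<open>[1, q)\<close> therefore leaves a unit.\<close>

lemma absv_eq_power_int:
  fixes x :: "'f::nonarch_local_field_0"
  assumes "x \<noteq> 0"
  obtains k where "absv x = real (residue_card TYPE('f)) powi k"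
proof -
  define q where "q = real (residue_card TYPE('f))"
  have q: "q \<ge> 2" using residue_card_ge_2[where 'f = 'f] by (simp add: q_def)
  obtain w :: 'f where w: "uniformizer w" "absv w = 1 / q"
    using uniformizer_exists unfolding q_def by blast
  obtain k where k: "q powi k \<le> absv x" "absv x < q powi (k + 1)"
    using power_int_bracket[of q "absv x"] q assms by auto
  define y where "y = x * w powi k"
  have ay: "absv y = absv x / q powi k"
    by (simp add: y_def absv_mult absv_power_int w(2) power_int_divide_distrib divide_simps)
  have "1 \<le> absv y" "absv y < q"
    using k q by (auto simp: ay divide_simps power_int_add mult.commute)
  moreover have "absv (inverse y) < 1 \<longrightarrow> absv (inverse y) \<le> absv w"
    using w(1) unfolding uniformizer_def by blast
  ultimately have "absv y = 1"
    using q w(2) less_imp_inverse_less[of 1 "absv y"] less_imp_inverse_less[of "absv y" q]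
    unfolding absv_inverse by (cases "absv y = 1") (auto simp: inverse_eq_divide simp flip: absv_pos_iff)
  then have "absv x = q powi k" using ay q by (auto simp: divide_simps split: if_splits)
  then show ?thesis using that q_def by blast
qed

text \<open>As the absolute values are discrete, every ball has a radius that is an absolute value; such a
  ball is a multiple of the ring of integers.\<close>

lemma closed_ball_eq_scaled_integers:
  fixes r :: real
  assumes "r > 0"
  obtains b :: "'f::nonarch_local_field_0" where "b \<noteq> 0" "absv b \<le> r"
    "\<And>x::'f. absv x \<le> r \<longleftrightarrow> absv x \<le> absv b"
proof -
  define q where "q = real (residue_card TYPE('f))"
  have q: "q \<ge> 2" using residue_card_ge_2[where 'f = 'f] by (simp add: q_def)
  obtain w :: 'f where w: "uniformizer w" "absv w = 1 / q"
    using uniformizer_exists unfolding q_def by blast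
  obtain k where k: "q powi k \<le> r" "r < q powi (k + 1)"
    using power_int_bracket[of q r] q assms by auto
  define b where "b = w powi (- k)"
  have ab: "absv b = q powi k"
    by (simp add: b_def absv_power_int w(2) power_int_minus power_int_divide_distrib)
  have "absv x \<le> absv b" if "absv x \<le> r" for x :: 'f
  proof (cases "x = 0")
    case False
    then obtain m where m: "absv x = q powi m" using absv_eq_power_int unfolding q_def by blast
    then have "q powi m < q powi (k + 1)" using that k by simp
    moreover have eq: "q powi i = q powr real_of_int i" for i
      using q by (simp add: powr_real_of_int')
    ultimately have "m < k + 1" using q unfolding eq by simp
    then show ?thesis using q unfolding ab m eq by simp
  qed simp
  moreover have "b \<noteq> 0" using w by (simp add: b_def uniformizer_def)
  ultimately show ?thesis using that[of b] k ab by fastforce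
qed

instance nonarch_local_field_0 \<subseteq> topological_ab_group_add
proof
  fix a b :: 'a
  have *: "(g \<longlongrightarrow> 0) F" if "eventually (\<lambda>x. 0 \<le> g x \<and> g x \<le> h x) F" "(h \<longlongrightarrow> 0) F"
    for g h :: "'a \<times> 'a \<Rightarrow> real" and F
    using that by (intro tendsto_sandwich[of "\<lambda>_. 0" g F h]) (auto elim: eventually_mono)
  show "LIM x nhds a \<times>\<^sub>F nhds b. fst x + snd x :> nhds (a + b)"
    unfolding nhds_prod[symmetric]
  proof (rule tendsto_dist_iff[THEN iffD2], rule *)
    show "((\<lambda>x. dist (fst x) a + dist (snd x) b) \<longlongrightarrow> 0) (nhds (a, b))"
      by (rule tendsto_eq_intros tendsto_fst tendsto_snd filterlim_ident refl | simp)+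
    show "\<forall>\<^sub>F x in nhds (a, b). 0 \<le> dist (fst x + snd x) (a + b) \<and>
        dist (fst x + snd x) (a + b) \<le> dist (fst x) a + dist (snd x) b"
    proof (intro always_eventually allI conjI)
      fix x :: "'a \<times> 'a"
      have eq: "fst x + snd x - (a + b) = (fst x - a) + (snd x - b)" by simp
      show "dist (fst x + snd x) (a + b) \<le> dist (fst x) a + dist (snd x) b"
        using absv_ultrametric[of "fst x - a" "snd x - b"] absv_nonneg[of "fst x - a"]
          absv_nonneg[of "snd x - b"] unfolding dist_absv eq by linarith
    qed simp
  qed
  have "dist (- x) (- a) = dist x a" for x
    using absv_minus_commute[of x a] by (simp add: dist_absv)
  then show "(uminus \<longlongrightarrow> - a) (nhds a)"
    using tendsto_dist_iff[of uminus "- a" "nhds a"] tendsto_dist_iff[of "\<lambda>x. x" a "nhds a"]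
    by (simp add: filterlim_ident)
qed

instance nonarch_local_field_0 \<subseteq> topological_semigroup_mult
proof
  fix a b :: 'a
  have "((\<lambda>x. dist (fst x * snd x) (a * b)) \<longlongrightarrow> 0) (nhds (a, b))"
  proof (rule tendsto_sandwich[of "\<lambda>_. 0"])
    show "((\<lambda>x. dist (fst x) a * dist (snd x) b + absv a * dist (snd x) b + dist (fst x) a * absv b)
        \<longlongrightarrow> 0) (nhds (a, b))"
      by (rule tendsto_eq_intros tendsto_fst tendsto_snd filterlim_ident refl | simp)+
    show "\<forall>\<^sub>F x in nhds (a, b). dist (fst x * snd x) (a * b) \<le>
        dist (fst x) a * dist (snd x) b + absv a * dist (snd x) b + dist (fst x) a * absv b"
    proof (intro always_eventually allI)
      fix x :: "'a \<times> 'a"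
      let ?u = "fst x - a" and ?v = "snd x - b"
      have eq: "fst x * snd x - a * b = (?u * ?v + a * ?v) + ?u * b" by (simp add: algebra_simps)
      have "absv ((?u * ?v + a * ?v) + ?u * b)
          \<le> max (max (absv (?u * ?v)) (absv (a * ?v))) (absv (?u * b))"
        using absv_ultrametric[of "?u * ?v + a * ?v" "?u * b"] absv_ultrametric[of "?u * ?v" "a * ?v"]
        by linarith
      moreover have "absv (?u * ?v) \<ge> 0" "absv (a * ?v) \<ge> 0" "absv (?u * b) \<ge> 0" by simp_all
      ultimately show "dist (fst x * snd x) (a * b) \<le>
          dist (fst x) a * dist (snd x) b + absv a * dist (snd x) b + dist (fst x) a * absv b"
        unfolding dist_absv absv_mult[symmetric] eq by linarith
    qed
  qed auto
  then show "LIM x nhds a \<times>\<^sub>F nhds b. fst x * snd x :> nhds (a * b)"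
    unfolding nhds_prod[symmetric] by (rule tendsto_dist_iff[THEN iffD2])
qed

instance nonarch_local_field_0 \<subseteq> topological_comm_monoid_mult ..

text \<open>The residue classes, transported to a ball of arbitrary radius \<open>r\<close> by a scalar \<open>b\<close>. The second
  radius \<open>r / q\<close> need not be an absolute value; only the ball that it defines matters.\<close>

lemma closed_ball_decomposition:
  fixes r :: real
  assumes "r > 0"
  obtains C :: "'f::nonarch_local_field_0 set" where "finite C" "card C = residue_card TYPE('f)"
    "{x. absv x \<le> r} = (\<Union>c\<in>C. {x. absv (x - c) \<le> r / residue_card TYPE('f)})"
    "disjoint_family_on (\<lambda>c. {x. absv (x - c) \<le> r / residue_card TYPE('f)}) C"
proof -
  define q where "q = real (residue_card TYPE('f))"
  have q: "q \<ge> 2" using residue_card_ge_2[where 'f = 'f] by (simp add: q_def)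
  obtain w :: 'f where w: "uniformizer w" "absv w = 1 / q"
    using uniformizer_exists unfolding q_def by blast
  obtain b :: 'f where b: "b \<noteq> 0" "absv b \<le> r" "\<And>x::'f. absv x \<le> r \<longleftrightarrow> absv x \<le> absv b"
    using closed_ball_eq_scaled_integers[OF assms] by blast
  have lt: "absv x < 1 \<longleftrightarrow> absv x \<le> 1 / q" for x :: 'f
    using w by (auto simp: uniformizer_def)
  have b': "absv x \<le> r / q \<longleftrightarrow> absv x \<le> absv b / q" for x :: 'f
    using b(3)[of "x / w"] q w(2) by (simp add: absv_divide field_simps)
  let ?c = "\<lambda>x::'f. {y. absv (y - x) < 1}"
  define D where "D = (\<lambda>S. SOME x. absv x \<le> 1 \<and> S = ?c x) ` (?c ` {x. absv x \<le> 1})"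
  have sel: "absv (SOME z. absv z \<le> 1 \<and> ?c x = ?c z) \<le> 1 \<and> ?c x = ?c (SOME z. absv z \<le> 1 \<and> ?c x = ?c z)"
    if "absv x \<le> 1" for x using someI[of "\<lambda>z. absv z \<le> 1 \<and> ?c x = ?c z" x] that by blast
  have inj: "inj_on (\<lambda>S. SOME x. absv x \<le> 1 \<and> S = ?c x) (?c ` {x. absv x \<le> 1})"
  proof (rule inj_onI)
    fix S T assume "S \<in> ?c ` {x. absv x \<le> 1}" "T \<in> ?c ` {x. absv x \<le> 1}"
      and eq: "(SOME x. absv x \<le> 1 \<and> S = ?c x) = (SOME x. absv x \<le> 1 \<and> T = ?c x)"
    then obtain x y where "S = ?c x" "absv x \<le> 1" "T = ?c y" "absv y \<le> 1" by auto
    then show "S = T" using sel[of x] sel[of y] eq by metis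
  qed
  have D1: "d \<in> D \<Longrightarrow> absv d \<le> 1" for d
    using sel unfolding D_def by auto
  have cover: "\<exists>d\<in>D. absv (x - d) < 1" if x: "absv x \<le> 1" for x
  proof -
    let ?d = "SOME z. absv z \<le> 1 \<and> ?c x = ?c z"
    have "?d \<in> D" using x unfolding D_def by blast
    moreover have "x \<in> ?c x" by simp
    then have "x \<in> ?c ?d" using sel[OF x] by blast
    ultimately show ?thesis by blast
  qed
  have sep: "d = e" if "d \<in> D" "e \<in> D" "absv (d - e) < 1" for d e
  proof -
    obtain x where x: "absv x \<le> 1" "d = (SOME z. absv z \<le> 1 \<and> ?c x = ?c z)" using \<open>d \<in> D\<close> by (auto simp: D_def)
    obtain y where y: "absv y \<le> 1" "e = (SOME z. absv z \<le> 1 \<and> ?c y = ?c z)" using \<open>e \<in> D\<close> by (auto simp: D_def)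
    have "?c d = ?c e"
    proof (intro set_eqI)
      fix z
      have "z - e = (z - d) + (d - e)" "z - d = (z - e) + - (d - e)" by auto
      then show "z \<in> ?c d \<longleftrightarrow> z \<in> ?c e"
        using that(3) absv_add_less[of "z - d" 1 "d - e"] absv_add_less[of "z - e" 1 "- (d - e)"]
        by (metis absv_minus mem_Collect_eq)
    qed
    then have "?c x = ?c y" using sel[OF x(1)] sel[OF y(1)] x(2) y(2) by metis
    then show ?thesis using x(2) y(2) by metis
  qed
  define C where "C = (\<lambda>d. b * d) ` D"
  have key: "absv (b * y - b * d) \<le> r / q \<longleftrightarrow> absv (y - d) < 1" for y d
  proof -
    have "absv (b * y - b * d) \<le> r / q \<longleftrightarrow> absv b * absv (y - d) \<le> absv b * (1 / q)"
      unfolding right_diff_distrib[symmetric] b' by (simp add: absv_mult)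
    also have "\<dots> \<longleftrightarrow> absv (y - d) < 1"
      using mult_le_cancel_left_pos[of "absv b" "absv (y - d)" "1 / q"] b(1) lt by simp
    finally show ?thesis .
  qed
  show ?thesis
  proof
    show "finite C" unfolding C_def D_def using finite_residue_field[where 'a='f] by simp
    have "inj_on (\<lambda>d. b * d) D" using b(1) by (auto intro: inj_onI)
    then show "card C = residue_card TYPE('f)"
      unfolding C_def residue_card_def D_def using card_image[OF inj] by (simp add: card_image)
    show "{x. absv x \<le> r} = (\<Union>c\<in>C. {x. absv (x - c) \<le> r / residue_card TYPE('f)})"
    proof (intro set_eqI iffI)
      fix x :: 'f assume "x \<in> {x. absv x \<le> r}"
      then have "absv (x / b) \<le> 1" using b by (auto simp: absv_divide divide_simps)
      then obtain d where d: "d \<in> D" "absv (x / b - d) < 1" using cover by blast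
      then have "absv (b * (x / b) - b * d) \<le> r / q" using key by blast
      then show "x \<in> (\<Union>c\<in>C. {x. absv (x - c) \<le> r / residue_card TYPE('f)})"
        using d b(1) by (auto simp: C_def q_def)
    next
      fix x :: 'f assume "x \<in> (\<Union>c\<in>C. {x. absv (x - c) \<le> r / residue_card TYPE('f)})"
      then obtain d where d: "d \<in> D" "absv (x - b * d) \<le> r / q" by (auto simp: C_def q_def)
      have "absv (b * d) \<le> r" using D1[OF d(1)] b(2) mult_left_le[of "absv d" "absv b"] by (auto simp: absv_mult)
      moreover have "r / q \<le> r" using q assms by (simp add: field_simps)
      ultimately show "x \<in> {x. absv x \<le> r}"
        using absv_add_le[of "x - b * d" r "b * d"] d(2) by simp
    qed
    show "disjoint_family_on (\<lambda>c. {x. absv (x - c) \<le> r / residue_card TYPE('f)}) C"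
      unfolding disjoint_family_on_def
    proof (intro ballI impI)
      fix c c' assume "c \<in> C" "c' \<in> C" "c \<noteq> c'"
      then obtain d e where de: "d \<in> D" "e \<in> D" "d \<noteq> e" "c = b * d" "c' = b * e" by (auto simp: C_def)
      have False if "absv (x - c) \<le> r / q" "absv (x - c') \<le> r / q" for x :: 'f
      proof -
        have "c' - c = (x - c) - (x - c')" by simp
        then have "absv (b * e - b * d) \<le> r / q" using absv_diff_le[OF that] de by simp
        then show False using key sep[OF de(2,1)] de(3) by auto
      qed
      then show "{x. absv (x - c) \<le> r / residue_card TYPE('f)} \<inter> {x. absv (x - c') \<le> r / residue_card TYPE('f)} = {}"
        by (auto simp: q_def)
    qed
  qed
qed

text \<open>Decomposing a ball again and again into finitely many smaller ones shows that it is totally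
  bounded.\<close>

lemma compact_closed_ball_absv: "compact {x::'f::nonarch_local_field_0. absv x \<le> r}"
proof (cases "r > 0")
  case True
  define q where "q = real (residue_card TYPE('f))"
  have q: "q \<ge> 2" using residue_card_ge_2[where 'f = 'f] by (simp add: q_def)
  have fin: "\<exists>C. finite C \<and> {x::'f. absv x \<le> r} \<subseteq> (\<Union>c\<in>C. {x. absv (x - c) \<le> r / q ^ n})" for n
  proof (induction n)
    case 0
    show ?case by (rule exI[of _ "{0}"]) simp
  next
    case (Suc n)
    then obtain C :: "'f set" where C: "finite C" "{x. absv x \<le> r} \<subseteq> (\<Union>c\<in>C. {x. absv (x - c) \<le> r / q ^ n})" by blast
    have "r / q ^ n > 0" using True q by simp
    then obtain B :: "'f set" where B: "finite B" "{x. absv x \<le> r / q ^ n} = (\<Union>c\<in>B. {x. absv (x - c) \<le> r / q ^ n / q})"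
      using closed_ball_decomposition[of "r / q ^ n", where 'f = 'f] unfolding q_def by metis
    show ?case
    proof (intro exI[of _ "(\<lambda>(b, c). b + c) ` (B \<times> C)"] conjI subsetI)
      fix x :: 'f assume "x \<in> {x. absv x \<le> r}"
      then obtain c where c: "c \<in> C" "absv (x - c) \<le> r / q ^ n" using C by blast
      then have "x - c \<in> {x. absv x \<le> r / q ^ n}" by simp
      then obtain b where "b \<in> B" "absv (x - c - b) \<le> r / q ^ n / q" unfolding B(2) by blast
      then show "x \<in> (\<Union>c\<in>(\<lambda>(b, c). b + c) ` (B \<times> C). {x. absv (x - c) \<le> r / q ^ Suc n})"
        using c(1) by (intro UN_I[of "b + c"]) (auto simp: diff_diff_eq add.commute mult.commute)
    qed (use B C in auto)
  qed
  have "{x::'f. absv x \<le> r} = cball 0 r" by (auto simp: dist_absv)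
  then have "complete {x::'f. absv x \<le> r}" by (simp add: complete_eq_closed)
  moreover have "\<exists>k. finite k \<and> {x::'f. absv x \<le> r} \<subseteq> (\<Union>x\<in>k. ball x e)" if "e > 0" for e :: real
  proof -
    obtain n where "(1 / q) ^ n < e / r" using real_arch_pow_inv[of "e / r" "1 / q"] q True \<open>e > 0\<close> by auto
    then have n: "r / q ^ n < e" using True by (simp add: field_simps power_divide)
    obtain C where C: "finite C" "{x::'f. absv x \<le> r} \<subseteq> (\<Union>c\<in>C. {x. absv (x - c) \<le> r / q ^ n})" using fin by blast
    have "(\<Union>c\<in>C. {x. absv (x - c) \<le> r / q ^ n}) \<subseteq> (\<Union>c\<in>C. ball c e)"
    proof
      fix x :: 'f assume "x \<in> (\<Union>c\<in>C. {x. absv (x - c) \<le> r / q ^ n})"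
      then obtain c where "c \<in> C" "absv (x - c) \<le> r / q ^ n" by auto
      then have "c \<in> C" "absv (c - x) < e" using n absv_minus_commute[of x c] by auto
      then show "x \<in> (\<Union>c\<in>C. ball c e)" by (auto simp: dist_absv)
    qed
    with C(2) have "{x::'f. absv x \<le> r} \<subseteq> (\<Union>c\<in>C. ball c e)" by (rule subset_trans)
    with C(1) show ?thesis by (intro exI[of _ C] conjI)
  qed
  ultimately show ?thesis by (simp add: compact_eq_totally_bounded)
next
  case False
  then have "x = 0" if "absv x \<le> r" for x :: 'f
    using that absv_nonneg[of x] absv_eq_zero_iff[of x] by linarith
  then have "{x::'f. absv x \<le> r} \<subseteq> {0}" by auto
  then show ?thesis by (metis finite.emptyI finite_imp_compact finite_insert finite_subset)
qed

instance nonarch_local_field_0 \<subseteq> heine_borel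
proof
  fix f :: "nat \<Rightarrow> 'a"
  assume "bounded (range f)"
  then obtain e where "\<forall>y\<in>range f. dist 0 y \<le> e" using bounded_any_center by blast
  then have "\<forall>n. f n \<in> {x. absv x \<le> e}" by (simp add: dist_absv)
  then show "\<exists>l r. strict_mono r \<and> (f \<circ> r) \<longlonglongrightarrow> l"
    using compact_closed_ball_absv[of e, unfolded compact_eq_seq_compact_metric] unfolding seq_compact_def by blast
qed

text \<open>A space whose closed balls are compact is separable: finite nets for finer and finer scales in
  larger and larger balls form a countable dense set.\<close>

lemma heine_borel_countable_dense:
  obtains D :: "'a::heine_borel set" where "countable D" "\<And>x e. e > 0 \<Longrightarrow> \<exists>d\<in>D. dist x d < e"
proof -
  fix a :: 'a
  have "\<exists>C. finite C \<and> cball a (real n) \<subseteq> (\<Union>c\<in>C. ball c (1 / Suc m))" for n m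
    using compact_eq_totally_bounded[of "cball a (real n)"] by simp
  then obtain C where C: "\<And>n m. finite (C n m)"
      "\<And>n m. cball a (real n) \<subseteq> (\<Union>c\<in>C n m. ball c (1 / Suc m))" by metis
  have "\<exists>d\<in>(\<Union>n. \<Union>m. C n m). dist x d < e" if e: "e > 0" for x e
  proof -
    obtain n where "dist a x \<le> real n" using real_arch_simple by blast
    moreover obtain m where "1 / Suc m < e" using nat_approx_posE[OF e] by blast
    ultimately show ?thesis using C(2)[of n m] by (force simp: dist_commute)
  qed
  then show ?thesis using that[of "\<Union>n. \<Union>m. C n m"] C(1) by (auto simp: countable_finite)
qed

instance nonarch_local_field_0 \<subseteq> second_countable_topology
proof
  obtain D :: "'a set" where D: "countable D" "\<And>x e. e > 0 \<Longrightarrow> \<exists>d\<in>D. dist x d < e"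
    using heine_borel_countable_dense by blast
  let ?B = "(\<lambda>(d, n). ball d (1 / Suc n)) ` (D \<times> (UNIV :: nat set))"
  have "topological_basis ?B"
  proof (rule topological_basisI)
    fix S :: "'a set" and x assume "open S" "x \<in> S"
    then obtain e where e: "e > 0" "ball x e \<subseteq> S" using open_contains_ball by blast
    obtain n where n: "1 / Suc n < e / 2" using nat_approx_posE[of "e / 2"] e by auto
    obtain d where d: "d \<in> D" "dist x d < 1 / Suc n" using D(2)[of "1 / Suc n" x] by auto
    have "ball d (1 / Suc n) \<subseteq> ball x e"
    proof
      fix y assume "y \<in> ball d (1 / Suc n)"
      then show "y \<in> ball x e" using d n dist_triangle[of x y d] by simp
    qed
    then show "\<exists>B'\<in>?B. x \<in> B' \<and> B' \<subseteq> S" using d e by (force simp: dist_commute)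
  qed auto
  then show "\<exists>B::'a set set. countable B \<and> open = generate_topology B"
    using D(1) topological_basis_imp_subbasis[of ?B] by (intro exI[of _ ?B]) auto
qed

section \<open>Matrices over a local field\<close>

definition mnorm :: "'f::nonarch_local_field_0^'n^'n \<Rightarrow> real"
  where "mnorm A = Max (range (\<lambda>(i, j). absv (A $ i $ j)))"

definition mball :: "'f::nonarch_local_field_0^'n^'n \<Rightarrow> real \<Rightarrow> ('f^'n^'n) set"
  where "mball a r = {y. mnorm (y - a) \<le> r}"

lemma mnorm_le_iff: "mnorm A \<le> r \<longleftrightarrow> (\<forall>i j. absv (A $ i $ j) \<le> r)"
  unfolding mnorm_def by (subst Max_le_iff) auto

lemma absv_entry_le: "absv (A $ i $ j) \<le> mnorm A"
  using mnorm_le_iff[of A "mnorm A"] by simp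

lemma mnorm_attained: obtains i j where "mnorm A = absv (A $ i $ j)"
proof -
  have "mnorm A \<in> range (\<lambda>(i, j). absv (A $ i $ j))"
    unfolding mnorm_def by (rule Max_in) auto
  then show ?thesis using that by auto
qed

lemma mnorm_nonneg [simp]: "0 \<le> mnorm A"
  using mnorm_attained[of A] by (metis absv_nonneg)

lemma mnorm_0 [simp]: "mnorm 0 = 0"
  by (rule antisym) (simp_all add: mnorm_le_iff)

lemma mnorm_eq_0 [simp]: "mnorm A = 0 \<longleftrightarrow> A = 0"
proof
  assume "mnorm A = 0"
  then have "absv (A $ i $ j) = 0" for i j
    using absv_entry_le[of A i j] absv_nonneg[of "A $ i $ j"] by linarith
  then show "A = 0" by (simp add: vec_eq_iff absv_eq_zero_iff)
qed simp

lemma mnorm_minus [simp]: "mnorm (- A) = mnorm A"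
  by (simp add: mnorm_def)

lemma mnorm_minus_commute: "mnorm (A - B) = mnorm (B - A)"
  using mnorm_minus[of "A - B"] by simp

lemma mnorm_add_le: "mnorm A \<le> r \<Longrightarrow> mnorm B \<le> r \<Longrightarrow> mnorm (A + B) \<le> r"
  by (auto simp: mnorm_le_iff intro: absv_add_le)

lemma mnorm_diff_le: "mnorm A \<le> r \<Longrightarrow> mnorm B \<le> r \<Longrightarrow> mnorm (A - B) \<le> r"
  by (auto simp: mnorm_le_iff intro: absv_diff_le)

lemma mnorm_add_eq:
  assumes "mnorm B < mnorm A"
  shows "mnorm (A + B) = mnorm A"
proof (rule antisym)
  show "mnorm (A + B) \<le> mnorm A" using assms by (intro mnorm_add_le) auto
  show "mnorm A \<le> mnorm (A + B)"
  proof (rule ccontr)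
    assume "\<not> ?thesis"
    then obtain r where "mnorm (A + B) \<le> r" "mnorm B \<le> r" "r < mnorm A"
      using assms that[of "max (mnorm (A + B)) (mnorm B)"] by auto
    then show False using mnorm_diff_le[of "A + B" r B] by simp
  qed
qed

lemma mnorm_mult_le: "mnorm (A ** B) \<le> mnorm A * mnorm B"
  unfolding mnorm_le_iff
  by (auto simp: matrix_matrix_mult_def absv_mult intro!: absv_sum_le mult_mono absv_entry_le)

lemma mnorm_mult_le': "mnorm A \<le> r \<Longrightarrow> mnorm B \<le> s \<Longrightarrow> mnorm (A ** B) \<le> r * s"
  using mnorm_mult_le[of A B] mult_mono[of "mnorm A" r "mnorm B" s]
  by (meson mnorm_nonneg order_trans)

lemma mat_nth: "mat t $ i $ j = (if i = j then t else 0)"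
  by (simp add: mat_def)

lemma mat_mult_nth [simp]: "(mat t ** A) $ i $ j = t * A $ i $ j"
proof -
  have "(mat t ** A) $ i $ j = (\<Sum>k\<in>UNIV. (if i = k then t else 0) * A $ k $ j)"
    by (simp add: matrix_matrix_mult_def mat_def)
  also have "\<dots> = (\<Sum>k\<in>UNIV. if i = k then t * A $ k $ j else 0)"
    by (rule sum.cong) auto
  finally show ?thesis by simp
qed

lemma mult_mat_nth [simp]: "(A ** mat t) $ i $ j = (A $ i $ j) * t"
proof -
  have "(A ** mat t) $ i $ j = (\<Sum>k\<in>UNIV. A $ i $ k * (if k = j then t else 0))"
    by (simp add: matrix_matrix_mult_def mat_def)
  also have "\<dots> = (\<Sum>k\<in>UNIV. if k = j then A $ i $ k * t else 0)"
    by (rule sum.cong) auto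
  finally show ?thesis by simp
qed

lemma mat_commute: "mat t ** A = A ** mat (t :: 'a::comm_semiring_1)"
  by (simp add: vec_eq_iff mult.commute)

lemma mnorm_mat_mult [simp]: "mnorm (mat t ** A) = absv t * mnorm A"
proof (rule antisym)
  show "mnorm (mat t ** A) \<le> absv t * mnorm A"
    by (auto simp: mnorm_le_iff absv_mult intro!: mult_left_mono absv_entry_le)
  obtain i j where "mnorm A = absv (A $ i $ j)" using mnorm_attained .
  then show "absv t * mnorm A \<le> mnorm (mat t ** A)"
    using absv_entry_le[of "mat t ** A" i j] by (simp add: absv_mult)
qed

lemma trace_mat_mult [simp]: "trace (mat t ** A) = t * trace A"
  by (simp add: trace_def sum_distrib_left)

lemma absv_trace_le: "absv (trace A) \<le> mnorm A"
  unfolding trace_def by (intro absv_sum_le absv_entry_le) auto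

lemma mnorm_mat_1 [simp]: "mnorm (mat 1 :: 'f::nonarch_local_field_0^'n^'n) = 1"
proof (rule antisym)
  show "mnorm (mat 1 :: 'f^'n^'n) \<le> 1" by (simp add: mnorm_le_iff mat_nth)
  show "1 \<le> mnorm (mat 1 :: 'f^'n^'n)"
    using absv_entry_le[of "mat 1 :: 'f^'n^'n" undefined undefined] by (simp add: mat_nth)
qed

subsection \<open>Topology\<close>

lemma mnorm_diff_le_dist: "mnorm (y - x) \<le> dist y x"
proof -
  have "dist (y $ i $ j) (x $ i $ j) \<le> dist y x" for i j
    using dist_vec_nth_le[of "y $ i" j "x $ i"] dist_vec_nth_le[of y i x] by linarith
  then show ?thesis by (simp add: mnorm_le_iff dist_absv)
qed

lemma dist_le_mnorm_diff:
  "dist y (x :: 'f::nonarch_local_field_0^'n^'n) \<le> real (CARD('n) * CARD('n)) * mnorm (y - x)"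
proof -
  have "dist y x \<le> (\<Sum>i\<in>UNIV. dist (y $ i) (x $ i))"
    unfolding dist_vec_def[of y x] by (rule L2_set_le_sum) simp
  also have "\<dots> \<le> (\<Sum>i\<in>(UNIV::'n set). \<Sum>j\<in>UNIV. dist (y $ i $ j) (x $ i $ j))"
    unfolding dist_vec_def[of "_ $ _"] by (intro sum_mono L2_set_le_sum) simp
  also have "\<dots> \<le> (\<Sum>i\<in>(UNIV::'n set). \<Sum>j\<in>(UNIV::'n set). mnorm (y - x))"
    using absv_entry_le[of "y - x"] by (intro sum_mono) (simp add: dist_absv)
  finally show ?thesis by simp
qed

lemma open_mnorm_iff: "open S \<longleftrightarrow> (\<forall>x\<in>S. \<exists>r>0. mball x r \<subseteq> S)"
  for S :: "('f::nonarch_local_field_0^'n^'n) set"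
proof
  assume S: "open S"
  show "\<forall>x\<in>S. \<exists>r>0. mball x r \<subseteq> S"
  proof
    fix x assume "x \<in> S"
    then obtain e where e: "e > 0" "\<And>y. dist y x < e \<Longrightarrow> y \<in> S" using S unfolding open_dist by blast
    let ?N = "real (CARD('n) * CARD('n))"
    have N: "?N > 0" by simp
    have "mball x (e / (2 * ?N)) \<subseteq> S"
    proof
      fix y assume "y \<in> mball x (e / (2 * ?N))"
      then have "?N * mnorm (y - x) \<le> ?N * (e / (2 * ?N))"
        using N unfolding mball_def by (intro mult_left_mono) auto
      also have "\<dots> < e" using e(1) N by (simp add: field_simps)
      finally show "y \<in> S" using e(2) dist_le_mnorm_diff[of y x] by (meson order_le_less_trans)
    qed
    then show "\<exists>r>0. mball x r \<subseteq> S" using e(1) N by (intro exI[of _ "e / (2 * ?N)"]) simp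
  qed
next
  assume *: "\<forall>x\<in>S. \<exists>r>0. mball x r \<subseteq> S"
  show "open S" unfolding open_dist
  proof
    fix x assume "x \<in> S"
    then obtain r where r: "r > 0" "mball x r \<subseteq> S" using * by blast
    have "y \<in> S" if "dist y x < r" for y
      using r(2) that mnorm_diff_le_dist[of y x] by (auto simp: mball_def)
    then show "\<exists>e>0. \<forall>y. dist y x < e \<longrightarrow> y \<in> S" using r(1) by blast
  qed
qed

lemma mem_mball: "y \<in> mball a r \<longleftrightarrow> mnorm (y - a) \<le> r"
  by (simp add: mball_def)

lemma centre_in_mball [simp]: "0 \<le> r \<Longrightarrow> a \<in> mball a r"
  by (simp add: mem_mball)

lemma mball_subset: "y \<in> mball a r \<Longrightarrow> s \<le> r \<Longrightarrow> mball y s \<subseteq> mball a r"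
proof
  fix z assume "y \<in> mball a r" "s \<le> r" "z \<in> mball y s"
  then have "mnorm ((z - y) + (y - a)) \<le> r" by (intro mnorm_add_le) (auto simp: mem_mball)
  then show "z \<in> mball a r" by (simp add: mem_mball)
qed

lemma mball_eq: "y \<in> mball a r \<Longrightarrow> mball y r = mball a r"
  using mball_subset[of y a r r] mball_subset[of a y r r]
  by (auto simp: mem_mball mnorm_minus_commute)

lemma open_mball: "r > 0 \<Longrightarrow> open (mball a r)"
  unfolding open_mnorm_iff using mball_subset by blast

lemma continuous_on_matrix_mult [continuous_intros]:
  fixes f g :: "'a::topological_space \<Rightarrow> 'f::nonarch_local_field_0^'n^'n"
  shows "continuous_on S f \<Longrightarrow> continuous_on S g \<Longrightarrow> continuous_on S (\<lambda>x. f x ** g x)"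
  unfolding matrix_matrix_mult_def
  by (intro continuous_on_vec_lambda continuous_on_sum continuous_on_mult' continuous_on_component)

lemma continuous_on_det [continuous_intros]:
  fixes f :: "'a::topological_space \<Rightarrow> 'f::nonarch_local_field_0^'n^'n"
  shows "continuous_on S f \<Longrightarrow> continuous_on S (\<lambda>x. det (f x))"
  unfolding det_def
  by (intro continuous_on_sum continuous_on_mult' continuous_on_prod' continuous_on_component
      continuous_on_const)

lemma closed_mball: "closed (mball a r)"
proof -
  have "open (- mball a r)" unfolding open_mnorm_iff
  proof
    fix x assume "x \<in> - mball a r"
    then have x: "r < mnorm (x - a)" by (simp add: mem_mball)
    show "\<exists>s>0. mball x s \<subseteq> - mball a r"
    proof (cases "r < 0")
      case True
      then have "mball a r = {}" using mnorm_nonneg[of "_ - a"] by (auto simp: mem_mball) (smt (verit) mnorm_nonneg)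
      then show ?thesis by (intro exI[of _ 1]) auto
    next
      case False
      have "mball x (mnorm (x - a) / 2) \<subseteq> - mball a r"
      proof
        fix y assume y: "y \<in> mball x (mnorm (x - a) / 2)"
        have "mnorm (x - a) > 0" using x False by linarith
        with y have "mnorm (y - x) < mnorm (x - a)" unfolding mem_mball by linarith
        then have "mnorm ((x - a) + (y - x)) = mnorm (x - a)" by (rule mnorm_add_eq)
        then show "y \<in> - mball a r" using x by (simp add: mem_mball)
      qed
      moreover have "mnorm (x - a) / 2 > 0" using x False by simp
      ultimately show ?thesis by blast
    qed
  qed
  then show ?thesis by (simp add: closed_open)
qed

lemma compact_mball: "compact (mball (a :: 'f::nonarch_local_field_0^'n^'n) r)"
proof -
  have "bounded (mball a r)" unfolding bounded_def
  proof (intro exI ballI)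
    fix y assume "y \<in> mball a r"
    then have "real (CARD('n) * CARD('n)) * mnorm (y - a) \<le> real (CARD('n) * CARD('n)) * r"
      by (intro mult_left_mono) (auto simp: mem_mball)
    then show "dist a y \<le> real (CARD('n) * CARD('n)) * r"
      using dist_le_mnorm_diff[of y a] unfolding dist_commute[of a y] by linarith
  qed
  then show ?thesis using closed_mball compact_eq_bounded_closed by blast
qed

lemma compact_imp_mnorm_bounded:
  assumes "compact (K :: ('f::nonarch_local_field_0^'n^'n) set)"
  obtains R where "R > 0" "\<And>y. y \<in> K \<Longrightarrow> mnorm y \<le> R"
proof -
  obtain e where "\<forall>y\<in>K. dist 0 y \<le> e" using compact_imp_bounded[OF assms] bounded_any_center by blast
  then have "mnorm y \<le> max 1 e" if "y \<in> K" for y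
    using that mnorm_diff_le_dist[of y 0] by (fastforce simp: dist_commute)
  then show ?thesis using that[of "max 1 e"] by simp
qed

subsection \<open>The general linear group\<close>

lemma GL_iff: "g \<in> GL \<longleftrightarrow> det g \<noteq> (0 :: 'f::nonarch_local_field_0)"
  by (simp add: GL_def invertible_det_nz)

lemma open_GL: "open (GL :: ('f::nonarch_local_field_0^'n^'n) set)"
proof -
  have "open (det -` (- {0}) :: ('f^'n^'n) set)"
    by (intro open_vimage) (auto intro!: continuous_intros)
  moreover have "(det -` (- {0}) :: ('f^'n^'n) set) = GL" by (auto simp: GL_iff)
  ultimately show ?thesis by simp
qed

lemma GL_mult [simp, intro]: "g \<in> GL \<Longrightarrow> h \<in> GL \<Longrightarrow> g ** h \<in> GL"
  by (simp add: GL_iff det_mul)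

lemma mat_1_GL [simp]: "mat 1 \<in> GL"
  by (simp add: GL_iff)

lemma matrix_inv_right [simp]: "g \<in> GL \<Longrightarrow> g ** matrix_inv g = mat 1"
  and matrix_inv_left [simp]: "g \<in> GL \<Longrightarrow> matrix_inv g ** g = mat 1"
proof -
  assume "g \<in> GL"
  then have "\<exists>h. g ** h = mat 1 \<and> h ** g = mat 1" by (simp add: GL_def invertible_def)
  then have "g ** matrix_inv g = mat 1 \<and> matrix_inv g ** g = mat 1"
    unfolding matrix_inv_def by (rule someI_ex)
  then show "g ** matrix_inv g = mat 1" "matrix_inv g ** g = mat 1" by simp_all
qed

lemma matrix_inv_right_assoc [simp]: "g \<in> GL \<Longrightarrow> g ** (matrix_inv g ** x) = x"
  and matrix_inv_left_assoc [simp]: "g \<in> GL \<Longrightarrow> matrix_inv g ** (g ** x) = x"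
  by (simp_all add: matrix_mul_assoc)

lemma matrix_inv_unique: "g ** h = mat 1 \<Longrightarrow> matrix_inv g = (h :: 'f::nonarch_local_field_0^'n^'n)"
proof -
  assume gh: "g ** h = mat 1"
  then have "det g * det h = 1" by (metis det_mul det_I)
  then have "g \<in> GL" by (auto simp: GL_iff)
  have "matrix_inv g = matrix_inv g ** (g ** h)" by (simp add: gh)
  then show ?thesis using \<open>g \<in> GL\<close> by simp
qed

lemma matrix_inv_GL [simp, intro]: "g \<in> GL \<Longrightarrow> matrix_inv g \<in> GL"
  by (metis GL_iff det_I det_mul matrix_inv_right mult_zero_right one_neq_zero)

lemma matrix_inv_inv [simp]: "g \<in> GL \<Longrightarrow> matrix_inv (matrix_inv g) = g"
  by (rule matrix_inv_unique) simp

lemma matrix_inv_mult: "g \<in> GL \<Longrightarrow> h \<in> GL \<Longrightarrow> matrix_inv (g ** h) = matrix_inv h ** matrix_inv g"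
proof (rule matrix_inv_unique)
  assume "g \<in> GL" "h \<in> GL"
  then have "g ** (h ** (matrix_inv h ** matrix_inv g)) = mat 1" by simp
  then show "g ** h ** (matrix_inv h ** matrix_inv g) = mat 1" by (simp add: matrix_mul_assoc)
qed

lemma matrix_inv_mat_1 [simp]: "matrix_inv (mat 1) = (mat 1 :: 'f::nonarch_local_field_0^'n^'n)"
  by (rule matrix_inv_unique) simp

lemma det_matrix_inv: "g \<in> GL \<Longrightarrow> det (matrix_inv g) = inverse (det g)"
  by (metis det_I det_mul inverse_unique matrix_inv_right)

lemma mnorm_pos_GL: "g \<in> GL \<Longrightarrow> 0 < mnorm (g :: 'f::nonarch_local_field_0^'n^'n)"
proof -
  assume "g \<in> GL"
  then have "g ** matrix_inv g = mat 1" "(mat 1 :: 'f^'n^'n) \<noteq> 0" by (auto simp: mat_def vec_eq_iff)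
  then have "g \<noteq> 0" by force
  then show ?thesis using mnorm_nonneg[of g] mnorm_eq_0[of g] by linarith
qed

lemma mnorm_le_mult_left:
  assumes "u \<in> GL"
  shows "mnorm g \<le> mnorm (matrix_inv u) * mnorm (u ** g)"
  using mnorm_mult_le[of "matrix_inv u" "u ** g"] assms by simp

lemma mnorm_conj_le:
  assumes "h \<in> GL"
  shows "mnorm (h ** g ** matrix_inv h) \<le> mnorm h * mnorm (matrix_inv h) * mnorm g"
proof -
  have "mnorm (h ** g ** matrix_inv h) \<le> (mnorm h * mnorm g) * mnorm (matrix_inv h)"
    by (intro mnorm_mult_le') (auto intro: mnorm_mult_le)
  then show ?thesis by (simp add: mult_ac)
qed

subsection \<open>Nilpotent directions\<close>

text \<open>The conditions make \<open>t \<mapsto> mat 1 + mat t ** N\<close> a one-parameter subgroup of the special linear group,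
  close to the identity for small \<open>t\<close>.\<close>

definition nilp :: "('f::nonarch_local_field_0^'n^'n) set"
  where "nilp = {N. N ** N = 0 \<and> mnorm N \<le> 1 \<and> (\<forall>t. det (mat 1 + mat t ** N) = 1)}"

definition unit_mat :: "'n \<Rightarrow> 'n \<Rightarrow> 'f::nonarch_local_field_0^'n^'n"
  where "unit_mat a b = (\<chi> i j. if i = a \<and> j = b then 1 else 0)"

lemma mult_unit_mat: "(A ** unit_mat a b) $ i $ j = (if j = b then A $ i $ a else 0)"
proof -
  have "(A ** unit_mat a b) $ i $ j = (\<Sum>k\<in>UNIV. A $ i $ k * (if k = a \<and> j = b then 1 else 0))"
    by (simp add: matrix_matrix_mult_def unit_mat_def)
  also have "\<dots> = (\<Sum>k\<in>UNIV. if k = a then (if j = b then A $ i $ k else 0) else 0)"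
    by (rule sum.cong) auto
  finally show ?thesis by simp
qed

lemma unit_mat_nth: "unit_mat a b $ i $ j = (if i = a \<and> j = b then 1 else 0)"
  by (simp add: unit_mat_def)

lemma trace_mult_unit_mat: "trace (A ** unit_mat a b) = A $ b $ a"
  by (simp add: trace_def mult_unit_mat)

lemma det_add_unit_mat:
  fixes a b :: "'n::finite" and t :: "'f::nonarch_local_field_0"
  assumes "a \<noteq> b"
  shows "det (mat 1 + mat t ** unit_mat a b) = 1"
proof -
  have "mat 1 + mat t ** unit_mat a b =
      (\<chi> k. if k = a then row a (mat 1) + t *s row b (mat 1) else row k (mat 1 :: 'f^'n^'n))"
    using assms by (auto simp: vec_eq_iff row_def unit_mat_nth mat_nth)
  then show ?thesis using det_row_operation[OF assms, of "mat 1 :: 'f^'n^'n" t] by simp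
qed

lemma unit_mat_nilp: "a \<noteq> b \<Longrightarrow> unit_mat a b \<in> nilp"
  by (auto simp: nilp_def det_add_unit_mat mnorm_le_iff unit_mat_nth vec_eq_iff mult_unit_mat)

lemma matrix_add_rdistrib': "(A + B) ** C = A ** C + B ** (C :: 'f::nonarch_local_field_0^'n^'n)"
  by (simp add: vec_eq_iff matrix_matrix_mult_def sum.distrib algebra_simps)

lemma matrix_sub_ldistrib': "C ** (A - B) = C ** A - C ** (B :: 'f::nonarch_local_field_0^'n^'n)"
  by (simp add: vec_eq_iff matrix_matrix_mult_def sum_subtractf algebra_simps)

lemma matrix_sub_rdistrib': "(A - B) ** C = A ** C - B ** (C :: 'f::nonarch_local_field_0^'n^'n)"
  by (simp add: vec_eq_iff matrix_matrix_mult_def sum_subtractf algebra_simps)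

lemma mult_mat_left_commute: "u ** (mat t ** X) = mat t ** (u ** (X :: 'f::nonarch_local_field_0^'n^'n))"
  by (metis matrix_mul_assoc mat_commute)

lemma mult_unipotent: "g ** (mat 1 + mat t ** N) = g + mat t ** (g ** (N :: 'f::nonarch_local_field_0^'n^'n))"
  by (simp add: matrix_add_ldistrib mult_mat_left_commute)

lemma unipotent_mult: "(mat 1 + mat t ** N) ** g = g + mat t ** (N ** (g :: 'f::nonarch_local_field_0^'n^'n))"
  by (simp add: matrix_add_rdistrib' flip: matrix_mul_assoc)

text \<open>Conjugating an elementary nilpotent matrix by an elementary unipotent one gives a nilpotent matrix
  with the difference of two diagonal units in it, without any denominators. In this way also the
  differences of diagonal entries of \<open>A\<close> are visible in traces \<open>trace (A ** N)\<close>.\<close>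

lemma diag_nilp:
  assumes "a \<noteq> b"
  shows "unit_mat a a - unit_mat b b + unit_mat a b - unit_mat b a \<in> (nilp :: ('f::nonarch_local_field_0^'n^'n) set)"
    (is "?N \<in> _")
proof -
  define u :: "'f^'n^'n" where "u = mat 1 - unit_mat b a"
  define u' :: "'f^'n^'n" where "u' = mat 1 + unit_mat b a"
  have uu: "u ** u' = mat 1" "u' ** u = mat 1"
    using assms by (auto simp: u_def u'_def vec_eq_iff matrix_add_ldistrib matrix_sub_ldistrib' mult_unit_mat unit_mat_nth mat_nth)
  have N: "?N = u ** unit_mat a b ** u'"
    using assms by (auto simp: u_def u'_def vec_eq_iff matrix_add_ldistrib mult_unit_mat unit_mat_nth mat_nth)
  have "?N ** ?N = u ** unit_mat a b ** (u' ** u) ** unit_mat a b ** u'"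
    unfolding N by (simp add: matrix_mul_assoc)
  also have "\<dots> = u ** (unit_mat a b ** unit_mat a b) ** u'"
    unfolding uu by (simp add: matrix_mul_assoc)
  also have "unit_mat a b ** unit_mat a b = (0 :: 'f^'n^'n)"
    using assms by (simp add: vec_eq_iff mult_unit_mat unit_mat_nth)
  finally have sq: "?N ** ?N = 0" by simp
  have "det (mat 1 + mat t ** ?N) = 1" for t
  proof -
    have "mat 1 + mat t ** ?N = u ** (mat 1 + mat t ** unit_mat a b) ** u'"
      unfolding N by (simp add: matrix_add_ldistrib matrix_add_rdistrib' uu matrix_mul_assoc
          mat_commute[of t u, symmetric])
    moreover have "det u * det u' = 1" using uu(1) by (metis det_mul det_I)
    ultimately show ?thesis by (simp add: det_mul det_add_unit_mat[OF assms] mult_ac)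
  qed
  moreover have "mnorm ?N \<le> 1"
    using assms by (auto simp: mnorm_le_iff unit_mat_nth)
  ultimately show ?thesis using sq by (simp add: nilp_def)
qed

lemma trace_diag_nilp:
  "trace (A ** (unit_mat a a - unit_mat b b + unit_mat a b - unit_mat b a))
    = A $ a $ a - A $ b $ b + A $ b $ a - A $ a $ b"
  by (simp add: matrix_sub_ldistrib' matrix_add_ldistrib trace_sub trace_add trace_mult_unit_mat)

text \<open>If no direction detected the norm, all off-diagonal entries and all differences of diagonal
  entries of \<open>y\<close> would be smaller than the norm. Then every diagonal entry has absolute value
  equal to the norm, so the diagonal term dominates the Leibniz expansion and the determinant is as
  large as it can be.\<close>

lemma nilp_detects:
  fixes y :: "'f::nonarch_local_field_0^'n^'n"
  assumes "absv (det y) < mnorm y ^ CARD('n)"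
  obtains N where "N \<in> nilp" "absv (trace (y ** N)) = mnorm y"
proof (rule ccontr)
  let ?m = "mnorm y"
  note dir = that
  assume no: "\<not> thesis"
  have lt: "absv (trace (y ** N)) < ?m" if N: "N \<in> nilp" for N
  proof -
    have "absv (trace (y ** N)) \<le> mnorm (y ** N)" by (rule absv_trace_le)
    also have "\<dots> \<le> ?m * 1" using N by (intro mnorm_mult_le') (auto simp: nilp_def)
    finally have "absv (trace (y ** N)) \<le> ?m" by simp
    moreover have "absv (trace (y ** N)) \<noteq> ?m" using no N dir by blast
    ultimately show ?thesis by simp
  qed
  have pos: "?m > 0"
    using assms absv_nonneg[of "det y"] mnorm_nonneg[of y] by (metis less_eq_real_def not_less zero_less_card_finite power_0_left neq0_conv)
  have off: "absv (y $ i $ j) < ?m" if "i \<noteq> j" for i j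
    using lt[OF unit_mat_nilp[of j i]] that by (simp add: trace_mult_unit_mat)
  have diag: "absv (y $ i $ i - y $ j $ j) < ?m" if "i \<noteq> j" for i j
  proof -
    have "y $ i $ i - y $ j $ j = trace (y ** (unit_mat i i - unit_mat j j + unit_mat i j - unit_mat j i))
        + (y $ i $ j + - (y $ j $ i))"
      by (simp add: trace_diag_nilp)
    also have "absv \<dots> < ?m"
      using that by (intro absv_add_less lt diag_nilp) (auto simp: off)
    finally show ?thesis .
  qed
  obtain a b where ab: "?m = absv (y $ a $ b)" using mnorm_attained .
  then have "a = b" using off by force
  have diag_eq: "absv (y $ i $ i) = ?m" for i
  proof (cases "i = a")
    case False
    have "absv (y $ i $ i - y $ a $ a) < absv (y $ a $ a)" using diag[OF False] ab \<open>a = b\<close> by simp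
    then have "absv (y $ a $ a + (y $ i $ i - y $ a $ a)) = absv (y $ a $ a)" by (rule absv_add_eq)
    then show ?thesis using ab \<open>a = b\<close> by simp
  qed (use ab \<open>a = b\<close> in simp)
  let ?P = "{p. p permutes (UNIV::'n set)}"
  let ?t = "\<lambda>p. of_int (sign p) * (\<Prod>i\<in>UNIV. y $ i $ p i)"
  have "det y = ?t id + sum ?t (?P - {id})"
    unfolding det_def by (rule sum.remove) (auto simp: finite_permutations permutes_id)
  moreover have "absv (?t id) = ?m ^ CARD('n)"
    by (simp add: absv_prod diag_eq)
  moreover have "absv (sum ?t (?P - {id})) < ?m ^ CARD('n)"
  proof (rule absv_sum_less)
    fix p assume p: "p \<in> ?P - {id}"
    then have "p \<noteq> id" by simp
    then obtain i where i: "p i \<noteq> i" by (auto simp: fun_eq_iff)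
    have "(\<Prod>i\<in>UNIV. absv (y $ i $ p i)) = absv (y $ i $ p i) * (\<Prod>i\<in>UNIV - {i}. absv (y $ i $ p i))"
      by (rule prod.remove) auto
    also have "(\<Prod>i\<in>UNIV - {i}. absv (y $ i $ p i)) \<le> (\<Prod>i\<in>UNIV - {i}. ?m)"
      by (intro prod_mono) (auto intro: absv_entry_le)
    then have "absv (y $ i $ p i) * (\<Prod>i\<in>UNIV - {i}. absv (y $ i $ p i)) \<le> absv (y $ i $ p i) * (\<Prod>i\<in>UNIV - {i}. ?m)"
      by (rule mult_left_mono) simp
    also have "\<dots> < ?m * (\<Prod>i\<in>UNIV - {i}. ?m)"
      using off[of i "p i"] i pos by (intro mult_strict_right_mono prod_pos) auto
    also have "\<dots> = (\<Prod>i\<in>(UNIV::'n set). ?m)" by (rule prod.remove[symmetric]) auto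
    finally have "(\<Prod>i\<in>UNIV. absv (y $ i $ p i)) < ?m ^ CARD('n)" by simp
    moreover have "absv (of_int (sign p) :: 'f) = 1" by (cases p rule: sign_cases) auto
    ultimately show "absv (?t p) < ?m ^ CARD('n)" by (simp add: absv_mult absv_prod)
  qed (use pos in simp)
  ultimately have "absv (det y) = ?m ^ CARD('n)"
    using absv_add_eq[of "sum ?t (?P - {id})" "?t id"] by simp
  then show False using assms by simp
qed

subsection \<open>Locally constant functions on the general linear group\<close>

text \<open>The value type is arbitrary, so that finitely many locally constant data can be packed into one
  function. Values outside the group do not matter, since a small ball around an invertible matrix
  consists of invertible matrices.\<close>

definition locconst_GL :: "('f::nonarch_local_field_0^'n^'n \<Rightarrow> 'b) \<Rightarrow> bool"
  where "locconst_GL f \<longleftrightarrow> (\<forall>x\<in>GL. \<exists>r>0. \<forall>y\<in>mball x r. f y = f x)"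

lemma smooth_fun_GL_iff: "f \<in> smooth_fun GL \<longleftrightarrow> locconst_GL f"
proof
  assume f: "f \<in> smooth_fun GL"
  show "locconst_GL f" unfolding locconst_GL_def
  proof
    fix x :: "'a^'b^'b" assume x: "x \<in> GL"
    then obtain U where U: "open U" "x \<in> U" "\<forall>y\<in>U \<inter> GL. f y = f x" using f unfolding smooth_fun_def by blast
    then have "open (U \<inter> GL)" using open_GL by blast
    then obtain r where "r > 0" "mball x r \<subseteq> U \<inter> GL" using U(2) x unfolding open_mnorm_iff by blast
    then show "\<exists>r>0. \<forall>y\<in>mball x r. f y = f x" using U(3) by (intro exI[of _ r] conjI ballI) blast+
  qed
next
  assume f: "locconst_GL f"
  have "\<exists>U. open U \<and> x \<in> U \<and> (\<forall>y\<in>U \<inter> GL. f y = f x)" if x: "x \<in> GL" for x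
  proof -
    obtain r where "r > 0" "\<forall>y\<in>mball x r. f y = f x" using f x unfolding locconst_GL_def by blast
    then show ?thesis using open_mball[of r x] by (intro exI[of _ "mball x r"] conjI) (simp, simp, blast)
  qed
  then show "f \<in> smooth_fun GL" by (simp add: smooth_fun_def)
qed

lemma locconst_GL_const [simp]: "locconst_GL (\<lambda>_. c)"
  by (auto simp: locconst_GL_def intro: exI[of _ 1])

lemma locconst_GL_Pair:
  assumes "locconst_GL f" "locconst_GL g"
  shows "locconst_GL (\<lambda>x. (f x, g x))"
  unfolding locconst_GL_def
proof
  fix x :: "'a^'b^'b" assume "x \<in> GL"
  then have "\<exists>r>0. \<forall>y\<in>mball x r. f y = f x" "\<exists>r>0. \<forall>y\<in>mball x r. g y = g x"
    using assms unfolding locconst_GL_def by blast+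
  then obtain r s where r: "r > 0" "\<And>y. y \<in> mball x r \<Longrightarrow> f y = f x"
      and s: "s > 0" "\<And>y. y \<in> mball x s \<Longrightarrow> g y = g x"
    by metis
  have "(f y, g y) = (f x, g x)" if y: "y \<in> mball x (min r s)" for y
  proof -
    have "f y = f x" by (rule r(2)) (use y in \<open>simp add: mem_mball\<close>)
    moreover have "g y = g x" by (rule s(2)) (use y in \<open>simp add: mem_mball\<close>)
    ultimately show ?thesis by (rule arg_cong2)
  qed
  moreover have "min r s > 0" using r(1) s(1) by simp
  ultimately show "\<exists>r>0. \<forall>y\<in>mball x r. (f y, g y) = (f x, g x)" by blast
qed

lemma locconst_GL_comp: "locconst_GL f \<Longrightarrow> locconst_GL (\<lambda>x. h (f x))"
  unfolding locconst_GL_def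
proof
  fix x :: "'a^'b^'b"
  assume f: "\<forall>x\<in>GL. \<exists>r>0. \<forall>y\<in>mball x r. f y = f x" and x: "x \<in> GL"
  obtain r where r: "r > 0" "\<forall>y\<in>mball x r. f y = f x" using f x by blast
  then show "\<exists>r>0. \<forall>y\<in>mball x r. h (f y) = h (f x)"
    by (intro exI[of _ r] conjI ballI arg_cong[of _ _ h]) blast+
qed

lemma locconst_GL_comp2:
  assumes "locconst_GL f" "locconst_GL g"
  shows "locconst_GL (\<lambda>x. h (f x) (g x))"
  using locconst_GL_comp[OF locconst_GL_Pair[OF assms], of "\<lambda>(a, b). h a b"] by simp

lemma locconst_GL_precomp:
  fixes f :: "'f::nonarch_local_field_0^'n^'n \<Rightarrow> 'b"
  assumes f: "locconst_GL f" and h: "continuous_on UNIV (h :: 'f^'n^'n \<Rightarrow> _)" "\<And>x. x \<in> GL \<Longrightarrow> h x \<in> GL"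
  shows "locconst_GL (\<lambda>x. f (h x :: 'f^'n^'n))"
  unfolding locconst_GL_def
proof
  fix x :: "'f^'n^'n" assume x: "x \<in> GL"
  then obtain r where r: "r > 0" "\<forall>y\<in>mball (h x) r. f y = f (h x)"
    using f h(2) unfolding locconst_GL_def by blast
  have "open (h -` mball (h x) r)" using h(1) r(1) by (intro open_vimage open_mball) auto
  moreover have "x \<in> h -` mball (h x) r" using r(1) by simp
  ultimately obtain s where "s > 0" "mball x s \<subseteq> h -` mball (h x) r" unfolding open_mnorm_iff by blast
  then show "\<exists>r>0. \<forall>y\<in>mball x r. f (h y) = f (h x)" using r(2) by blast
qed

lemma locconst_GL_indicator:
  assumes "open S" "closed S"
  shows "locconst_GL (\<lambda>x. x \<in> (S :: ('f::nonarch_local_field_0^'n^'n) set))"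
  unfolding locconst_GL_def
proof
  fix x :: "'f^'n^'n" assume "x \<in> GL"
  show "\<exists>r>0. \<forall>y\<in>mball x r. (y \<in> S) = (x \<in> S)"
  proof (cases "x \<in> S")
    case True
    then show ?thesis using assms(1) unfolding open_mnorm_iff by blast
  next
    case False
    then have "\<exists>r>0. mball x r \<subseteq> - S" using assms(2) unfolding closed_open open_mnorm_iff by blast
    then show ?thesis using False by blast
  qed
qed

lemma locconst_GL_mnorm_le: "r > 0 \<Longrightarrow> locconst_GL (\<lambda>x. mnorm x \<le> r)"
proof -
  assume "r > 0"
  then have "locconst_GL (\<lambda>x. x \<in> mball 0 r)" by (intro locconst_GL_indicator open_mball closed_mball)
  then show ?thesis by (simp add: mem_mball)
qed

lemma locconst_GL_det:
  fixes f :: "'f::nonarch_local_field_0 \<Rightarrow> 'b"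
  assumes "\<And>x. x \<noteq> 0 \<Longrightarrow> \<exists>U. open U \<and> x \<in> U \<and> (\<forall>y\<in>U. f y = f x)"
  shows "locconst_GL (\<lambda>g :: 'f^'n^'n. f (det g))"
  unfolding locconst_GL_def
proof
  fix x :: "'f^'n^'n" assume x: "x \<in> GL"
  then obtain U where U: "open U" "det x \<in> U" "\<forall>y\<in>U. f y = f (det x)" using assms[of "det x"] GL_iff by blast
  have "open ((\<lambda>g. det g) -` U :: ('f^'n^'n) set)" using U(1) by (intro open_vimage continuous_intros) auto
  then obtain r where "r > 0" "mball x r \<subseteq> (\<lambda>g. det g) -` U" using U(2) unfolding open_mnorm_iff by blast
  then show "\<exists>r>0. \<forall>y\<in>mball x r. f (det y) = f (det x)" using U(3) by blast
qed

lemma locconst_GL_absv_det: "locconst_GL (\<lambda>g :: 'f::nonarch_local_field_0^'n^'n. absv (det g))"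
proof (rule locconst_GL_det)
  fix x :: 'f assume "x \<noteq> 0"
  have "absv y = absv x" if "y \<in> ball x (absv x)" for y
    using that absv_add_eq[of "y - x" x] absv_minus_commute[of x y] by (simp add: dist_absv)
  moreover have "open (ball x (absv x))" "x \<in> ball x (absv x)" using \<open>x \<noteq> 0\<close> by simp_all
  ultimately show "\<exists>U. open U \<and> x \<in> U \<and> (\<forall>y\<in>U. absv y = absv x)" by blast
qed

text \<open>Two balls of the same radius are equal or disjoint, so a cover by balls of one sufficiently small
  radius becomes a partition once repetitions are dropped.\<close>

lemma compact_ball_partition:
  fixes f :: "'f::nonarch_local_field_0^'n^'n \<Rightarrow> 'b"
  assumes K: "compact K" "K \<subseteq> GL" and f: "locconst_GL f" and "r0 > 0"
  obtains r A where "0 < r" "r \<le> r0" "finite A" "A \<subseteq> K" "K \<subseteq> (\<Union>a\<in>A. mball a r)"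
    "disjoint_family_on (\<lambda>a. mball a r) A"
    "\<And>a. a \<in> A \<Longrightarrow> mball a r \<subseteq> GL" "\<And>a y. a \<in> A \<Longrightarrow> y \<in> mball a r \<Longrightarrow> f y = f a"
proof -
  have "\<exists>r>0. mball x r \<subseteq> GL \<and> (\<forall>y\<in>mball x r. f y = f x)" if x: "x \<in> K" for x
  proof -
    have "x \<in> GL" using x K by blast
    then obtain s t where "s > 0" "mball x s \<subseteq> GL" "t > 0" "\<forall>y\<in>mball x t. f y = f x"
      using f open_GL unfolding locconst_GL_def open_mnorm_iff by blast
    moreover have "mball x (min s t) \<subseteq> mball x s" "mball x (min s t) \<subseteq> mball x t"
      by (auto simp: mem_mball)
    ultimately show ?thesis by (intro exI[of _ "min s t"] conjI) (simp, blast+)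
  qed
  then obtain \<rho> where \<rho>: "\<And>x. x \<in> K \<Longrightarrow> \<rho> x > 0" "\<And>x. x \<in> K \<Longrightarrow> mball x (\<rho> x) \<subseteq> GL"
      "\<And>x y. x \<in> K \<Longrightarrow> y \<in> mball x (\<rho> x) \<Longrightarrow> f y = f x" by metis
  obtain C where C: "C \<subseteq> K" "finite C" "K \<subseteq> (\<Union>x\<in>C. mball x (\<rho> x))"
    using compactE_image[OF K(1), of K "\<lambda>x. mball x (\<rho> x)"] open_mball \<rho>(1)
    by (metis (no_types, lifting) UN_I centre_in_mball less_imp_le subsetI)
  define r where "r = Min (insert r0 (\<rho> ` C))"
  have r: "r > 0" "r \<le> r0" "\<And>x. x \<in> C \<Longrightarrow> r \<le> \<rho> x"
    using C \<rho>(1) \<open>r0 > 0\<close> unfolding r_def by (auto simp: Min_gr_iff Min_le_iff)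
  obtain D where D: "D \<subseteq> K" "finite D" "K \<subseteq> (\<Union>x\<in>D. mball x r)"
    using compactE_image[OF K(1), of K "\<lambda>x. mball x r"] open_mball[OF r(1)] r(1)
    by (metis (no_types, lifting) UN_I centre_in_mball less_imp_le subsetI)
  define rep where "rep x = (SOME z. z \<in> D \<and> mball z r = mball x r)" for x
  have rep: "rep x \<in> D \<and> mball (rep x) r = mball x r" if "x \<in> D" for x
    unfolding rep_def by (rule someI[of _ x]) (simp add: that)
  define A where "A = rep ` D"
  have AD: "A \<subseteq> D" using rep by (auto simp: A_def)
  show ?thesis
  proof (rule that[of r A])
    show "0 < r" "r \<le> r0" "finite A" "A \<subseteq> K" using r D AD by (auto simp: A_def)
    show "K \<subseteq> (\<Union>a\<in>A. mball a r)" using D(3) rep unfolding A_def by fastforce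
    show "disjoint_family_on (\<lambda>a. mball a r) A"
      unfolding disjoint_family_on_def
    proof (intro ballI impI, rule ccontr)
      fix a b assume ab: "a \<in> A" "b \<in> A" "a \<noteq> b" "mball a r \<inter> mball b r \<noteq> {}"
      then have eq: "mball a r = mball b r" using mball_eq by blast
      obtain x y where xy: "x \<in> D" "a = rep x" "y \<in> D" "b = rep y" using ab by (auto simp: A_def)
      then have "mball x r = mball y r" using eq rep by metis
      then have "rep x = rep y" by (simp add: rep_def)
      then show False using xy ab by simp
    qed
    fix a assume a: "a \<in> A"
    then have "a \<in> K" using AD D by blast
    then obtain x where x: "x \<in> C" "a \<in> mball x (\<rho> x)" using C by blast
    have sub: "mball a r \<subseteq> mball x (\<rho> x)" using mball_subset x r(3) by blast
    then show "mball a r \<subseteq> GL" using \<rho>(2) x C by blast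
    show "f y = f a" if y: "y \<in> mball a r" for y
    proof -
      have "f y = f x" "f a = f x" using \<rho>(3) sub x C y by blast+
      then show ?thesis by (rule trans[OF _ sym])
    qed
  qed
qed

section \<open>Haar measures\<close>

subsection \<open>Volumes of balls in the field\<close>

locale field_haar =
  fixes \<mu> :: "'f::nonarch_local_field_0 measure"
  assumes haar: "haar_measure_field \<mu>"
begin

lemma sets_mu [simp]: "sets \<mu> = sets borel"
  using haar by (simp add: haar_measure_field_def)

lemma space_mu [simp]: "space \<mu> = UNIV"
  using sets_eq_imp_space_eq[OF sets_mu] by simp

lemma closed_ball_absv: "closed {x::'f. absv (x - c) \<le> r}"
proof -
  have "{x::'f. absv (x - c) \<le> r} = cball c r"
    by (auto simp: dist_absv absv_minus_commute[of c])
  then show ?thesis by simp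
qed

lemma closed_ball_sets [measurable]: "{x. absv (x - c) \<le> r} \<in> sets \<mu>"
  unfolding sets_mu by (rule borel_closed[OF closed_ball_absv])

lemma emeasure_translate_ball:
  "emeasure \<mu> {x. absv (x - c) \<le> r} = emeasure \<mu> {x. absv x \<le> r}"
proof -
  have "(\<lambda>x. c + x) \<in> borel_measurable borel"
    by (intro borel_measurable_continuous_onI continuous_intros)
  then have meas: "(\<lambda>x. c + x) \<in> measurable \<mu> \<mu>"
    by (simp cong: measurable_cong_sets)
  have "emeasure \<mu> {x. absv (x - c) \<le> r} = emeasure (distr \<mu> \<mu> (\<lambda>x. c + x)) {x. absv (x - c) \<le> r}"
    using haar by (simp add: haar_measure_field_def)
  also have "\<dots> = emeasure \<mu> {x. absv x \<le> r}"
    by (subst emeasure_distr[OF meas closed_ball_sets]) (simp add: vimage_def)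
  finally show ?thesis .
qed

lemma emeasure_ball_finite: "emeasure \<mu> {x. absv x \<le> r} < \<infinity>"
  using haar compact_closed_ball_absv by (auto simp: haar_measure_field_def)

definition ball_vol :: "real \<Rightarrow> real"
  where "ball_vol r = measure \<mu> {x. absv x \<le> r}"

lemma emeasure_ball: "emeasure \<mu> {x. absv (x - c) \<le> r} = ennreal (ball_vol r)"
  unfolding emeasure_translate_ball ball_vol_def
  using emeasure_ball_finite[of r] by (simp add: emeasure_eq_ennreal_measure)

lemma ball_vol_nonneg [simp]: "0 \<le> ball_vol r"
  by (simp add: ball_vol_def)

lemma ball_vol_shrink:
  assumes "r > 0"
  shows "ball_vol r = residue_card TYPE('f) * ball_vol (r / residue_card TYPE('f))"
proof -
  let ?q = "real (residue_card TYPE('f))"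
  obtain C :: "'f set" where C: "finite C" "card C = residue_card TYPE('f)"
    "{x. absv x \<le> r} = (\<Union>c\<in>C. {x. absv (x - c) \<le> r / ?q})"
    "disjoint_family_on (\<lambda>c. {x. absv (x - c) \<le> r / ?q}) C"
    using closed_ball_decomposition[OF assms] by blast
  have "ennreal (ball_vol r) = emeasure \<mu> (\<Union>c\<in>C. {x. absv (x - c) \<le> r / ?q})"
    using emeasure_ball[of 0 r] C(3) by simp
  also have "\<dots> = (\<Sum>c\<in>C. emeasure \<mu> {x. absv (x - c) \<le> r / ?q})"
    using C by (intro sum_emeasure[symmetric]) (auto simp del: sets_mu)
  also have "\<dots> = of_nat (residue_card TYPE('f)) * ennreal (ball_vol (r / ?q))"
    by (simp add: emeasure_ball C(2))
  also have "\<dots> = ennreal (?q * ball_vol (r / ?q))"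
    by (simp add: ennreal_mult ennreal_of_nat_eq_real_of_nat)
  finally show ?thesis by simp
qed

lemma ball_vol_power:
  assumes "r > 0"
  shows "ball_vol (real (residue_card TYPE('f)) powi k * r) = real (residue_card TYPE('f)) powi k * ball_vol r"
proof -
  define q where "q = real (residue_card TYPE('f))"
  have q: "q > 0" using residue_card_ge_2[where 'f = 'f] by (simp add: q_def)
  have nat: "ball_vol (q ^ n * s) = q ^ n * ball_vol s" if "s > 0" for n s
  proof (induction n)
    case (Suc n)
    have "ball_vol (q ^ Suc n * s) = q * ball_vol (q ^ Suc n * s / q)"
      using ball_vol_shrink[of "q ^ Suc n * s"] q that by (simp add: q_def)
    then show ?case using Suc q by (simp add: mult_ac)
  qed simp
  show ?thesis
  proof (cases "k \<ge> 0")
    case True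
    then show ?thesis using nat[OF assms, of "nat k"] by (simp add: power_int_def q_def)
  next
    case False
    define n where "n = nat (- k)"
    have k: "q powi k = inverse (q ^ n)" using False by (simp add: power_int_def n_def power_inverse)
    have "ball_vol (q ^ n * (inverse (q ^ n) * r)) = q ^ n * ball_vol (inverse (q ^ n) * r)"
      using q assms by (intro nat) simp
    then show ?thesis using q unfolding q_def[symmetric] k by (simp add: field_simps)
  qed
qed

text \<open>For the normalized absolute value, multiplication by \<open>a\<close> scales the measure by \<open>absv a\<close>: a generator of
  the maximal ideal shrinks a ball to one of the \<open>q\<close> translates into which it decomposes.\<close>

lemma ball_vol_scale:
  assumes "a \<noteq> (0::'f)" "r > 0"
  shows "ball_vol (absv a * r) = absv a * ball_vol r"
proof -
  obtain k where "absv a = real (residue_card TYPE('f)) powi k"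
    using absv_eq_power_int[OF assms(1)] by blast
  then show ?thesis using ball_vol_power[OF assms(2)] by simp
qed

lemma ball_vol_pos:
  assumes "r > 0"
  shows "0 < ball_vol r"
proof (rule ccontr)
  assume "\<not> 0 < ball_vol r"
  then have 0: "ball_vol r = 0" using ball_vol_nonneg[of r] by linarith
  define q where "q = real (residue_card TYPE('f))"
  have q: "q > 1" using residue_card_ge_2[where 'f = 'f] by (simp add: q_def)
  have "(\<Union>n. {x::'f. absv x \<le> q ^ n * r}) = UNIV"
  proof -
    have "\<exists>n. absv x \<le> q ^ n * r" for x :: 'f
    proof -
      obtain n where "absv x / r < q ^ n" using real_arch_pow[OF q] by blast
      then show ?thesis using assms by (intro exI[of _ n]) (simp add: field_simps)
    qed
    then show ?thesis by auto
  qed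
  moreover have "emeasure \<mu> (\<Union>n. {x::'f. absv x \<le> q ^ n * r}) = 0"
  proof (rule emeasure_UN_eq_0)
    fix n
    have "ball_vol (q ^ n * r) = 0" using ball_vol_power[OF assms, of "int n"] 0 by (simp add: q_def)
    then show "emeasure \<mu> {x::'f. absv x \<le> q ^ n * r} = 0" using emeasure_ball[of 0] by simp
  next
    show "range (\<lambda>n. {x::'f. absv x \<le> q ^ n * r}) \<subseteq> sets \<mu>"
      using closed_ball_sets[of 0] by (auto simp del: sets_mu)
  qed
  ultimately show False using haar by (simp add: haar_measure_field_def)
qed

lemma sigma_finite_mu: "sigma_finite_measure \<mu>"
proof
  show "\<exists>A. countable A \<and> A \<subseteq> sets \<mu> \<and> \<Union> A = space \<mu> \<and> (\<forall>a\<in>A. emeasure \<mu> a \<noteq> \<infinity>)"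
  proof (intro exI conjI)
    show "countable (range (\<lambda>n::nat. {x::'f. absv x \<le> real n}))" by simp
    show "range (\<lambda>n::nat. {x::'f. absv x \<le> real n}) \<subseteq> sets \<mu>"
      using closed_ball_sets[of 0] by (auto simp del: sets_mu)
    show "\<Union> (range (\<lambda>n::nat. {x::'f. absv x \<le> real n})) = space \<mu>"
      using real_arch_simple by auto
    show "\<forall>a\<in>range (\<lambda>n::nat. {x::'f. absv x \<le> real n}). emeasure \<mu> a \<noteq> \<infinity>"
      using emeasure_ball_finite by (auto simp: less_top)
  qed
qed

subsection \<open>Volumes of boxes of matrices\<close>

text \<open>The field is second countable, so the product \<sigma>-algebra on functions is the Borel \<sigma>-algebra and
  continuity suffices.\<close>

lemma measurable_mat_of_fun:
  "(\<lambda>X. \<chi> i j. X (i, j)) \<in> measurable (Pi\<^sub>M (UNIV :: ('n \<times> 'n::finite) set) (\<lambda>_. \<mu>)) (borel :: ('f^'n^'n) measure)"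
proof -
  have "sets (Pi\<^sub>M (UNIV :: ('n \<times> 'n) set) (\<lambda>_. \<mu>)) = sets (Pi\<^sub>M UNIV (\<lambda>_. borel))"
    by (intro sets_PiM_cong) auto
  also have "\<dots> = sets borel" by (rule sets_PiM_equal_borel)
  finally have eq: "sets (Pi\<^sub>M (UNIV :: ('n \<times> 'n) set) (\<lambda>_. \<mu>)) = sets borel" .
  have "(\<lambda>X. \<chi> i j. X (i, j)) \<in> borel_measurable (borel :: ('n \<times> 'n \<Rightarrow> 'f) measure)"
    by (intro borel_measurable_continuous_onI continuous_on_vec_lambda continuous_on_product_coordinates)
  then show ?thesis using eq by (simp cong: measurable_cong_sets)
qed

lemma sets_haar_mat [simp]: "sets (haar_mat \<mu>) = sets borel"
  by (simp add: haar_mat_def)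

definition box :: "'f^'n^'n \<Rightarrow> ('n \<Rightarrow> 'n \<Rightarrow> real) \<Rightarrow> ('f^'n^'n) set"
  where "box c \<rho> = {X. \<forall>i j. absv (X $ i $ j - c $ i $ j) \<le> \<rho> i j}"

lemma closed_box: "closed (box c \<rho>)"
proof -
  have "box c \<rho> = (\<Inter>i. \<Inter>j. (\<lambda>X. X $ i $ j) -` {x. absv (x - c $ i $ j) \<le> \<rho> i j})"
    by (auto simp: box_def)
  also have "closed \<dots>"
    by (intro closed_INT ballI closed_vimage closed_ball_absv continuous_intros)
  finally show ?thesis .
qed

lemma emeasure_box:
  "emeasure (haar_mat \<mu>) (box c \<rho> :: ('f^'n^'n) set) = ennreal (\<Prod>(i, j)\<in>UNIV. ball_vol (\<rho> i j))"
proof -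
  interpret sigma_finite_measure \<mu> by (rule sigma_finite_mu)
  interpret product_sigma_finite "\<lambda>_ :: 'n \<times> 'n. \<mu>" ..
  let ?S = "\<lambda>(i, j). {x. absv (x - c $ i $ j) \<le> \<rho> i j}"
  have "emeasure (haar_mat \<mu>) (box c \<rho>) =
      emeasure (Pi\<^sub>M (UNIV :: ('n \<times> 'n) set) (\<lambda>_. \<mu>)) ((\<lambda>X. \<chi> i j. X (i, j)) -` box c \<rho> \<inter> space (Pi\<^sub>M (UNIV :: ('n \<times> 'n) set) (\<lambda>_. \<mu>)))"
    unfolding haar_mat_def by (rule emeasure_distr[OF measurable_mat_of_fun]) (simp add: closed_box)
  also have "(\<lambda>X. \<chi> i j. X (i, j)) -` box c \<rho> \<inter> space (Pi\<^sub>M (UNIV :: ('n \<times> 'n) set) (\<lambda>_. \<mu>)) = Pi\<^sub>E UNIV ?S"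
    by (auto simp: box_def space_PiM PiE_iff)
  also have "emeasure (Pi\<^sub>M (UNIV :: ('n \<times> 'n) set) (\<lambda>_. \<mu>)) (Pi\<^sub>E UNIV ?S) = (\<Prod>p\<in>UNIV. emeasure \<mu> (?S p))"
    by (rule emeasure_PiM) (auto simp del: sets_mu)
  also have "\<dots> = (\<Prod>p\<in>UNIV. ennreal (case p of (i, j) \<Rightarrow> ball_vol (\<rho> i j)))"
    by (intro prod.cong) (auto simp: emeasure_ball)
  also have "\<dots> = ennreal (\<Prod>(i, j)\<in>UNIV. ball_vol (\<rho> i j))"
    by (rule prod_ennreal) auto
  finally show ?thesis .
qed

lemma mball_eq_box: "mball a r = box a (\<lambda>_ _. r)"
  by (auto simp: mball_def box_def mnorm_le_iff)

subsection \<open>The measure on the general linear group\<close>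

lemma borel_GL: "GL \<in> sets (borel :: ('f^'n^'n) measure)"
  using open_GL by (rule borel_open)

lemma space_haar_mat [simp]: "space (haar_mat \<mu>) = UNIV"
  by (simp add: haar_mat_def)

lemma space_haar_GL [simp]: "space (haar_GL \<mu> :: ('f^'n^'n) measure) = GL"
  by (simp add: haar_GL_def space_restrict_space)

lemma sets_haar_GL: "sets (haar_GL \<mu> :: ('f^'n^'n) measure) = sets (restrict_space borel GL)"
  by (simp add: haar_GL_def cong: sets_restrict_space_cong)

lemma sets_haar_GL_iff: "S \<in> sets (haar_GL \<mu> :: ('f^'n^'n) measure) \<longleftrightarrow> S \<in> sets borel \<and> S \<subseteq> GL"
  using sets_restrict_space_iff[of GL borel S] borel_GL by (auto simp: sets_haar_GL)

lemma emeasure_haar_GL: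
  assumes S: "S \<in> sets borel" "S \<subseteq> GL" and d: "\<And>y. y \<in> S \<Longrightarrow> absv (det y) = d"
  shows "emeasure (haar_GL \<mu>) (S :: ('f^'n^'n) set) = ennreal (inverse (d ^ CARD('n))) * emeasure (haar_mat \<mu>) S"
proof -
  have meas: "(\<lambda>g. ennreal (inverse (absv (det g) ^ CARD('n)))) \<in> borel_measurable (restrict_space (haar_mat \<mu>) (GL :: ('f^'n^'n) set))"
  proof -
    have "continuous_on UNIV (\<lambda>x::'f. absv x)"
      using continuous_on_dist[of UNIV "\<lambda>x. x" "\<lambda>_. 0::'f"] by (simp add: dist_absv)
    then have "continuous_on UNIV (\<lambda>g::'f^'n^'n. absv (det g))"
      by (rule continuous_on_compose2[where g = absv]) (auto intro!: continuous_intros)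
    then have "(\<lambda>g::'f^'n^'n. absv (det g)) \<in> borel_measurable borel"
      by (rule borel_measurable_continuous_onI)
    then have "(\<lambda>g::'f^'n^'n. absv (det g)) \<in> borel_measurable (haar_mat \<mu>)"
      by (simp cong: measurable_cong_sets)
    then show ?thesis by (intro measurable_restrict_space1) measurable
  qed
  have S': "S \<in> sets (restrict_space (haar_mat \<mu>) GL)"
    using S borel_GL sets_restrict_space_iff[of GL "haar_mat \<mu>" S] by simp
  have "emeasure (haar_GL \<mu>) S = (\<integral>\<^sup>+g. ennreal (inverse (absv (det g) ^ CARD('n))) * indicator S g \<partial>restrict_space (haar_mat \<mu>) GL)"
    unfolding haar_GL_def by (rule emeasure_density[OF meas S'])
  also have "\<dots> = (\<integral>\<^sup>+g. ennreal (inverse (d ^ CARD('n))) * indicator S g \<partial>restrict_space (haar_mat \<mu>) GL)"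
    using d by (intro nn_integral_cong) (auto simp: indicator_def)
  also have "\<dots> = ennreal (inverse (d ^ CARD('n))) * emeasure (restrict_space (haar_mat \<mu>) GL) S"
    by (rule nn_integral_cmult_indicator[OF S'])
  also have "emeasure (restrict_space (haar_mat \<mu>) GL) S = emeasure (haar_mat \<mu>) S"
    using S borel_GL by (intro emeasure_restrict_space) auto
  finally show ?thesis .
qed

text \<open>On such a ball the density of the measure of the group with respect to the additive measure is
  constant, which makes its volume explicit.\<close>

definition good_ball :: "'f^'n^'n \<Rightarrow> real \<Rightarrow> bool"
  where "good_ball a r \<longleftrightarrow> 0 < r \<and> mball a r \<subseteq> GL \<and> (\<forall>y\<in>mball a r. absv (det y) = absv (det a))"

lemma good_ballD:
  assumes "good_ball a r"
  shows "0 < r" "mball a r \<subseteq> GL" "a \<in> GL" "\<And>y. y \<in> mball a r \<Longrightarrow> absv (det y) = absv (det a)"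
proof -
  show 1: "0 < r" "mball a r \<subseteq> GL" using assms by (simp_all add: good_ball_def)
  then show "a \<in> GL" using centre_in_mball[of r a] by auto
  show "absv (det y) = absv (det a)" if "y \<in> mball a r" for y
    using assms that unfolding good_ball_def by blast
qed

lemma good_ball_sets: "good_ball a r \<Longrightarrow> mball a r \<in> sets (haar_GL \<mu>)"
  using closed_mball[of a r] good_ballD(2)[of a r] by (simp add: sets_haar_GL_iff)

lemma emeasure_good_ball:
  assumes "good_ball (a :: 'f^'n^'n) r"
  shows "emeasure (haar_GL \<mu>) (mball a r) =
    ennreal (inverse (absv (det a) ^ CARD('n)) * (\<Prod>p\<in>(UNIV :: ('n \<times> 'n) set). ball_vol r))"
proof -
  have "emeasure (haar_GL \<mu>) (mball a r) = ennreal (inverse (absv (det a) ^ CARD('n))) * emeasure (haar_mat \<mu>) (mball a r)"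
    using good_ballD[OF assms] closed_mball[of a r] by (intro emeasure_haar_GL) (simp, assumption, blast)
  then show ?thesis unfolding mball_eq_box emeasure_box
    by (simp add: ennreal_mult case_prod_unfold)
qed

definition ball_measure :: "'f^'n^'n \<Rightarrow> real \<Rightarrow> real"
  where "ball_measure a r = measure (haar_GL \<mu>) (mball a r)"

lemma emeasure_good_ball_finite: "good_ball (a :: 'f^'n^'n) r \<Longrightarrow> emeasure (haar_GL \<mu>) (mball a r) < \<infinity>"
  by (simp add: emeasure_good_ball)

lemma ball_measure_pos:
  assumes "good_ball (a :: 'f^'n^'n) r"
  shows "0 < ball_measure a r"
proof -
  have "a \<in> GL" "r > 0" using good_ballD[OF assms] by blast+
  then have "inverse (absv (det a) ^ CARD('n)) * (\<Prod>p\<in>(UNIV :: ('n \<times> 'n) set). ball_vol r) > 0"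
    by (intro mult_pos_pos prod_pos) (auto simp: GL_iff ball_vol_pos)
  then show ?thesis unfolding ball_measure_def measure_def by (simp add: emeasure_good_ball[OF assms])
qed

text \<open>The preimage of a ball under a scaling of the entries is a box. Its additive volume changes by the product
  of all scaling factors, and the hypothesis on \<open>e\<close> says that the density compensates this
  exactly. Multiplication by a diagonal matrix, from either side, is of this form.\<close>

lemma emeasure_scaled_good_ball:
  fixes \<tau> :: "'f^'n^'n \<Rightarrow> 'f^'n^'n"
  assumes \<tau>: "\<And>X i j. \<tau> X $ i $ j = \<alpha> i j * X $ i $ j" and \<alpha>: "\<And>i j. \<alpha> i j \<noteq> 0"
    and det: "\<And>X. det (\<tau> X) = e * det X" "absv e ^ CARD('n) = (\<Prod>(i, j)\<in>UNIV. absv (\<alpha> i j))"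
    and good: "good_ball a r"
  shows "emeasure (haar_GL \<mu>) (\<tau> -` mball a r) = emeasure (haar_GL \<mu>) (mball a r)"
    and "\<tau> -` mball a r \<in> sets (haar_GL \<mu>)"
proof -
  have r: "r > 0" using good by (simp add: good_ball_def)
  have e: "e \<noteq> 0"
  proof
    assume "e = 0"
    then have "(\<Prod>(i, j)\<in>UNIV. absv (\<alpha> i j)) = 0" using det(2) by (simp add: power_0_left)
    then show False using \<alpha> by (auto simp: absv_eq_zero_iff)
  qed
  have eq: "\<tau> -` mball a r = box (\<chi> i j. a $ i $ j / \<alpha> i j) (\<lambda>i j. r / absv (\<alpha> i j))"
  proof -
    have "absv (\<alpha> i j * x - b) \<le> r \<longleftrightarrow> absv (x - b / \<alpha> i j) \<le> r / absv (\<alpha> i j)" for i j x b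
    proof -
      have "\<alpha> i j * x - b = \<alpha> i j * (x - b / \<alpha> i j)" using \<alpha>[of i j] by (simp add: field_simps)
      then show ?thesis using \<alpha>[of i j] by (simp add: absv_mult pos_le_divide_eq mult.commute)
    qed
    then show ?thesis by (auto simp: mball_eq_box box_def \<tau>)
  qed
  have S: "\<tau> -` mball a r \<in> sets borel" unfolding eq by (rule borel_closed[OF closed_box])
  have sub: "\<tau> -` mball a r \<subseteq> GL"
  proof
    fix y assume "y \<in> \<tau> -` mball a r"
    then have "\<tau> y \<in> GL" using good unfolding good_ball_def by blast
    then show "y \<in> GL" using det(1)[of y] by (auto simp: GL_iff)
  qed
  show "\<tau> -` mball a r \<in> sets (haar_GL \<mu>)" using S sub by (simp add: sets_haar_GL_iff)
  have "absv (det y) = absv (det a) / absv e" if y: "y \<in> \<tau> -` mball a r" for y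
  proof -
    have "absv (det (\<tau> y)) = absv (det a)" using good y unfolding good_ball_def by blast
    moreover have "absv e \<noteq> 0" using e by (simp add: absv_eq_zero_iff)
    ultimately show ?thesis by (simp add: det(1)[of y] absv_mult field_simps)
  qed
  then have "emeasure (haar_GL \<mu>) (\<tau> -` mball a r) =
      ennreal (inverse ((absv (det a) / absv e) ^ CARD('n))) * emeasure (haar_mat \<mu>) (\<tau> -` mball a r)"
    by (rule emeasure_haar_GL[OF S sub])
  also have "\<dots> = ennreal (inverse ((absv (det a) / absv e) ^ CARD('n)) * (\<Prod>(i, j)\<in>UNIV. ball_vol (r / absv (\<alpha> i j))))"
    unfolding eq emeasure_box by (simp add: ennreal_mult prod_nonneg case_prod_unfold)
  also have "(\<Prod>(i, j)\<in>UNIV. ball_vol (r / absv (\<alpha> i j))) = (\<Prod>(i, j)\<in>UNIV. ball_vol r / absv (\<alpha> i j))"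
  proof (intro prod.cong refl)
    fix p :: "'n \<times> 'n"
    have "ball_vol (absv (inverse (\<alpha> i j)) * r) = absv (inverse (\<alpha> i j)) * ball_vol r" for i j
      using \<alpha> r by (intro ball_vol_scale) auto
    then show "(case p of (i, j) \<Rightarrow> ball_vol (r / absv (\<alpha> i j))) = (case p of (i, j) \<Rightarrow> ball_vol r / absv (\<alpha> i j))"
      by (auto simp: divide_inverse mult.commute split: prod.split)
  qed
  also have "\<dots> = (\<Prod>p\<in>(UNIV :: ('n \<times> 'n) set). ball_vol r) / absv e ^ CARD('n)"
    by (simp add: det(2) case_prod_unfold prod_dividef)
  also have "inverse ((absv (det a) / absv e) ^ CARD('n)) * ((\<Prod>p\<in>(UNIV :: ('n \<times> 'n) set). ball_vol r) / absv e ^ CARD('n))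
      = inverse (absv (det a) ^ CARD('n)) * (\<Prod>p\<in>(UNIV :: ('n \<times> 'n) set). ball_vol r)"
    using e by (simp add: power_divide absv_eq_zero_iff field_simps)
  finally show "emeasure (haar_GL \<mu>) (\<tau> -` mball a r) = emeasure (haar_GL \<mu>) (mball a r)"
    by (simp only: emeasure_good_ball[OF good])
qed

end

subsection \<open>Integrals of test functions\<close>

lemma integral_finite_combination:
  fixes c :: "'a \<Rightarrow> complex"
  assumes "finite A" "\<And>a. a \<in> A \<Longrightarrow> S a \<inter> space M \<in> sets M" "\<And>a. a \<in> A \<Longrightarrow> emeasure M (S a \<inter> space M) < \<infinity>"
    and f: "\<And>x. x \<in> space M \<Longrightarrow> f x = (\<Sum>a\<in>A. c a * indicator (S a) x)"
  shows "integrable M f" "integral\<^sup>L M f = (\<Sum>a\<in>A. c a * of_real (measure M (S a \<inter> space M)))"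
proof -
  have ind: "has_bochner_integral M (\<lambda>x. c a * of_real (indicator (S a \<inter> space M) x)) (c a * of_real (measure M (S a \<inter> space M)))"
    if "a \<in> A" for a
    using assms(2,3)[OF that] by (intro has_bochner_integral_mult_right has_bochner_integral_of_real has_bochner_integral_real_indicator) auto
  have "has_bochner_integral M (\<lambda>x. \<Sum>a\<in>A. c a * of_real (indicator (S a \<inter> space M) x)) (\<Sum>a\<in>A. c a * of_real (measure M (S a \<inter> space M)))"
    by (intro has_bochner_integral_sum ind)
  moreover have "f x = (\<Sum>a\<in>A. c a * of_real (indicator (S a \<inter> space M) x))" if "x \<in> space M" for x
    unfolding f[OF that] using that by (intro sum.cong) (auto simp: indicator_def)
  ultimately have "has_bochner_integral M f (\<Sum>a\<in>A. c a * of_real (measure M (S a \<inter> space M)))"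
    by (subst has_bochner_integral_cong[OF refl _ refl]) auto
  then show "integrable M f" "integral\<^sup>L M f = (\<Sum>a\<in>A. c a * of_real (measure M (S a \<inter> space M)))"
    by (auto simp: has_bochner_integral_iff)
qed

lemma finite_disjoint_combination:
  fixes f :: "'a \<Rightarrow> complex"
  assumes "finite A" "disjoint_family_on S A" "\<And>a y. a \<in> A \<Longrightarrow> y \<in> S a \<Longrightarrow> f y = f a"
    and "x \<notin> (\<Union>a\<in>A. S a) \<Longrightarrow> f x = 0"
  shows "f x = (\<Sum>a\<in>A. f a * indicator (S a) x)"
proof (cases "x \<in> (\<Union>a\<in>A. S a)")
  case True
  then obtain b where b: "b \<in> A" "x \<in> S b" by blast
  then have "x \<notin> S a" if "a \<in> A - {b}" for a
    using that assms(2) unfolding disjoint_family_on_def by blast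
  then have "(\<Sum>a\<in>A. f a * indicator (S a) x) = f b * indicator (S b) x"
    using assms(1) b by (intro sum.remove[THEN trans]) (auto intro!: sum.neutral)
  then show ?thesis using b assms(3) by simp
next
  case False
  then show ?thesis using assms(4) by (auto intro!: sum.neutral[symmetric])
qed

definition support_in :: "('a \<Rightarrow> 'b::zero) \<Rightarrow> 'a set \<Rightarrow> bool"
  where "support_in f K \<longleftrightarrow> (\<forall>x. x \<notin> K \<longrightarrow> f x = 0)"

lemma test_fun_GL_iff:
  "f \<in> test_fun GL \<longleftrightarrow> locconst_GL f \<and> (\<exists>K. compact K \<and> K \<subseteq> GL \<and> support_in f K)"
  by (simp add: test_fun_def smooth_fun_GL_iff support_in_def)

context field_haar begin

lemma haar_GL_ball_partition:
  fixes f :: "'f^'n^'n \<Rightarrow> 'b"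
  assumes K: "compact K" "K \<subseteq> GL" and f: "locconst_GL f" and "r0 > 0"
  obtains r A where "0 < r" "r \<le> r0" "finite A" "A \<subseteq> K" "K \<subseteq> (\<Union>a\<in>A. mball a r)"
    "disjoint_family_on (\<lambda>a. mball a r) A" "\<And>a. a \<in> A \<Longrightarrow> good_ball a r"
    "\<And>a y. a \<in> A \<Longrightarrow> y \<in> mball a r \<Longrightarrow> f y = f a"
proof -
  obtain r A where *: "0 < r" "r \<le> r0" "finite A" "A \<subseteq> K" "K \<subseteq> (\<Union>a\<in>A. mball a r)"
    "disjoint_family_on (\<lambda>a. mball a r) A" "\<And>a. a \<in> A \<Longrightarrow> mball a r \<subseteq> GL"
    "\<And>a y. a \<in> A \<Longrightarrow> y \<in> mball a r \<Longrightarrow> (f y, absv (det y)) = (f a, absv (det a))"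
    using compact_ball_partition[OF K locconst_GL_Pair[OF f locconst_GL_absv_det] \<open>r0 > 0\<close>] by blast
  have "good_ball a r" if "a \<in> A" for a
    unfolding good_ball_def using *(1) *(7,8)[OF that] by blast
  moreover have "f y = f a" if "a \<in> A" "y \<in> mball a r" for a y
    using *(8)[OF that] by simp
  ultimately show ?thesis using that[of r A] *(1-6) by blast
qed

lemma haar_GL_integral_partition:
  fixes f :: "'f^'n^'n \<Rightarrow> complex"
  assumes A: "finite A" "disjoint_family_on (\<lambda>a. mball a r) A" "\<And>a. a \<in> A \<Longrightarrow> good_ball a r"
    and f: "\<And>a y. a \<in> A \<Longrightarrow> y \<in> mball a r \<Longrightarrow> f y = f a" "\<And>x. x \<in> GL \<Longrightarrow> x \<notin> (\<Union>a\<in>A. mball a r) \<Longrightarrow> f x = 0"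
  shows "integrable (haar_GL \<mu>) f" "integral\<^sup>L (haar_GL \<mu>) f = (\<Sum>a\<in>A. f a * of_real (ball_measure a r))"
proof -
  have sub: "mball a r \<inter> space (haar_GL \<mu>) = mball a r" if "a \<in> A" for a
    using good_ballD(2)[OF A(3)[OF that]] by auto
  have *: "f x = (\<Sum>a\<in>A. f a * indicator (mball a r) x)" if "x \<in> space (haar_GL \<mu>)" for x
    using that f by (intro finite_disjoint_combination A) auto
  have fin: "mball a r \<inter> space (haar_GL \<mu>) \<in> sets (haar_GL \<mu>)"
      "emeasure (haar_GL \<mu>) (mball a r \<inter> space (haar_GL \<mu>)) < \<infinity>" if "a \<in> A" for a
    unfolding sub[OF that] using A(3)[OF that] good_ball_sets emeasure_good_ball_finite by blast+
  note i = integral_finite_combination[where S = "\<lambda>a. mball a r" and c = f and A = A, OF A(1) _ _ *]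
  show "integrable (haar_GL \<mu>) f"
    by (rule i) (use fin in simp_all)
  have "integral\<^sup>L (haar_GL \<mu>) f = (\<Sum>a\<in>A. f a * of_real (measure (haar_GL \<mu>) (mball a r \<inter> space (haar_GL \<mu>))))"
    by (rule i) (use fin in simp_all)
  also have "\<dots> = (\<Sum>a\<in>A. f a * of_real (ball_measure a r))"
    unfolding ball_measure_def by (intro sum.cong refl) (simp only: sub)
  finally show "integral\<^sup>L (haar_GL \<mu>) f = (\<Sum>a\<in>A. f a * of_real (ball_measure a r))" .
qed

lemma integrable_test_fun_GL:
  fixes f :: "'f^'n^'n \<Rightarrow> complex"
  assumes "f \<in> test_fun GL"
  shows "integrable (haar_GL \<mu>) f"
proof -
  obtain K where K: "locconst_GL f" "compact K" "K \<subseteq> GL" "support_in f K"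
    using assms unfolding test_fun_GL_iff by blast
  obtain r A where A: "0 < r" "r \<le> (1::real)" "finite A" "A \<subseteq> K" "K \<subseteq> (\<Union>a\<in>A. mball a r)"
    "disjoint_family_on (\<lambda>a. mball a r) A" "\<And>a. a \<in> A \<Longrightarrow> good_ball a r"
    "\<And>a y. a \<in> A \<Longrightarrow> y \<in> mball a r \<Longrightarrow> f y = f a"
    using haar_GL_ball_partition[OF K(2,3,1), of 1] by auto
  show ?thesis
    by (rule haar_GL_integral_partition[OF A(3,6,7,8)]) (use A K in \<open>auto simp: support_in_def\<close>)
qed

text \<open>A test function is a combination of indicator functions of small balls, so volumes of
  preimages of balls decide. Only balls around points where \<open>f\<close> does not vanish are considered: the
  additive translations to which this is applied preserve the measure of the group only locally.\<close>

lemma haar_GL_change_of_variables: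
  fixes f :: "'f^'n^'n \<Rightarrow> complex"
  assumes f: "f \<in> test_fun GL" and r0: "r0 > 0"
    and \<tau>: "\<And>b s. f b \<noteq> 0 \<Longrightarrow> s \<le> r0 \<Longrightarrow> good_ball b s \<Longrightarrow> \<tau> -` mball b s \<in> sets (haar_GL \<mu>)"
      "\<And>b s. f b \<noteq> 0 \<Longrightarrow> s \<le> r0 \<Longrightarrow> good_ball b s \<Longrightarrow>
         emeasure (haar_GL \<mu>) (\<tau> -` mball b s) = emeasure (haar_GL \<mu>) (mball b s)"
  shows "(\<integral>g. f (\<tau> g) \<partial>haar_GL \<mu>) = (\<integral>g. f g \<partial>haar_GL \<mu>)"
proof -
  obtain K where K: "locconst_GL f" "compact K" "K \<subseteq> GL" "support_in f K"
    using f unfolding test_fun_GL_iff by blast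
  obtain r A' where A': "0 < r" "r \<le> r0" "finite A'" "A' \<subseteq> K" "K \<subseteq> (\<Union>a\<in>A'. mball a r)"
    "disjoint_family_on (\<lambda>a. mball a r) A'" "\<And>a. a \<in> A' \<Longrightarrow> good_ball a r"
    "\<And>a y. a \<in> A' \<Longrightarrow> y \<in> mball a r \<Longrightarrow> f y = f a"
    using haar_GL_ball_partition[OF K(2,3,1) r0] by blast
  define A where "A = {a \<in> A'. f a \<noteq> 0}"
  have A: "finite A" "disjoint_family_on (\<lambda>a. mball a r) A" "\<And>a. a \<in> A \<Longrightarrow> good_ball a r"
    "\<And>a y. a \<in> A \<Longrightarrow> y \<in> mball a r \<Longrightarrow> f y = f a" "\<And>a. a \<in> A \<Longrightarrow> f a \<noteq> 0"
    using A' unfolding A_def disjoint_family_on_def by auto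
  have out: "f x = 0" if "x \<notin> (\<Union>a\<in>A. mball a r)" for x
  proof (rule ccontr)
    assume "f x \<noteq> 0"
    then have "x \<in> K" using K(4) by (auto simp: support_in_def)
    then obtain a where "a \<in> A'" "x \<in> mball a r" using A'(5) by blast
    then show False using A'(8) \<open>f x \<noteq> 0\<close> \<open>x \<notin> _\<close> unfolding A_def by auto
  qed
  have \<tau>': "\<tau> -` mball a r \<in> sets (haar_GL \<mu>)"
      "emeasure (haar_GL \<mu>) (\<tau> -` mball a r) = emeasure (haar_GL \<mu>) (mball a r)" if "a \<in> A" for a
    using \<tau>[of a r] A(3,5)[OF that] A'(2) by blast+
  have space: "\<tau> -` mball a r \<inter> space (haar_GL \<mu>) = \<tau> -` mball a r" if "a \<in> A" for a
    using sets.sets_into_space[OF \<tau>'(1)[OF that]] by auto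
  have "f (\<tau> x) = (\<Sum>a\<in>A. f a * indicator (\<tau> -` mball a r) x)" for x
    using finite_disjoint_combination[where f = f and x = "\<tau> x", OF A(1,2,4) out] by (simp add: indicator_def)
  then have "(\<integral>g. f (\<tau> g) \<partial>haar_GL \<mu>) = (\<Sum>a\<in>A. f a * of_real (measure (haar_GL \<mu>) (\<tau> -` mball a r \<inter> space (haar_GL \<mu>))))"
    using A(1) \<tau>'(1) emeasure_good_ball_finite[OF A(3)]
    by (intro integral_finite_combination) (simp_all only: space \<tau>'(2))
  also have "\<dots> = (\<Sum>a\<in>A. f a * of_real (ball_measure a r))"
    unfolding ball_measure_def measure_def by (intro sum.cong refl) (simp only: space \<tau>')
  also have "\<dots> = (\<integral>g. f g \<partial>haar_GL \<mu>)"
    by (rule haar_GL_integral_partition(2)[symmetric]) (use A out in auto)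
  finally show ?thesis .
qed

text \<open>One choice of nodes \<open>a\<close> and weights \<open>c a\<close> serves all functions \<open>h\<close> of the values of \<open>q\<close>. When the values lie in
  a vector space and \<open>h\<close> runs through functionals, the integral of \<open>f\<close> times \<open>q\<close> is thereby given as
  a vector.\<close>

lemma test_fun_weighted_sum:
  fixes f :: "'f^'n^'n \<Rightarrow> complex" and q :: "'f^'n^'n \<Rightarrow> 'b"
  assumes f: "f \<in> test_fun GL" and q: "locconst_GL q"
  obtains A c where "finite A" "A \<subseteq> GL"
    "\<And>h. (\<integral>g. f g * h (q g) \<partial>haar_GL \<mu>) = (\<Sum>a\<in>A. c a * h (q a))"
proof -
  obtain K where K: "locconst_GL f" "compact K" "K \<subseteq> GL" "support_in f K"
    using f unfolding test_fun_GL_iff by blast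
  obtain s A where "0 < s" "s \<le> (1::real)" and A: "finite A" "A \<subseteq> K" "K \<subseteq> (\<Union>a\<in>A. mball a s)"
    "disjoint_family_on (\<lambda>a. mball a s) A" "\<And>a. a \<in> A \<Longrightarrow> good_ball a s"
    "\<And>a y. a \<in> A \<Longrightarrow> y \<in> mball a s \<Longrightarrow> (f y, q y) = (f a, q a)"
    by (rule haar_GL_ball_partition[OF K(2,3) locconst_GL_Pair[OF K(1) q] zero_less_one]) (rule that; assumption)
  have "(\<integral>g. f g * h (q g) \<partial>haar_GL \<mu>) = (\<Sum>a\<in>A. (f a * of_real (ball_measure a s)) * h (q a))"
    for h :: "'b \<Rightarrow> complex"
  proof -
    have "(\<integral>g. f g * h (q g) \<partial>haar_GL \<mu>) = (\<Sum>a\<in>A. (f a * h (q a)) * of_real (ball_measure a s))"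
    proof (rule haar_GL_integral_partition(2)[OF A(1,4,5)])
      show "f y * h (q y) = f a * h (q a)" if "a \<in> A" "y \<in> mball a s" for a y
        using A(6)[OF that] by simp
      show "f y * h (q y) = 0" if "y \<notin> (\<Union>a\<in>A. mball a s)" for y
      proof -
        have "y \<notin> K" using that A(3) by blast
        then show ?thesis using K(4) by (simp add: support_in_def)
      qed
    qed
    then show ?thesis by (simp add: mult_ac)
  qed
  then show ?thesis by (rule that[OF A(1) subset_trans[OF A(2) K(3)]])
qed

end

section \<open>Invariance and disintegration\<close>

lemma test_fun_GL_precomp:
  fixes f :: "'f::nonarch_local_field_0^'n^'n \<Rightarrow> complex"
  assumes f: "f \<in> test_fun GL"
    and h: "continuous_on UNIV (h :: 'f^'n^'n \<Rightarrow> 'f^'n^'n)" "\<And>x. x \<in> GL \<Longrightarrow> h x \<in> GL"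
    and k: "continuous_on UNIV k" "\<And>x. x \<in> GL \<Longrightarrow> k x \<in> GL" "\<And>x. k (h x) = x"
  shows "(\<lambda>x. f (h x :: 'f^'n^'n)) \<in> test_fun GL"
proof -
  obtain K where K: "locconst_GL f" "compact K" "K \<subseteq> GL" "support_in f K"
    using f unfolding test_fun_GL_iff by blast
  have "compact (k ` K)" using K(2) k(1) compact_continuous_image continuous_on_subset by blast
  moreover have "k ` K \<subseteq> GL" using K(3) k(2) by auto
  moreover have "support_in (\<lambda>x. f (h x)) (k ` K)"
    unfolding support_in_def
  proof (intro allI impI)
    fix x assume "x \<notin> k ` K"
    then have "h x \<notin> K" using k(3)[of x] by (metis imageI)
    then show "f (h x) = 0" using K(4) by (simp add: support_in_def)
  qed
  ultimately show ?thesis unfolding test_fun_GL_iff using locconst_GL_precomp[OF K(1) h] by blast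
qed

lemma locconst_GL_indicator_mball:
  "r > 0 \<Longrightarrow> locconst_GL (indicator (mball a r) :: 'f::nonarch_local_field_0^'n^'n \<Rightarrow> complex)"
proof -
  assume "r > 0"
  then have "locconst_GL (\<lambda>x. x \<in> mball a r)" by (intro locconst_GL_indicator open_mball closed_mball)
  then have "locconst_GL (\<lambda>x. of_bool (x \<in> mball a r) :: complex)" by (rule locconst_GL_comp)
  moreover have "(\<lambda>x. of_bool (x \<in> mball a r) :: complex) = indicator (mball a r)"
    by (auto simp: indicator_def)
  ultimately show ?thesis by (simp only:)
qed

lemma test_fun_GL_mult_left:
  fixes f :: "'f::nonarch_local_field_0^'n^'n \<Rightarrow> complex"
  assumes "f \<in> test_fun GL" "h \<in> GL"
  shows "(\<lambda>g. f (h ** g)) \<in> test_fun GL"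
  by (rule test_fun_GL_precomp[OF assms(1), where k = "\<lambda>g. matrix_inv h ** g"])
    (use assms(2) in \<open>auto intro!: continuous_intros\<close>)

lemma test_fun_GL_mult_right:
  fixes f :: "'f::nonarch_local_field_0^'n^'n \<Rightarrow> complex"
  assumes "f \<in> test_fun GL" "h \<in> GL"
  shows "(\<lambda>g. f (g ** h)) \<in> test_fun GL"
  by (rule test_fun_GL_precomp[OF assms(1), where k = "\<lambda>g. g ** matrix_inv h"])
    (use assms(2) in \<open>auto intro!: continuous_intros simp: matrix_mul_assoc[symmetric]\<close>)

text \<open>Entries of a diagonal matrix of determinant \<open>e\<close>: the choice operator picks one position for \<open>e\<close>.\<close>

definition diag_entry :: "'f \<Rightarrow> 'n \<Rightarrow> 'f::nonarch_local_field_0"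
  where "diag_entry e i = (if i = (SOME k. True) then e else 1)"

definition diag_mat :: "'f::nonarch_local_field_0 \<Rightarrow> 'f^'n^'n"
  where "diag_mat e = (\<chi> i j. if i = j then diag_entry e i else 0)"

lemma prod_diag_entry: "(\<Prod>i\<in>(UNIV::'n::finite set). diag_entry e i) = e"
  by (simp add: diag_entry_def)

lemma det_diag_mat: "det (diag_mat e :: 'f::nonarch_local_field_0^'n^'n) = e"
proof -
  have "det (diag_mat e :: 'f^'n^'n) = (\<Prod>i\<in>UNIV. (diag_mat e :: 'f^'n^'n) $ i $ i)"
    by (rule det_diagonal) (simp add: diag_mat_def)
  then show ?thesis by (simp add: diag_mat_def prod_diag_entry)
qed

lemma diag_mat_mult_nth: "(diag_mat e ** X) $ i $ j = diag_entry e i * X $ i $ j"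
proof -
  have "(diag_mat e ** X) $ i $ j = (\<Sum>k\<in>UNIV. (if i = k then diag_entry e i else 0) * X $ k $ j)"
    by (simp add: matrix_matrix_mult_def diag_mat_def)
  also have "\<dots> = (\<Sum>k\<in>UNIV. if i = k then diag_entry e i * X $ k $ j else 0)"
    by (rule sum.cong) auto
  finally show ?thesis by simp
qed

lemma mult_diag_mat_nth: "(X ** diag_mat e) $ i $ j = diag_entry e j * X $ i $ j"
proof -
  have "(X ** diag_mat e) $ i $ j = (\<Sum>k\<in>UNIV. X $ i $ k * (if k = j then diag_entry e k else 0))"
    by (simp add: matrix_matrix_mult_def diag_mat_def)
  also have "\<dots> = (\<Sum>k\<in>UNIV. if k = j then diag_entry e j * X $ i $ k else 0)"
    by (rule sum.cong) auto
  finally show ?thesis by simp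
qed

locale kernel_setting = field_haar \<mu>
  for \<mu> :: "'f::nonarch_local_field_0 measure" +
  fixes \<psi> :: "'f \<Rightarrow> complex" and \<nu> :: "'f \<Rightarrow> ('f^'n^'n) measure"
  assumes psi: "unramified_additive_character \<psi>"
    and fibre: "det_fibre_measures \<mu> \<nu>"
begin

lemma sets_nu: "x \<noteq> 0 \<Longrightarrow> sets (\<nu> x) = sets (restrict_space borel (det_fibre x))"
  using fibre by (simp add: det_fibre_measures_def)

lemma space_nu: "x \<noteq> 0 \<Longrightarrow> space (\<nu> x) = det_fibre x"
  using sets_eq_imp_space_eq[OF sets_nu] by (simp add: space_restrict_space)

lemma emeasure_nu_compact: "x \<noteq> 0 \<Longrightarrow> compact K \<Longrightarrow> K \<subseteq> det_fibre x \<Longrightarrow> emeasure (\<nu> x) K < \<infinity>"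
  using fibre by (simp add: det_fibre_measures_def)

lemma det_fibre_GL: "x \<noteq> 0 \<Longrightarrow> det_fibre x \<subseteq> (GL :: ('f^'n^'n) set)"
  by (auto simp: det_fibre_def GL_iff)

lemma closed_det_fibre: "closed (det_fibre x :: ('f^'n^'n) set)"
proof -
  have "closed ((\<lambda>g. det g) -` {x} :: ('f^'n^'n) set)"
    by (intro closed_vimage continuous_intros closed_singleton)
  moreover have "((\<lambda>g. det g) -` {x} :: ('f^'n^'n) set) = det_fibre x" by (auto simp: det_fibre_def)
  ultimately show ?thesis by simp
qed

lemma sets_nu_iff: "x \<noteq> 0 \<Longrightarrow> S \<in> sets (\<nu> x) \<longleftrightarrow> S \<in> sets borel \<and> S \<subseteq> det_fibre x"
  using sets_restrict_space_iff[of "det_fibre x" borel S] borel_closed[OF closed_det_fibre[of x]]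
  by (auto simp: sets_nu)

text \<open>On the fibre, the support is compact and the function is a finite combination of indicator
  functions of compact sets, which have finite measure.\<close>

lemma integrable_fibre:
  fixes f :: "'f^'n^'n \<Rightarrow> complex"
  assumes x: "x \<noteq> 0" and f: "locconst_GL f" and R: "\<And>g. det g = x \<Longrightarrow> R < mnorm g \<Longrightarrow> f g = 0"
  shows "integrable (\<nu> x) f"
proof -
  let ?K = "mball 0 R \<inter> det_fibre x :: ('f^'n^'n) set"
  have K: "compact ?K" "?K \<subseteq> GL"
    using compact_mball closed_det_fibre det_fibre_GL[OF x] by (auto intro!: compact_Int_closed)
  obtain r A where A: "0 < r" "r \<le> (1::real)" "finite A" "A \<subseteq> ?K" "?K \<subseteq> (\<Union>a\<in>A. mball a r)"
    "disjoint_family_on (\<lambda>a. mball a r) A" "\<And>a. a \<in> A \<Longrightarrow> mball a r \<subseteq> GL"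
    "\<And>a y. a \<in> A \<Longrightarrow> y \<in> mball a r \<Longrightarrow> f y = f a"
    using compact_ball_partition[OF K f, of 1] by auto
  have fin: "mball a r \<inter> space (\<nu> x) \<in> sets (\<nu> x)" "emeasure (\<nu> x) (mball a r \<inter> space (\<nu> x)) < \<infinity>" for a
  proof -
    have "compact (mball a r \<inter> space (\<nu> x))"
      using x compact_mball closed_det_fibre by (auto simp: space_nu intro!: compact_Int_closed)
    then show "mball a r \<inter> space (\<nu> x) \<in> sets (\<nu> x)" "emeasure (\<nu> x) (mball a r \<inter> space (\<nu> x)) < \<infinity>"
      using x emeasure_nu_compact[OF x, of "mball a r \<inter> space (\<nu> x)"]
      by (auto simp: sets_nu_iff space_nu borel_compact)
  qed
  have sum: "f g = (\<Sum>a\<in>A. f a * indicator (mball a r) g)" if g: "g \<in> space (\<nu> x)" for g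
  proof (rule finite_disjoint_combination[OF A(3,6,8)])
    assume "g \<notin> (\<Union>a\<in>A. mball a r)"
    then have "g \<notin> ?K" using A(5) by blast
    then show "f g = 0" using R[of g] g x by (auto simp: space_nu mem_mball det_fibre_def not_le)
  qed
  show ?thesis by (rule integral_finite_combination[OF A(3) fin sum])
qed

lemma measurable_fibre_mult:
  assumes x: "x \<noteq> 0" and h: "continuous_on UNIV (h :: 'f^'n^'n \<Rightarrow> 'f^'n^'n)" "\<And>g. det (h g) = det g"
  shows "h \<in> measurable (\<nu> x) (\<nu> x)"
proof -
  have "h \<in> measurable (restrict_space borel (det_fibre x)) (restrict_space borel (det_fibre x))"
    using h by (intro measurable_restrict_space3 borel_measurable_continuous_onI) (auto simp: det_fibre_def)
  then show ?thesis using sets_nu[OF x] by (simp cong: measurable_cong_sets)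
qed

lemma integral_fibre_mult_right:
  fixes f :: "'f^'n^'n \<Rightarrow> complex"
  assumes x: "x \<noteq> 0" and s: "det s = 1" and f: "integrable (\<nu> x) f"
  shows "(\<integral>g. f (g ** s) \<partial>\<nu> x) = (\<integral>g. f g \<partial>\<nu> x)"
proof -
  have "distr (\<nu> x) (\<nu> x) (\<lambda>g. g ** s) = \<nu> x" using fibre x s by (simp add: det_fibre_measures_def)
  moreover have "(\<integral>g. f g \<partial>distr (\<nu> x) (\<nu> x) (\<lambda>g. g ** s)) = (\<integral>g. f (g ** s) \<partial>\<nu> x)"
    using f s by (intro integral_distr measurable_fibre_mult[OF x]) (auto intro!: continuous_intros simp: det_mul)
  ultimately show ?thesis by simp
qed

lemma integral_fibre_mult_left:
  fixes f :: "'f^'n^'n \<Rightarrow> complex"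
  assumes x: "x \<noteq> 0" and s: "det s = 1" and f: "integrable (\<nu> x) f"
  shows "(\<integral>g. f (s ** g) \<partial>\<nu> x) = (\<integral>g. f g \<partial>\<nu> x)"
proof -
  have "distr (\<nu> x) (\<nu> x) (\<lambda>g. s ** g) = \<nu> x" using fibre x s by (simp add: det_fibre_measures_def)
  moreover have "(\<integral>g. f g \<partial>distr (\<nu> x) (\<nu> x) (\<lambda>g. s ** g)) = (\<integral>g. f (s ** g) \<partial>\<nu> x)"
    using f s by (intro integral_distr measurable_fibre_mult[OF x]) (auto intro!: continuous_intros simp: det_mul)
  ultimately show ?thesis by simp
qed

lemma test_fun_integrable_fibre:
  fixes f :: "'f^'n^'n \<Rightarrow> complex"
  assumes "f \<in> test_fun GL" "x \<noteq> 0"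
  shows "integrable (\<nu> x) f"
proof -
  obtain K where K: "locconst_GL f" "compact K" "support_in f K"
    using assms(1) unfolding test_fun_GL_iff by blast
  obtain R where "\<And>y. y \<in> K \<Longrightarrow> mnorm y \<le> R" using compact_imp_mnorm_bounded[OF K(2)] by blast
  then show ?thesis
    using K by (intro integrable_fibre[OF assms(2) K(1), of R]) (auto simp: support_in_def not_le[symmetric])
qed

lemma disintegration:
  "f \<in> test_fun GL \<Longrightarrow> (\<integral>g. f g \<partial>haar_GL \<mu>) = (\<integral>x. (\<integral>g. f g \<partial>\<nu> x) \<partial>haar_units \<mu>)"
  using fibre by (simp add: det_fibre_measures_def)

lemma space_haar_units [simp]: "space (haar_units \<mu>) = - {0}"
  by (simp add: haar_units_def space_restrict_space)

lemma haar_GL_invariant_of_fibre: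
  fixes f :: "'f^'n^'n \<Rightarrow> complex"
  assumes "f \<in> test_fun GL" "(\<lambda>g. f (h g)) \<in> test_fun GL"
    "\<And>x. x \<noteq> 0 \<Longrightarrow> (\<integral>g. f (h g) \<partial>\<nu> x) = (\<integral>g. f g \<partial>\<nu> x)"
  shows "(\<integral>g. f (h g) \<partial>haar_GL \<mu>) = (\<integral>g. f g \<partial>haar_GL \<mu>)"
  unfolding disintegration[OF assms(1)] disintegration[OF assms(2)]
  by (rule Bochner_Integration.integral_cong) (auto simp: assms(3))

text \<open>The special linear group leaves the measure invariant because it does so on every fibre; only
  one diagonal matrix for each determinant remains to be treated by computing volumes.\<close>

lemma haar_GL_mult_diag:
  fixes f :: "'f^'n^'n \<Rightarrow> complex"
  assumes f: "f \<in> test_fun GL" and e: "e \<noteq> 0"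
  shows "(\<integral>g. f (diag_mat e ** g) \<partial>haar_GL \<mu>) = (\<integral>g. f g \<partial>haar_GL \<mu>)"
    and "(\<integral>g. f (g ** diag_mat e) \<partial>haar_GL \<mu>) = (\<integral>g. f g \<partial>haar_GL \<mu>)"
proof -
  have nz: "diag_entry e i \<noteq> 0" for i :: 'n using e by (simp add: diag_entry_def)
  have abs: "(\<Prod>i\<in>(UNIV::'n set). absv (diag_entry e i)) = absv e"
    by (simp add: prod_diag_entry flip: absv_prod)
  have p1: "absv e ^ CARD('n) = (\<Prod>(i, j)\<in>(UNIV :: ('n \<times> 'n) set). absv (diag_entry e i))"
  proof -
    have "(\<Prod>(i, j)\<in>(UNIV :: 'n set) \<times> (UNIV :: 'n set). absv (diag_entry e i)) = (\<Prod>i\<in>(UNIV::'n set). \<Prod>j\<in>(UNIV::'n set). absv (diag_entry e i))"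
      by (rule prod.cartesian_product[symmetric])
    then show ?thesis by (simp add: prod_power_distrib[symmetric] abs)
  qed
  have p2: "absv e ^ CARD('n) = (\<Prod>(i, j)\<in>(UNIV :: ('n \<times> 'n) set). absv (diag_entry e j))"
  proof -
    have "(\<Prod>(i, j)\<in>(UNIV :: 'n set) \<times> (UNIV :: 'n set). absv (diag_entry e j)) = (\<Prod>i\<in>(UNIV::'n set). \<Prod>j\<in>(UNIV::'n set). absv (diag_entry e j))"
      by (rule prod.cartesian_product[symmetric])
    then show ?thesis by (simp add: abs)
  qed
  show "(\<integral>g. f (diag_mat e ** g) \<partial>haar_GL \<mu>) = (\<integral>g. f g \<partial>haar_GL \<mu>)"
    by (rule haar_GL_change_of_variables[OF f zero_less_one])
      (rule emeasure_scaled_good_ball[where \<alpha> = "\<lambda>i j. diag_entry e i" and e = e]; simp add: diag_mat_mult_nth nz det_mul det_diag_mat p1)+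
  show "(\<integral>g. f (g ** diag_mat e) \<partial>haar_GL \<mu>) = (\<integral>g. f g \<partial>haar_GL \<mu>)"
    by (rule haar_GL_change_of_variables[OF f zero_less_one])
      (rule emeasure_scaled_good_ball[where \<alpha> = "\<lambda>i j. diag_entry e j" and e = e]; simp add: mult_diag_mat_nth nz det_mul det_diag_mat p2)+
qed

lemma haar_GL_mult_left:
  fixes f :: "'f^'n^'n \<Rightarrow> complex"
  assumes f: "f \<in> test_fun GL" and h: "h \<in> GL"
  shows "(\<integral>g. f (h ** g) \<partial>haar_GL \<mu>) = (\<integral>g. f g \<partial>haar_GL \<mu>)"
proof -
  define d :: "'f^'n^'n" where "d = diag_mat (det h)"
  define s where "s = h ** matrix_inv d"
  have d: "det d = det h" "d \<in> GL" using h by (auto simp: d_def det_diag_mat GL_iff)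
  then have s: "det s = 1" "s \<in> GL" using h by (auto simp: s_def det_mul det_matrix_inv GL_iff)
  have sd: "s ** d = h" using d by (simp add: s_def flip: matrix_mul_assoc)
  have f': "(\<lambda>g. f (s ** g)) \<in> test_fun GL" using test_fun_GL_mult_left[OF f s(2)] .
  have "(\<integral>g. f (s ** (d ** g)) \<partial>haar_GL \<mu>) = (\<integral>g. f (s ** g) \<partial>haar_GL \<mu>)"
    unfolding d_def by (rule haar_GL_mult_diag(1)[OF f']) (use h in \<open>simp add: GL_iff\<close>)
  also have "\<dots> = (\<integral>g. f g \<partial>haar_GL \<mu>)"
    by (rule haar_GL_invariant_of_fibre[OF f f'])
      (rule integral_fibre_mult_left[OF _ s(1) test_fun_integrable_fibre[OF f]])
  finally show ?thesis by (simp add: matrix_mul_assoc sd)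
qed

lemma haar_GL_mult_right:
  fixes f :: "'f^'n^'n \<Rightarrow> complex"
  assumes f: "f \<in> test_fun GL" and h: "h \<in> GL"
  shows "(\<integral>g. f (g ** h) \<partial>haar_GL \<mu>) = (\<integral>g. f g \<partial>haar_GL \<mu>)"
proof -
  define d :: "'f^'n^'n" where "d = diag_mat (det h)"
  define s where "s = matrix_inv d ** h"
  have d: "det d = det h" "d \<in> GL" using h by (auto simp: d_def det_diag_mat GL_iff)
  then have s: "det s = 1" "s \<in> GL" using h by (auto simp: s_def det_mul det_matrix_inv GL_iff)
  have sd: "d ** s = h" using d by (simp add: s_def)
  have f': "(\<lambda>g. f (g ** s)) \<in> test_fun GL" using test_fun_GL_mult_right[OF f s(2)] .
  have "(\<integral>g. f ((g ** d) ** s) \<partial>haar_GL \<mu>) = (\<integral>g. f (g ** s) \<partial>haar_GL \<mu>)"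
    unfolding d_def by (rule haar_GL_mult_diag(2)[OF f']) (use h in \<open>simp add: GL_iff\<close>)
  also have "\<dots> = (\<integral>g. f g \<partial>haar_GL \<mu>)"
    by (rule haar_GL_invariant_of_fibre[OF f f'])
      (rule integral_fibre_mult_right[OF _ s(1) test_fun_integrable_fibre[OF f]])
  finally show ?thesis by (simp add: sd flip: matrix_mul_assoc)
qed

lemma haar_GL_conj:
  fixes f :: "'f^'n^'n \<Rightarrow> complex"
  assumes f: "f \<in> test_fun GL" and h: "h \<in> GL"
  shows "(\<integral>g. f (h ** g ** matrix_inv h) \<partial>haar_GL \<mu>) = (\<integral>g. f g \<partial>haar_GL \<mu>)"
proof -
  have f': "(\<lambda>g. f (g ** matrix_inv h)) \<in> test_fun GL" using test_fun_GL_mult_right[OF f] h by simp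
  show ?thesis
    using haar_GL_mult_left[OF f' h] haar_GL_mult_right[OF f matrix_inv_GL[OF h]] by simp
qed

text \<open>An integral in the sense of Bochner vanishes when the integrand is not integrable. As the
  volume of a ball is positive, the disintegration formula therefore forces its fibre volumes to be an
  integrable function of the determinant.\<close>

lemma integrable_fibre_ball:
  assumes "good_ball (a :: 'f^'n^'n) r"
  shows "integrable (haar_units \<mu>) (\<lambda>x. (\<integral>g. indicator (mball a r) g \<partial>\<nu> x) :: complex)"
proof (rule ccontr)
  let ?f = "\<lambda>g. indicator (mball a r) g :: complex"
  note r = good_ballD[OF assms]
  have "locconst_GL ?f" by (rule locconst_GL_indicator_mball[OF r(1)])
  then have f: "?f \<in> test_fun GL" unfolding test_fun_GL_iff support_in_def
    using compact_mball[of a r] r(2) by (intro conjI exI[of _ "mball a r"]) auto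
  assume "\<not> integrable (haar_units \<mu>) (\<lambda>x. \<integral>g. ?f g \<partial>\<nu> x)"
  then have "(\<integral>g. ?f g \<partial>haar_GL \<mu>) = 0"
    unfolding disintegration[OF f] by (rule not_integrable_integral_eq)
  moreover have "(\<integral>g. ?f g \<partial>haar_GL \<mu>) = of_real (ball_measure a r)"
    using haar_GL_integral_partition(2)[of "{a}" r ?f] assms r(1)
    by (simp add: disjoint_family_on_def indicator_def)
  ultimately show False using ball_measure_pos[OF assms] by simp
qed

lemma integrable_fibre_integral:
  fixes f :: "'f^'n^'n \<Rightarrow> complex"
  assumes "f \<in> test_fun GL"
  shows "integrable (haar_units \<mu>) (\<lambda>x. \<integral>g. f g \<partial>\<nu> x)"
proof -
  obtain K where K: "locconst_GL f" "compact K" "K \<subseteq> GL" "support_in f K"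
    using assms unfolding test_fun_GL_iff by blast
  obtain r A where A: "0 < r" "r \<le> (1::real)" "finite A" "A \<subseteq> K" "K \<subseteq> (\<Union>a\<in>A. mball a r)"
    "disjoint_family_on (\<lambda>a. mball a r) A" "\<And>a. a \<in> A \<Longrightarrow> good_ball a r"
    "\<And>a y. a \<in> A \<Longrightarrow> y \<in> mball a r \<Longrightarrow> f y = f a"
    using haar_GL_ball_partition[OF K(2,3,1), of 1] by auto
  have sum: "f g = (\<Sum>a\<in>A. f a * indicator (mball a r) g)" for g
    by (rule finite_disjoint_combination[OF A(3,6,8)]) (use A(5) K(4) in \<open>auto simp: support_in_def\<close>)
  have "(\<integral>g. f g \<partial>\<nu> x) = (\<Sum>a\<in>A. f a * (\<integral>g. indicator (mball a r) g \<partial>\<nu> x))" if x: "x \<noteq> 0" for x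
  proof -
    have "integrable (\<nu> x) (indicator (mball a r) :: _ \<Rightarrow> complex)" for a
    proof (rule integrable_fibre[OF x, where R = "max r (mnorm a)"])
      show "locconst_GL (indicator (mball a r) :: _ \<Rightarrow> complex)" 
        by (rule locconst_GL_indicator_mball[OF A(1)])
      fix g :: "'f^'n^'n" assume "max r (mnorm a) < mnorm g"
      then have "\<not> mnorm ((g - a) + a) \<le> max r (mnorm a)" unfolding diff_add_cancel by linarith
      then have "\<not> mnorm (g - a) \<le> max r (mnorm a)"
        using mnorm_add_le[of "g - a" "max r (mnorm a)" a] max.cobounded2 by blast
      then have "g \<notin> mball a r" by (simp add: mem_mball)
      then show "indicator (mball a r) g = (0::complex)" by simp
    qed
    then have "(\<integral>g. (\<Sum>a\<in>A. f a * indicator (mball a r) g) \<partial>\<nu> x) =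
        (\<Sum>a\<in>A. f a * (\<integral>g. indicator (mball a r) g \<partial>\<nu> x))"
      by (subst Bochner_Integration.integral_sum) auto
    moreover have "(\<integral>g. f g \<partial>\<nu> x) = (\<integral>g. (\<Sum>a\<in>A. f a * indicator (mball a r) g) \<partial>\<nu> x)"
      by (rule Bochner_Integration.integral_cong[OF refl sum])
    ultimately show ?thesis by (rule trans[rotated])
  qed
  then have eq: "(\<integral>g. f g \<partial>\<nu> x) = (\<Sum>a\<in>A. f a * (\<integral>g. indicator (mball a r) g \<partial>\<nu> x))" if "x \<in> space (haar_units \<mu>)" for x
    using that by simp
  have "integrable (haar_units \<mu>) (\<lambda>x. \<Sum>a\<in>A. f a * (\<integral>g. indicator (mball a r) g \<partial>\<nu> x))"
    by (intro Bochner_Integration.integrable_sum integrable_mult_right integrable_fibre_ball A(7))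
  then show ?thesis by (subst Bochner_Integration.integrable_cong[OF refl eq])
qed

section \<open>Cancellation\<close>

lemma psi_add: "\<psi> (x + y) = \<psi> x * \<psi> y"
  and psi_integer: "absv x \<le> 1 \<Longrightarrow> \<psi> x = 1"
  using psi by (auto simp: unramified_additive_character_def ring_of_integers_def)

lemma psi_eq: "absv (x - y) \<le> 1 \<Longrightarrow> \<psi> x = \<psi> y"
  using psi_add[of "x - y" y] psi_integer[of "x - y"] by simp

lemma psi_nontrivial: "\<exists>b. \<psi> b \<noteq> 1"
proof -
  obtain w :: 'f where "uniformizer w" using uniformizer_exists by blast
  then show ?thesis using psi unfolding unramified_additive_character_def by blast
qed

text \<open>The character is non-trivial on the ball of this radius, and hence on every larger one.\<close>

definition psi_bound :: real
  where "psi_bound = absv (SOME b. \<psi> b \<noteq> 1)"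

lemma psi_bound_pos: "psi_bound > 0"
proof -
  have "\<psi> (SOME b. \<psi> b \<noteq> 1) \<noteq> 1" using someI_ex[OF psi_nontrivial] .
  then have "(SOME b. \<psi> b \<noteq> 1) \<noteq> 0" using psi_integer[of 0] by auto
  then show ?thesis unfolding psi_bound_def by simp
qed

lemma psi_detects:
  assumes "r > 0" "psi_bound / r \<le> absv a"
  obtains t where "absv t \<le> r" "\<psi> (t * a) \<noteq> 1"
proof -
  define b where "b = (SOME b. \<psi> b \<noteq> 1)"
  have b: "\<psi> b \<noteq> 1" "absv b = psi_bound" using someI_ex[OF psi_nontrivial] by (auto simp: b_def psi_bound_def)
  have "psi_bound / r > 0" using assms(1) psi_bound_pos by simp
  then have a: "absv a > 0" using assms(2) by linarith
  then have "absv (b / a) \<le> r" using assms b by (simp add: absv_divide field_simps)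
  moreover have "b / a * a = b" using a by auto
  ultimately show ?thesis using that[of "b / a"] b by simp
qed

lemma psi_trace_eq: "mnorm (y - x) \<le> 1 \<Longrightarrow> \<psi> (trace y) = \<psi> (trace x)"
  using absv_trace_le[of "y - x"] by (intro psi_eq) (simp add: trace_sub)

lemma locconst_psi_trace_mult: "locconst_GL (\<lambda>u :: 'f^'n^'n. \<psi> (trace (g ** u)))"
  unfolding locconst_GL_def
proof
  fix z :: "'f^'n^'n"
  have pos: "mnorm g + 1 > 0" using mnorm_nonneg[of g] by linarith
  have "\<psi> (trace (g ** v)) = \<psi> (trace (g ** z))" if "v \<in> mball z (1 / (mnorm g + 1))" for v
  proof (rule psi_trace_eq)
    have "mnorm (g ** v - g ** z) \<le> (mnorm g + 1) * (1 / (mnorm g + 1))"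
      unfolding matrix_sub_ldistrib'[symmetric] using that by (intro mnorm_mult_le') (auto simp: mem_mball)
    then show "mnorm (g ** v - g ** z) \<le> 1" using pos by simp
  qed
  moreover have "1 / (mnorm g + 1) > 0" using pos by simp
  ultimately show "\<exists>r>0. \<forall>v\<in>mball z r. \<psi> (trace (g ** v)) = \<psi> (trace (g ** z))" by blast
qed

text \<open>The nilpotent directions in which the trace form of \<open>y\<close> is as large as the norm of \<open>y\<close> permits.\<close>

definition sharp :: "'f^'n^'n \<Rightarrow> ('f^'n^'n) set"
  where "sharp y = {N \<in> nilp. absv (trace (y ** N)) = mnorm y}"

definition direction :: "'f^'n^'n \<Rightarrow> 'f^'n^'n"
  where "direction y = (SOME N. N \<in> sharp y)"

text \<open>The second component is the residue class of the trace form modulo the ring of integers; for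
  \<open>absv t \<le> 1\<close> it determines the phase \<open>\<psi> (t * trace (y ** direction y))\<close>. Without a sharp direction the
  choice operator returns an arbitrary matrix, and the empty set keeps the class
  locally constant.\<close>

definition phase_class :: "'f^'n^'n \<Rightarrow> ('f^'n^'n) \<times> 'f set"
  where "phase_class y = (direction y,
    if sharp y = {} then {} else {a. absv (a - trace (y ** direction y)) \<le> 1})"

lemma absv_trace_nilp_le: "N \<in> nilp \<Longrightarrow> absv (trace (X ** N)) \<le> mnorm X"
  using absv_trace_le[of "X ** N"] mnorm_mult_le'[of X "mnorm X" N 1] by (simp add: nilp_def)

text \<open>By the ultrametric inequality neither the norm of \<open>y\<close> nor a trace of that absolute value changes under a smaller
  perturbation. Therefore a translation by \<open>mat 1 + mat t ** N\<close> leaves the chosen direction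
  unchanged.\<close>

lemma sharp_perturb:
  assumes "mnorm (y' - y) < mnorm y"
  shows "sharp y' = sharp y"
proof -
  have n: "mnorm y' = mnorm y" using mnorm_add_eq[OF assms] by simp
  have "absv (trace (y' ** N)) = mnorm y \<longleftrightarrow> absv (trace (y ** N)) = mnorm y" if "N \<in> nilp" for N
  proof -
    have eq: "trace (y' ** N) = trace (y ** N) + trace ((y' - y) ** N)"
      by (simp add: matrix_add_rdistrib'[symmetric] trace_add[symmetric])
    have small: "absv (trace ((y' - y) ** N)) < mnorm y"
      using absv_trace_nilp_le[OF that, of "y' - y"] assms by linarith
    show ?thesis
    proof
      assume "absv (trace (y ** N)) = mnorm y"
      then show "absv (trace (y' ** N)) = mnorm y" using absv_add_eq small eq by metis
    next
      assume *: "absv (trace (y' ** N)) = mnorm y"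
      have "trace (y ** N) = trace (y' ** N) + - trace ((y' - y) ** N)" using eq by simp
      then show "absv (trace (y ** N)) = mnorm y"
        using absv_add_eq[of "- trace ((y' - y) ** N)" "trace (y' ** N)"] small * by simp
    qed
  qed
  then show ?thesis by (auto simp: sharp_def n)
qed

lemma direction_sharp: "sharp y \<noteq> {} \<Longrightarrow> direction y \<in> sharp y"
  unfolding direction_def by (rule someI_ex) blast

lemma sharp_nonempty:
  assumes "absv (det y) < mnorm y ^ CARD('n)"
  shows "sharp (y :: 'f^'n^'n) \<noteq> {}"
proof -
  obtain N where "N \<in> nilp" "absv (trace (y ** N)) = mnorm y" using nilp_detects[OF assms] .
  then show ?thesis by (auto simp: sharp_def)
qed

lemma class_eq: "absv (a - b) \<le> 1 \<Longrightarrow> {c. absv (c - a) \<le> 1} = {c. absv (c - b) \<le> (1::real)}" for a b :: 'f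
proof -
  assume ab: "absv (a - b) \<le> 1"
  have "absv (c - a) \<le> 1 \<longleftrightarrow> absv (c - b) \<le> 1" for c
    using absv_add_le[of "c - a" 1 "a - b"] absv_diff_le[of "c - b" 1 "a - b"] ab by auto
  then show ?thesis by simp
qed

lemma locconst_GL_phase_class:
  assumes u: "u \<in> GL"
  shows "locconst_GL (\<lambda>g. phase_class (u ** g))"
  unfolding locconst_GL_def
proof
  fix g :: "'f^'n^'n" assume g: "g \<in> GL"
  have pos: "mnorm (u ** g) > 0" using u g by (intro mnorm_pos_GL) simp
  have upos: "mnorm u > 0" using mnorm_pos_GL[OF u] .
  define r where "r = min 1 (mnorm (u ** g) / 2) / mnorm u"
  have "r > 0" using pos upos by (simp add: r_def)
  moreover have "phase_class (u ** h) = phase_class (u ** g)" if h: "h \<in> mball g r" for h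
  proof -
    have "mnorm (u ** (h - g)) \<le> mnorm u * r"
      using h by (intro mnorm_mult_le') (simp_all add: mem_mball)
    also have "\<dots> = min 1 (mnorm (u ** g) / 2)" using upos by (simp only: r_def) simp
    finally have small: "mnorm (u ** h - u ** g) \<le> 1" "mnorm (u ** h - u ** g) \<le> mnorm (u ** g) / 2"
      by (simp_all add: matrix_sub_ldistrib')
    then have s: "sharp (u ** h) = sharp (u ** g)" using pos by (intro sharp_perturb) linarith
    then have d: "direction (u ** h) = direction (u ** g)" by (simp add: direction_def)
    have "{a. absv (a - trace (u ** h ** direction (u ** g))) \<le> 1} = {a. absv (a - trace (u ** g ** direction (u ** g))) \<le> 1}"
      if N: "direction (u ** g) \<in> nilp"
    proof (rule class_eq)
      have "u ** h ** direction (u ** g) = (u ** h - u ** g) ** direction (u ** g) + u ** g ** direction (u ** g)"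
        by (simp flip: matrix_add_rdistrib')
      then have "trace (u ** h ** direction (u ** g)) - trace (u ** g ** direction (u ** g)) = trace ((u ** h - u ** g) ** direction (u ** g))"
        by (simp add: trace_add)
      then show "absv (trace (u ** h ** direction (u ** g)) - trace (u ** g ** direction (u ** g))) \<le> 1"
        using absv_trace_nilp_le[OF N, of "u ** h - u ** g"] small by simp
    qed
    then show ?thesis
      using direction_sharp[of "u ** g"] unfolding phase_class_def d s by (auto simp: sharp_def)
  qed
  ultimately show "\<exists>r>0. \<forall>h\<in>mball g r. phase_class (u ** h) = phase_class (u ** g)" by blast
qed

text \<open>The phase class of \<open>u ** g\<close> takes finitely many values on the support of \<open>w\<close>, so the integral is a finite sum of
  integrals over its level sets. On one of them the direction \<open>N\<close> is constant. As \<open>N ** N = 0\<close>, the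
  trace form in direction \<open>N\<close> does not change under translation by \<open>mat 1 + mat t ** N\<close>, so the level set is
  preserved, while the integrand is multiplied by \<open>\<psi> (t * a0)\<close> with \<open>a0\<close> a representative of
  the class. For a suitable \<open>t\<close> this factor is not 1, and the integral is zero. The function \<open>act\<close> stands for
  translation from the left or from the right.\<close>

lemma fibre_cancellation:
  fixes w :: "'f^'n^'n \<Rightarrow> complex"
  assumes x: "x \<noteq> 0" and r: "0 < r" "r < 1" and u: "u \<in> GL"
    and w: "locconst_GL w" "\<And>g. det g = x \<Longrightarrow> R < mnorm g \<Longrightarrow> w g = 0"
    and large: "\<And>g. det g = x \<Longrightarrow> w g \<noteq> 0 \<Longrightarrow> psi_bound / r \<le> mnorm (u ** g) \<and> absv (det (u ** g)) < mnorm (u ** g) ^ CARD('n)"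
    and act_det: "\<And>N t g. N \<in> nilp \<Longrightarrow> det (act N t g) = det g"
    and act_int: "\<And>N t f. N \<in> nilp \<Longrightarrow> integrable (\<nu> x) f \<Longrightarrow> (\<integral>g. f (act N t g) \<partial>\<nu> x) = (\<integral>g. f g \<partial>\<nu> x :: complex)"
    and act_w: "\<And>N t g. N \<in> nilp \<Longrightarrow> absv t \<le> r \<Longrightarrow> det g = x \<Longrightarrow> w (act N t g) = w g"
    and act_diff: "\<And>N t g. N \<in> nilp \<Longrightarrow> mnorm (u ** act N t g - u ** g) \<le> absv t * mnorm (u ** g)"
    and act_trace: "\<And>N t g. N \<in> nilp \<Longrightarrow> trace (u ** act N t g) = trace (u ** g) + t * trace (u ** g ** N)"
      "\<And>N t g. N \<in> nilp \<Longrightarrow> trace (u ** act N t g ** N) = trace (u ** g ** N)"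
  shows "(\<integral>g. \<psi> (trace (u ** g)) * w g \<partial>\<nu> x) = 0"
proof -
  let ?key = "\<lambda>g. phase_class (u ** g)"
  define G where "G g = \<psi> (trace (u ** g)) * w g" for g
  have lG: "locconst_GL G" unfolding G_def by (rule locconst_GL_comp2[OF locconst_psi_trace_mult w(1)])
  define Gk where "Gk \<kappa> g = (if ?key g = \<kappa> then G g else 0)" for \<kappa> g
  have int: "integrable (\<nu> x) (Gk \<kappa>)" for \<kappa>
  proof (rule integrable_fibre[OF x])
    show "locconst_GL (Gk \<kappa>)" unfolding Gk_def
      by (rule locconst_GL_comp2[OF locconst_GL_phase_class[OF u] lG])
    show "Gk \<kappa> g = 0" if "det g = x" "R < mnorm g" for g using w(2)[OF that] by (simp add: Gk_def G_def)
  qed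
  have zero: "(\<integral>g. Gk \<kappa> g \<partial>\<nu> x) = 0" for \<kappa>
  proof (cases "\<exists>g. det g = x \<and> Gk \<kappa> g \<noteq> 0")
    case True
    then obtain g0 where g0: "det g0 = x" "?key g0 = \<kappa>" "w g0 \<noteq> 0" by (auto simp: Gk_def G_def split: if_splits)
    define N where "N = direction (u ** g0)"
    define a0 where "a0 = trace (u ** g0 ** N)"
    have sh: "sharp (u ** g0) \<noteq> {}" using large[OF g0(1,3)] by (intro sharp_nonempty) simp
    have N: "N \<in> nilp" "absv a0 = mnorm (u ** g0)"
      using direction_sharp[OF sh] by (auto simp: N_def a0_def sharp_def)
    \<comment> \<open>the lower bound for the norm on the support of \<open>w\<close> is what makes a small \<open>t\<close> sufficient\<close>
    obtain t where t: "absv t \<le> r" "\<psi> (t * a0) \<noteq> 1"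
      using psi_detects[OF r(1), of a0] large[OF g0(1,3)] N(2) by metis
    have key_iff: "?key g = \<kappa> \<longleftrightarrow> sharp (u ** g) \<noteq> {} \<and> direction (u ** g) = N \<and> absv (trace (u ** g ** N) - a0) \<le> 1" for g
    proof -
      have \<kappa>: "\<kappa> = (N, {a. absv (a - a0) \<le> 1})" using g0(2) sh by (simp add: phase_class_def N_def a0_def)
      show ?thesis
      proof
        assume k: "?key g = \<kappa>"
        have "a0 \<in> snd \<kappa>" by (simp add: \<kappa>)
        then have "a0 \<in> snd (?key g)" using k by simp
        moreover from this have s: "sharp (u ** g) \<noteq> {}" by (auto simp: phase_class_def)
        moreover have d: "direction (u ** g) = N" using k by (simp add: \<kappa> phase_class_def)
        ultimately have "absv (a0 - trace (u ** g ** N)) \<le> 1" by (simp add: phase_class_def)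
        then show "sharp (u ** g) \<noteq> {} \<and> direction (u ** g) = N \<and> absv (trace (u ** g ** N) - a0) \<le> 1"
          using s d absv_minus_commute[of a0] by simp
      next
        assume "sharp (u ** g) \<noteq> {} \<and> direction (u ** g) = N \<and> absv (trace (u ** g ** N) - a0) \<le> 1"
        then show "?key g = \<kappa>" using class_eq[of "trace (u ** g ** N)" a0] by (simp add: phase_class_def \<kappa>)
      qed
    qed
    have shift: "Gk \<kappa> (act N t g) = \<psi> (t * a0) * Gk \<kappa> g" if g: "det g = x" for g
    proof -
      have "u ** g \<in> GL" using u g x by (simp add: GL_iff det_mul)
      then have "mnorm (u ** g) > 0" by (rule mnorm_pos_GL)
      then have "absv t * mnorm (u ** g) < mnorm (u ** g)" using t r by simp
      then have "mnorm (u ** act N t g - u ** g) < mnorm (u ** g)" using act_diff[OF N(1), of t g] by linarith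
      then have s: "sharp (u ** act N t g) = sharp (u ** g)" by (rule sharp_perturb)
      then have d: "direction (u ** act N t g) = direction (u ** g)" by (simp add: direction_def)
      have k: "?key (act N t g) = \<kappa> \<longleftrightarrow> ?key g = \<kappa>" unfolding key_iff s d act_trace(2)[OF N(1)] ..
      show ?thesis
      proof (cases "?key g = \<kappa>")
        case True
        have "absv (t * trace (u ** g ** N) - t * a0) = absv t * absv (trace (u ** g ** N) - a0)"
          by (simp add: absv_mult right_diff_distrib flip: absv_mult)
        also have "\<dots> \<le> 1 * 1" using True t r unfolding key_iff by (intro mult_mono) auto
        finally have "\<psi> (t * trace (u ** g ** N)) = \<psi> (t * a0)" by (intro psi_eq) simp
        then show ?thesis using True k act_w[OF N(1) t(1) g]
          by (simp add: Gk_def G_def act_trace(1)[OF N(1)] psi_add)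
      qed (use k in \<open>simp add: Gk_def\<close>)
    qed
    have "(\<integral>g. Gk \<kappa> g \<partial>\<nu> x) = (\<integral>g. Gk \<kappa> (act N t g) \<partial>\<nu> x)"
      using act_int[OF N(1) int] by simp
    also have "\<dots> = (\<integral>g. \<psi> (t * a0) * Gk \<kappa> g \<partial>\<nu> x)"
      by (rule Bochner_Integration.integral_cong) (auto simp: shift space_nu[OF x] det_fibre_def)
    also have "\<dots> = \<psi> (t * a0) * (\<integral>g. Gk \<kappa> g \<partial>\<nu> x)" by simp
    finally have "(1 - \<psi> (t * a0)) * (\<integral>g. Gk \<kappa> g \<partial>\<nu> x) = 0" by (simp add: algebra_simps)
    then show ?thesis using t(2) by simp
  next
    case False
    then have "(\<integral>g. Gk \<kappa> g \<partial>\<nu> x) = (\<integral>g. 0 \<partial>\<nu> x)"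
      by (intro Bochner_Integration.integral_cong) (auto simp: space_nu[OF x] det_fibre_def)
    then show ?thesis by simp
  qed
  let ?K = "mball 0 R \<inter> det_fibre x :: ('f^'n^'n) set"
  have K: "compact ?K" "?K \<subseteq> GL"
    using compact_mball closed_det_fibre det_fibre_GL[OF x] by (auto intro!: compact_Int_closed)
  obtain r' A where A: "finite A" "A \<subseteq> ?K" "?K \<subseteq> (\<Union>a\<in>A. mball a r')"
    "\<And>a y. a \<in> A \<Longrightarrow> y \<in> mball a r' \<Longrightarrow> ?key y = ?key a"
    using compact_ball_partition[OF K locconst_GL_phase_class[OF u], of 1] by (metis zero_less_one)
  have sum: "G g = (\<Sum>\<kappa>\<in>?key ` A. Gk \<kappa> g)" if g: "g \<in> space (\<nu> x)" for g
  proof (cases "w g = 0")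
    case False
    have "det g = x" using g by (simp add: space_nu[OF x] det_fibre_def)
    then have "g \<in> ?K" using w(2)[of g] False by (auto simp: mem_mball det_fibre_def not_less[symmetric])
    then obtain a where "a \<in> A" "g \<in> mball a r'" using A(3) by blast
    then have "?key g \<in> ?key ` A" using A(4) by blast
    then show ?thesis using A(1) by (simp add: Gk_def)
  next
    case True
    then have "G g = 0" by (simp add: G_def)
    then show ?thesis by (simp add: Gk_def cong: if_cong)
  qed
  have "(\<integral>g. G g \<partial>\<nu> x) = (\<integral>g. (\<Sum>\<kappa>\<in>?key ` A. Gk \<kappa> g) \<partial>\<nu> x)"
    by (rule Bochner_Integration.integral_cong[OF refl sum])
  also have "\<dots> = (\<Sum>\<kappa>\<in>?key ` A. \<integral>g. Gk \<kappa> g \<partial>\<nu> x)"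
    by (rule Bochner_Integration.integral_sum) (rule int)
  also have "\<dots> = 0" by (simp add: zero)
  finally show ?thesis by (simp add: G_def)
qed

lemma fibre_cancellation_right:
  fixes w :: "'f^'n^'n \<Rightarrow> complex"
  assumes x: "x \<noteq> 0" and r: "0 < r" "r < 1" and u: "u \<in> GL"
    and w: "locconst_GL w" "\<And>g. det g = x \<Longrightarrow> R < mnorm g \<Longrightarrow> w g = 0"
    and large: "\<And>g. det g = x \<Longrightarrow> w g \<noteq> 0 \<Longrightarrow> psi_bound / r \<le> mnorm (u ** g) \<and> absv (det (u ** g)) < mnorm (u ** g) ^ CARD('n)"
    and inv: "\<And>N t g. N \<in> nilp \<Longrightarrow> absv t \<le> r \<Longrightarrow> det g = x \<Longrightarrow> w (g ** (mat 1 + mat t ** N)) = w g"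
  shows "(\<integral>g. \<psi> (trace (u ** g)) * w g \<partial>\<nu> x) = 0"
proof (rule fibre_cancellation[OF x r u w large, where act = "\<lambda>N t g. g ** (mat 1 + mat t ** N)"])
  fix N :: "'f^'n^'n" assume "N \<in> nilp"
  then have N: "N ** N = 0" "mnorm N \<le> 1" "\<And>t. det (mat 1 + mat t ** N) = 1" by (auto simp: nilp_def)
  show "det (g ** (mat 1 + mat t ** N)) = det g" for t g by (simp add: det_mul N)
  show "(\<integral>g. f (g ** (mat 1 + mat t ** N)) \<partial>\<nu> x) = (\<integral>g. f g \<partial>\<nu> x)"
    if "integrable (\<nu> x) f" for t and f :: "'f^'n^'n \<Rightarrow> complex"
    by (rule integral_fibre_mult_right[OF x N(3) that])
  show "w (g ** (mat 1 + mat t ** N)) = w g" if "absv t \<le> r" "det g = x" for t g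
    using inv \<open>N \<in> nilp\<close> that by blast
  have eq: "u ** (g ** (mat 1 + mat t ** N)) = u ** g + mat t ** (u ** g ** N)" for t g
    by (simp only: mult_unipotent matrix_add_ldistrib mult_mat_left_commute) (simp only: matrix_mul_assoc matrix_mul_rid)
  show "mnorm (u ** (g ** (mat 1 + mat t ** N)) - u ** g) \<le> absv t * mnorm (u ** g)" for t g
    unfolding eq using mnorm_mult_le'[of "u ** g" "mnorm (u ** g)" N 1] N(2)
    by (simp add: mult_left_mono)
  show "trace (u ** (g ** (mat 1 + mat t ** N))) = trace (u ** g) + t * trace (u ** g ** N)" for t g
    unfolding eq by (simp add: trace_add)
  have "u ** (g ** (mat 1 + mat t ** N)) ** N = u ** g ** N + mat t ** (u ** g ** (N ** N))" for t g
    unfolding eq by (simp only: matrix_add_rdistrib' matrix_mul_assoc)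
  then show "trace (u ** (g ** (mat 1 + mat t ** N)) ** N) = trace (u ** g ** N)" for t g
    by (simp add: N)
qed

lemma fibre_cancellation_left:
  fixes w :: "'f^'n^'n \<Rightarrow> complex"
  assumes x: "x \<noteq> 0" and r: "0 < r" "r < 1"
    and w: "locconst_GL w" "\<And>g. det g = x \<Longrightarrow> R < mnorm g \<Longrightarrow> w g = 0"
    and large: "\<And>g. det g = x \<Longrightarrow> w g \<noteq> 0 \<Longrightarrow> psi_bound / r \<le> mnorm g \<and> absv (det g) < mnorm g ^ CARD('n)"
    and inv: "\<And>N t g. N \<in> nilp \<Longrightarrow> absv t \<le> r \<Longrightarrow> det g = x \<Longrightarrow> w ((mat 1 + mat t ** N) ** g) = w g"
  shows "(\<integral>g. \<psi> (trace g) * w g \<partial>\<nu> x) = 0"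
proof -
  have "(\<integral>g. \<psi> (trace (mat 1 ** g)) * w g \<partial>\<nu> x) = 0"
  proof (rule fibre_cancellation[OF x r mat_1_GL w, where act = "\<lambda>N t g. (mat 1 + mat t ** N) ** g"])
    fix N :: "'f^'n^'n" assume "N \<in> nilp"
    then have N: "N ** N = 0" "mnorm N \<le> 1" "\<And>t. det (mat 1 + mat t ** N) = 1" by (auto simp: nilp_def)
    show "det ((mat 1 + mat t ** N) ** g) = det g" for t g by (simp add: det_mul N)
    show "(\<integral>g. f ((mat 1 + mat t ** N) ** g) \<partial>\<nu> x) = (\<integral>g. f g \<partial>\<nu> x)"
      if "integrable (\<nu> x) f" for t and f :: "'f^'n^'n \<Rightarrow> complex"
      by (rule integral_fibre_mult_left[OF x N(3) that])
    show "w ((mat 1 + mat t ** N) ** g) = w g" if "absv t \<le> r" "det g = x" for t g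
      using inv \<open>N \<in> nilp\<close> that by blast
    have eq: "mat 1 ** ((mat 1 + mat t ** N) ** g) = g + mat t ** (N ** g)" for t and g :: "'f^'n^'n"
      by (simp only: unipotent_mult matrix_mul_lid)
    show "mnorm (mat 1 ** ((mat 1 + mat t ** N) ** g) - mat 1 ** g) \<le> absv t * mnorm (mat 1 ** g)" for t g
      unfolding eq using mnorm_mult_le'[of N 1 g "mnorm g"] N(2) by (simp add: mult_left_mono)
    show "trace (mat 1 ** ((mat 1 + mat t ** N) ** g)) = trace (mat 1 ** g) + t * trace (mat 1 ** g ** N)" for t g
      unfolding eq by (simp add: trace_add trace_mul_sym[of N])
    have "trace (mat t ** (N ** g) ** N) = 0" for t and g :: "'f^'n^'n"
    proof -
      have "trace (mat t ** (N ** g) ** N) = t * trace (N ** (g ** N))"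
        by (simp flip: matrix_mul_assoc)
      also have "trace (N ** (g ** N)) = trace (g ** (N ** N))"
        using trace_mul_sym[of N "g ** N"] by (simp add: matrix_mul_assoc)
      finally show ?thesis by (simp add: N trace_def)
    qed
    then show "trace (mat 1 ** ((mat 1 + mat t ** N) ** g) ** N) = trace (mat 1 ** g ** N)" for t g
      unfolding eq by (simp add: matrix_add_rdistrib' trace_add)
  qed (use large in auto)
  then show ?thesis by simp
qed

end

section \<open>The kernel as a truncated integral\<close>

lemma locconst_GL_bounded:
  fixes f :: "'f::nonarch_local_field_0^'n^'n \<Rightarrow> real"
  assumes "compact K" "K \<subseteq> GL" "locconst_GL f"
  obtains C where "C > 0" "\<And>u. u \<in> K \<Longrightarrow> f u \<le> C"
proof -
  obtain r A where A: "finite A" "K \<subseteq> (\<Union>a\<in>A. mball a r)" "\<And>a y. a \<in> A \<Longrightarrow> y \<in> mball a r \<Longrightarrow> f y = f a"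
    using compact_ball_partition[OF assms zero_less_one] by metis
  have "f u \<le> Max (insert 1 (f ` A))" if u: "u \<in> K" for u
  proof -
    obtain a where a: "a \<in> A" "u \<in> mball a r" using A(2) u by blast
    have "f u = f a" using A(3)[OF a] .
    also have "f a \<le> Max (insert 1 (f ` A))" using A(1) a(1) by (intro Max_ge) auto
    finally show ?thesis .
  qed
  moreover have "1 \<le> Max (insert 1 (f ` A))" using A(1) by (intro Max_ge) auto
  ultimately show ?thesis using that[of "Max (insert 1 (f ` A))"] by auto
qed

text \<open>From \<open>matrix_inv v = matrix_inv u - matrix_inv v ** (v - u) ** matrix_inv u\<close>, where the last term is smaller than
  the others.\<close>

lemma mnorm_inverse_perturb:
  assumes "u \<in> GL" "v \<in> GL" "mnorm (v - u) * mnorm (matrix_inv u) < 1"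
  shows "mnorm (matrix_inv v) = mnorm (matrix_inv u)"
proof -
  let ?d = "mnorm (v - u) * mnorm (matrix_inv u)"
  let ?E = "matrix_inv v ** (v - u) ** matrix_inv u"
  have "?E = matrix_inv u - matrix_inv v"
    using assms(1,2) by (simp add: matrix_sub_ldistrib' matrix_sub_rdistrib' flip: matrix_mul_assoc)
  then have eq: "matrix_inv v = matrix_inv u + - ?E" by simp
  have E: "mnorm ?E \<le> mnorm (matrix_inv v) * ?d"
    unfolding matrix_mul_assoc[symmetric] by (intro mnorm_mult_le' order_refl mnorm_mult_le)
  have pos: "mnorm (matrix_inv v) > 0" using assms by (intro mnorm_pos_GL) simp
  have lt: "mnorm (matrix_inv v) * ?d < mnorm (matrix_inv v)" using pos assms(3) by simp
  have "mnorm (matrix_inv v) \<le> mnorm (matrix_inv u)"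
  proof (rule ccontr)
    assume "\<not> ?thesis"
    then obtain m where m: "mnorm (matrix_inv u) \<le> m" "mnorm ?E \<le> m" "m < mnorm (matrix_inv v)"
      using E lt by (intro that[of "max (mnorm (matrix_inv u)) (mnorm ?E)"]) auto
    then have "mnorm (matrix_inv u + - ?E) \<le> m" by (intro mnorm_add_le) simp_all
    then show False using m(3) unfolding eq[symmetric] by linarith
  qed
  then have "mnorm (- ?E) < mnorm (matrix_inv u)"
  proof -
    have "mnorm ?E \<le> mnorm (matrix_inv u) * ?d"
      using E \<open>mnorm (matrix_inv v) \<le> mnorm (matrix_inv u)\<close>
      by (rule order_trans[OF _ mult_right_mono]) simp
    also have "\<dots> < mnorm (matrix_inv u)" using assms mnorm_pos_GL[of "matrix_inv u"] by simp
    finally show ?thesis by simp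
  qed
  then show ?thesis using mnorm_add_eq eq by metis
qed

lemma locconst_GL_mnorm_inverse: "locconst_GL (\<lambda>u. mnorm (matrix_inv u))"
  unfolding locconst_GL_def
proof
  fix u :: "'a^'b^'b" assume u: "u \<in> GL"
  obtain r where r: "r > 0" "mball u r \<subseteq> GL" using open_GL u unfolding open_mnorm_iff by blast
  have pos: "mnorm (matrix_inv u) > 0" using u by (intro mnorm_pos_GL) simp
  have "mnorm (matrix_inv v) = mnorm (matrix_inv u)" if v: "v \<in> mball u (min r (1 / (2 * mnorm (matrix_inv u))))" for v
  proof (rule mnorm_inverse_perturb[OF u])
    show "v \<in> GL" using v r(2) by (auto simp: mem_mball subset_iff)
    have "mnorm (v - u) * mnorm (matrix_inv u) \<le> 1 / (2 * mnorm (matrix_inv u)) * mnorm (matrix_inv u)"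
      using v by (intro mult_right_mono) (auto simp: mem_mball)
    also have "\<dots> < 1" using pos by (simp add: field_simps)
    finally show "mnorm (v - u) * mnorm (matrix_inv u) < 1" .
  qed
  moreover have "min r (1 / (2 * mnorm (matrix_inv u))) > 0" using r pos by simp
  ultimately show "\<exists>r>0. \<forall>v\<in>mball u r. mnorm (matrix_inv v) = mnorm (matrix_inv u)" by blast
qed

lemma mnorm_mult_unipotent:
  assumes "N \<in> nilp" "absv t < 1"
  shows "mnorm (g ** (mat 1 + mat t ** N)) = mnorm g"
proof (cases "g = 0")
  case False
  have pos: "mnorm g > 0" using False mnorm_nonneg[of g] mnorm_eq_0[of g] by linarith
  have "mnorm (mat t ** (g ** N)) \<le> absv t * mnorm g"
    using mnorm_mult_le'[of g "mnorm g" N 1] assms(1) by (simp add: nilp_def mult_left_mono)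
  also have "\<dots> < mnorm g" using pos assms(2) by simp
  finally have "mnorm (g + mat t ** (g ** N)) = mnorm g" by (rule mnorm_add_eq)
  moreover have "g ** (mat 1 + mat t ** N) = g + mat t ** (g ** N)"
    by (rule mult_unipotent)
  ultimately show ?thesis by simp
qed simp

text \<open>A quantitative form of invariance under an open subgroup: \<open>r\<close> measures how far from the identity
  the invariance extends, and enters the radius beyond which cancellation sets in.\<close>

definition right_level :: "('f::nonarch_local_field_0^'n^'n \<Rightarrow> 'b) \<Rightarrow> real \<Rightarrow> bool"
  where "right_level \<phi> r \<longleftrightarrow> 0 < r \<and> r < 1 \<and> (\<forall>g\<in>GL. \<forall>k. mnorm (k - mat 1) \<le> r \<longrightarrow> \<phi> (g ** k) = \<phi> g)"

lemma mnorm_unipotent_diff: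
  "N \<in> nilp \<Longrightarrow> absv t \<le> r \<Longrightarrow> mnorm ((mat 1 + mat t ** N) - mat 1) \<le> r"
  using mult_mono[of "absv t" r "mnorm N" 1] by (simp add: nilp_def) (meson absv_nonneg order_trans)

context kernel_setting begin

lemma Phi_mult:
  "Phi_GJ \<psi> (g ** u) = \<psi> (trace (g ** u)) *
    (of_real (absv (det g) powr (real CARD('n) / 2)) * of_real (absv (det u) powr (real CARD('n) / 2)))"
  for g u :: "'f^'n^'n"
  by (simp add: Phi_GJ_def det_mul absv_mult powr_mult)

lemma locconst_Phi: "locconst_GL (Phi_GJ \<psi> :: 'f^'n^'n \<Rightarrow> complex)"
  using locconst_GL_comp2[OF locconst_psi_trace_mult[of "mat 1"] locconst_GL_absv_det,
      of "\<lambda>p d. p * of_real (d powr (real CARD('n) / 2))"]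
  by (simp add: Phi_GJ_def[abs_def])

lemma Phi_mult_eq:
  fixes g u v :: "'f^'n^'n"
  assumes "mnorm g * mnorm (u - v) \<le> 1" "absv (det u) = absv (det v)"
  shows "Phi_GJ \<psi> (g ** u) = Phi_GJ \<psi> (g ** v)"
proof -
  have "mnorm (g ** u - g ** v) \<le> 1"
    using mnorm_mult_le[of g "u - v"] assms(1) by (simp add: matrix_sub_ldistrib')
  then show ?thesis using assms(2) by (simp add: Phi_mult psi_trace_eq)
qed

lemma Phi_mult_eq_left:
  fixes g h u :: "'f^'n^'n"
  assumes "mnorm (g - h) * mnorm u \<le> 1" "absv (det g) = absv (det h)"
  shows "Phi_GJ \<psi> (g ** u) = Phi_GJ \<psi> (h ** u)"
proof -
  have "mnorm (g ** u - h ** u) \<le> 1"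
    using mnorm_mult_le[of "g - h" u] assms(1) by (simp add: matrix_sub_rdistrib')
  then show ?thesis using assms(2) by (simp add: Phi_mult psi_trace_eq)
qed

text \<open>The integral obtained formally by letting the delta sequence concentrate at \<open>u\<close>, made convergent by a
  cutoff.\<close>

definition truncated_kernel :: "('f^'n^'n \<Rightarrow> complex) \<Rightarrow> real \<Rightarrow> 'f \<Rightarrow> 'f^'n^'n \<Rightarrow> complex"
  where "truncated_kernel \<phi> R x u = (\<integral>g. (if mnorm g \<le> R then Phi_GJ \<psi> (g ** u) * \<phi> g else 0) \<partial>\<nu> x)"

lemma integrable_truncated:
  assumes "x \<noteq> 0" "locconst_GL \<phi>" "u \<in> GL" "R > 0"
  shows "integrable (\<nu> x) (\<lambda>g. if mnorm g \<le> R then Phi_GJ \<psi> (g ** u) * \<phi> g else 0)"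
proof (rule integrable_fibre[OF assms(1), of _ R])
  have "locconst_GL (\<lambda>g. Phi_GJ \<psi> (g ** u))"
    by (rule locconst_GL_precomp[OF locconst_Phi]) (use assms in \<open>auto intro!: continuous_intros\<close>)
  then have "locconst_GL (\<lambda>g. Phi_GJ \<psi> (g ** u) * \<phi> g)" by (rule locconst_GL_comp2[OF _ assms(2)])
  then show "locconst_GL (\<lambda>g. if mnorm g \<le> R then Phi_GJ \<psi> (g ** u) * \<phi> g else 0)"
    by (rule locconst_GL_comp2[OF locconst_GL_mnorm_le[OF assms(4)]])
qed simp

text \<open>The difference of the two sides is an integral over \<open>R0 < mnorm g \<le> R\<close>. The condition on \<open>C\<close> bounds
  \<open>mnorm (u ** g)\<close> below by \<open>R0 / C\<close> there, and the two conditions on \<open>R0\<close> put this in the range of the cancellation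
  principle.\<close>

lemma truncated_kernel_stable:
  assumes x: "x \<noteq> 0" and \<phi>: "locconst_GL \<phi>" "right_level \<phi> r" and u: "u \<in> GL"
    and C: "0 < C" "mnorm (matrix_inv u) \<le> C" and R: "0 < R0" "R0 \<le> R"
    and R0: "psi_bound / r * C \<le> R0" "absv (det u) * absv x < (R0 / C) ^ CARD('n)"
  shows "truncated_kernel \<phi> R x u = truncated_kernel \<phi> R0 x u"
proof -
  have r: "0 < r" "r < 1" using \<phi>(2) by (auto simp: right_level_def)
  define d where "d g = complex_of_real (absv (det g) powr (real CARD('n) / 2)) * of_real (absv (det u) powr (real CARD('n) / 2))" for g :: "'f^'n^'n"
  define w where "w g = (if mnorm g \<le> R \<and> \<not> mnorm g \<le> R0 then d g * \<phi> g else 0)" for g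
  have "(\<integral>g. \<psi> (trace (u ** g)) * w g \<partial>\<nu> x) = 0"
  proof (rule fibre_cancellation_right[OF x r u, of _ R])
    have "locconst_GL d" unfolding d_def
      by (rule locconst_GL_comp[OF locconst_GL_absv_det])
    then have "locconst_GL (\<lambda>g. d g * \<phi> g)" by (rule locconst_GL_comp2[OF _ \<phi>(1)])
    moreover have "locconst_GL (\<lambda>g :: 'f^'n^'n. mnorm g \<le> R \<and> \<not> mnorm g \<le> R0)"
      using R by (intro locconst_GL_comp2[of "\<lambda>g. mnorm g \<le> R" "\<lambda>g. mnorm g \<le> R0" "\<lambda>a b. a \<and> \<not> b"] locconst_GL_mnorm_le) auto
    ultimately show "locconst_GL w" unfolding w_def[abs_def] by (rule locconst_GL_comp2[rotated])
    show "w g = 0" if "R < mnorm g" for g using that by (simp add: w_def)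
    show "psi_bound / r \<le> mnorm (u ** g) \<and> absv (det (u ** g)) < mnorm (u ** g) ^ CARD('n)"
      if "det g = x" "w g \<noteq> 0" for g
    proof -
      have "R0 < mnorm g" using that(2) by (auto simp: w_def split: if_splits)
      also have "mnorm g \<le> mnorm (matrix_inv u) * mnorm (u ** g)" by (rule mnorm_le_mult_left[OF u])
      also have "\<dots> \<le> C * mnorm (u ** g)" using C by (intro mult_right_mono) auto
      finally have lt: "R0 / C < mnorm (u ** g)" using C(1) by (simp add: field_simps)
      have "psi_bound / r \<le> R0 / C" using R0(1) C(1) by (simp add: pos_le_divide_eq)
      moreover have "absv (det (u ** g)) < (R0 / C) ^ CARD('n)" using R0(2) that(1) by (simp add: det_mul absv_mult)
      moreover have "(R0 / C) ^ CARD('n) \<le> mnorm (u ** g) ^ CARD('n)" using lt R C by (intro power_mono) auto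
      ultimately show ?thesis using lt by linarith
    qed
    show "w (g ** (mat 1 + mat t ** N)) = w g" if "N \<in> nilp" "absv t \<le> r" "det g = x" for N t g
    proof -
      have "\<phi> (g ** (mat 1 + mat t ** N)) = \<phi> g"
        using \<phi>(2) mnorm_unipotent_diff[OF that(1,2)] that(3) x by (simp add: right_level_def GL_iff)
      moreover have "mnorm (g ** (mat 1 + mat t ** N)) = mnorm g"
        using that r by (intro mnorm_mult_unipotent) auto
      moreover have "det (g ** (mat 1 + mat t ** N)) = det g" using that(1) by (simp add: det_mul nilp_def)
      ultimately show ?thesis by (simp add: w_def d_def)
    qed
  qed
  moreover have "\<psi> (trace (u ** g)) * w g = (if mnorm g \<le> R then Phi_GJ \<psi> (g ** u) * \<phi> g else 0)
      - (if mnorm g \<le> R0 then Phi_GJ \<psi> (g ** u) * \<phi> g else 0)" for g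
    using R by (simp add: w_def d_def Phi_mult trace_mul_sym[of u g])
  ultimately have "(\<integral>g. (if mnorm g \<le> R then Phi_GJ \<psi> (g ** u) * \<phi> g else 0)
      - (if mnorm g \<le> R0 then Phi_GJ \<psi> (g ** u) * \<phi> g else 0) \<partial>\<nu> x) = 0" by simp
  then show ?thesis
    using R integrable_truncated[OF x \<phi>(1) u] unfolding truncated_kernel_def
    by (subst (asm) Bochner_Integration.integral_diff) auto
qed

lemma locconst_truncated_kernel:
  assumes "R > 0"
  shows "locconst_GL (\<lambda>u. truncated_kernel \<phi> R x u)"
  unfolding locconst_GL_def
proof
  fix u :: "'f^'n^'n" assume "u \<in> GL"
  then obtain s where s: "s > 0" "\<forall>v\<in>mball u s. absv (det v) = absv (det u)"
    using locconst_GL_absv_det unfolding locconst_GL_def by blast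
  have "truncated_kernel \<phi> R x v = truncated_kernel \<phi> R x u" if v: "v \<in> mball u (min s (1 / R))" for v
  proof -
    have d: "absv (det v) = absv (det u)" using s(2) v by (simp add: mem_mball)
    have "Phi_GJ \<psi> (g ** v) = Phi_GJ \<psi> (g ** u)" if "mnorm g \<le> R" for g
    proof (rule Phi_mult_eq[OF _ d])
      have "mnorm g * mnorm (v - u) \<le> R * (1 / R)" using that v assms by (intro mult_mono) (auto simp: mem_mball)
      then show "mnorm g * mnorm (v - u) \<le> 1" using assms by simp
    qed
    then show ?thesis unfolding truncated_kernel_def by (intro arg_cong[of _ _ "integral\<^sup>L (\<nu> x)"]) auto
  qed
  moreover have "min s (1 / R) > 0" using s assms by simp
  ultimately show "\<exists>r>0. \<forall>v\<in>mball u r. truncated_kernel \<phi> R x v = truncated_kernel \<phi> R x u" by blast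
qed

text \<open>Substituting \<open>h = g ** u\<close> in the convolution.\<close>

lemma convolution_Phi:
  fixes c :: "'f^'n^'n \<Rightarrow> complex"
  assumes c: "c \<in> test_fun GL" and g: "g \<in> GL"
  shows "convolution \<mu> (Phi_GJ \<psi>) (inv_fun c) g = (\<integral>u. Phi_GJ \<psi> (g ** u) * c u \<partial>haar_GL \<mu>)"
proof -
  define F where "F h = Phi_GJ \<psi> h * c (matrix_inv g ** h)" for h
  have c': "(\<lambda>h. c (matrix_inv g ** h)) \<in> test_fun GL" using test_fun_GL_mult_left[OF c] g by simp
  have F: "F \<in> test_fun GL"
  proof -
    obtain K where K: "compact K" "K \<subseteq> GL" "support_in (\<lambda>h. c (matrix_inv g ** h)) K" "locconst_GL (\<lambda>h. c (matrix_inv g ** h))"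
      using c' unfolding test_fun_GL_iff by blast
    have "locconst_GL F" unfolding F_def[abs_def] by (rule locconst_GL_comp2[OF locconst_Phi K(4)])
    moreover have "support_in F K" using K(3) by (simp add: support_in_def F_def)
    ultimately show ?thesis using K unfolding test_fun_GL_iff by blast
  qed
  have "convolution \<mu> (Phi_GJ \<psi>) (inv_fun c) g = (\<integral>h. F h \<partial>haar_GL \<mu>)"
    unfolding convolution_def inv_fun_def F_def
    by (rule Bochner_Integration.integral_cong) (use g in \<open>auto simp: matrix_inv_mult\<close>)
  also have "\<dots> = (\<integral>u. F (g ** u) \<partial>haar_GL \<mu>)" by (rule haar_GL_mult_left[OF F g, symmetric])
  finally show ?thesis using g by (simp add: F_def)
qed

lemma test_fun_ball_character:
  fixes a g :: "'f^'n^'n"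
  assumes good: "good_ball a r"
  shows "(\<lambda>u. indicator (mball a r) u * \<psi> (trace (g ** u))) \<in> test_fun GL"
proof -
  note gd = good_ballD[OF good]
  have "locconst_GL (\<lambda>u. indicator (mball a r) u * \<psi> (trace (g ** u)))"
    by (rule locconst_GL_comp2[OF locconst_GL_indicator_mball[OF gd(1)] locconst_psi_trace_mult])
  then show ?thesis unfolding test_fun_GL_iff support_in_def
    using compact_mball[of a r] gd(2) by (intro conjI exI[of _ "mball a r"]) auto
qed

text \<open>The ball is invariant under addition of a matrix \<open>Y\<close> of norm at most \<open>r\<close>, and the density of the measure
  is constant on it. With \<open>Y\<close> a multiple of the matrix unit opposite to the largest entry of \<open>g\<close>,
  the integrand gets multiplied by a constant different from 1.\<close>

lemma character_ball_integral_zero: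
  fixes a g :: "'f^'n^'n"
  assumes good: "good_ball a r" and g: "psi_bound / r \<le> mnorm g"
  shows "(\<integral>u. indicator (mball a r) u * \<psi> (trace (g ** u)) \<partial>haar_GL \<mu>) = 0"
proof -
  note gd = good_ballD[OF good]
  define f where "f u = indicator (mball a r) u * \<psi> (trace (g ** u))" for u :: "'f^'n^'n"
  obtain i j where ij: "mnorm g = absv (g $ i $ j)" using mnorm_attained .
  obtain t where t: "absv t \<le> r" "\<psi> (t * g $ i $ j) \<noteq> 1" using psi_detects[OF gd(1), of "g $ i $ j"] g ij by auto
  define Y where "Y = mat t ** (unit_mat j i :: 'f^'n^'n)"
  have Y: "mnorm Y \<le> r"
    using t(1) mult_mono[of "absv t" r "mnorm (unit_mat j i :: 'f^'n^'n)" 1] gd(1)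
    by (auto simp: Y_def mnorm_le_iff unit_mat_nth)
  have trY: "trace (g ** Y) = t * g $ i $ j"
    unfolding Y_def by (simp add: mult_mat_left_commute trace_mult_unit_mat)
  have in_iff: "u + Y \<in> mball a r \<longleftrightarrow> u \<in> mball a r" for u
  proof
    assume "u + Y \<in> mball a r"
    then have "mnorm ((u + Y - a) - Y) \<le> r" using Y by (intro mnorm_diff_le[of "u + Y - a"]) (simp_all add: mem_mball)
    then show "u \<in> mball a r" by (simp add: mem_mball algebra_simps)
  next
    assume "u \<in> mball a r"
    then have "mnorm ((u - a) + Y) \<le> r" using Y by (intro mnorm_add_le[of "u - a"]) (simp_all add: mem_mball)
    then show "u + Y \<in> mball a r" by (simp add: mem_mball algebra_simps)
  qed
  have f: "f \<in> test_fun GL" unfolding f_def[abs_def] by (rule test_fun_ball_character[OF good])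
  have "(\<integral>u. f (u + Y) \<partial>haar_GL \<mu>) = (\<integral>u. f u \<partial>haar_GL \<mu>)"
  proof (rule haar_GL_change_of_variables[OF f gd(1)])
    fix b s assume b: "f b \<noteq> 0" "s \<le> r" "good_ball b s"
    have ba: "b \<in> mball a r" using b(1) by (rule contrapos_np) (simp add: f_def)
    have eq: "(\<lambda>u. u + Y) -` mball b s = mball (b - Y) s" by (auto simp: mem_mball algebra_simps)
    have bY: "b - Y \<in> mball a r" using in_iff[of "b - Y"] ba by simp
    have sub: "mball (b - Y) s \<subseteq> mball a r" using mball_subset[OF bY b(2)] .
    have "good_ball (b - Y) s" unfolding good_ball_def
      using good_ballD(1)[OF b(3)] sub gd(2) gd(4)[OF bY] gd(4)
      by (intro conjI ballI) (blast, blast, metis subsetD)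
    then show "(\<lambda>u. u + Y) -` mball b s \<in> sets (haar_GL \<mu>)"
        "emeasure (haar_GL \<mu>) ((\<lambda>u. u + Y) -` mball b s) = emeasure (haar_GL \<mu>) (mball b s)"
      unfolding eq using b(3) gd(4)[OF ba] gd(4)[OF bY]
      by (simp_all add: good_ball_sets emeasure_good_ball)
  qed
  moreover have "f (u + Y) = \<psi> (t * g $ i $ j) * f u" for u
    unfolding f_def using in_iff[of u] trY
    by (simp add: indicator_def matrix_add_ldistrib trace_add psi_add)
  ultimately have "(1 - \<psi> (t * g $ i $ j)) * (\<integral>u. f u \<partial>haar_GL \<mu>) = 0" by (simp add: algebra_simps)
  then show ?thesis using t(2) by (simp add: f_def)
qed

text \<open>The integral is a Fourier transform: the test function is constant on balls of a fixed radius, over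
  which a character of large frequency \<open>g\<close> integrates to zero.\<close>

lemma Phi_transform_support:
  fixes c :: "'f^'n^'n \<Rightarrow> complex"
  assumes c: "c \<in> test_fun GL"
  obtains R1 where "R1 > 0" "\<And>g. R1 < mnorm g \<Longrightarrow> (\<integral>u. Phi_GJ \<psi> (g ** u) * c u \<partial>haar_GL \<mu>) = 0"
proof -
  obtain K where K: "locconst_GL c" "compact K" "K \<subseteq> GL" "support_in c K"
    using c unfolding test_fun_GL_iff by blast
  obtain r A where A: "0 < r" "r \<le> (1::real)" "finite A" "A \<subseteq> K" "K \<subseteq> (\<Union>a\<in>A. mball a r)"
    "disjoint_family_on (\<lambda>a. mball a r) A" "\<And>a. a \<in> A \<Longrightarrow> good_ball a r"
    "\<And>a y. a \<in> A \<Longrightarrow> y \<in> mball a r \<Longrightarrow> c y = c a"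
    using haar_GL_ball_partition[OF K(2,3,1), of 1] by auto
  have sum: "c u = (\<Sum>a\<in>A. c a * indicator (mball a r) u)" for u
    by (rule finite_disjoint_combination[OF A(3,6,8)]) (use A(5) K(4) in \<open>auto simp: support_in_def\<close>)
  have "(\<integral>u. Phi_GJ \<psi> (g ** u) * c u \<partial>haar_GL \<mu>) = 0" if g: "psi_bound / r < mnorm g" for g :: "'f^'n^'n"
  proof -
    define d where "d a = complex_of_real (absv (det g) powr (real CARD('n) / 2)) * of_real (absv (det a) powr (real CARD('n) / 2)) * c a" for a :: "'f^'n^'n"
    have zero: "(\<integral>u. indicator (mball a r) u * \<psi> (trace (g ** u)) \<partial>haar_GL \<mu>) = 0" if "a \<in> A" for a
      by (rule character_ball_integral_zero) (use A(7) that g in auto)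
    have pt: "Phi_GJ \<psi> (g ** u) * c u = (\<Sum>a\<in>A. d a * (indicator (mball a r) u * \<psi> (trace (g ** u))))" for u
    proof -
      have "Phi_GJ \<psi> (g ** u) * c u = (\<Sum>a\<in>A. Phi_GJ \<psi> (g ** u) * (c a * indicator (mball a r) u))"
        unfolding sum_distrib_left[symmetric] by (rule arg_cong[OF sum])
      also have "\<dots> = (\<Sum>a\<in>A. d a * (indicator (mball a r) u * \<psi> (trace (g ** u))))"
      proof (rule sum.cong[OF refl])
        fix a assume "a \<in> A"
        then show "Phi_GJ \<psi> (g ** u) * (c a * indicator (mball a r) u) = d a * (indicator (mball a r) u * \<psi> (trace (g ** u)))"
          using good_ballD(4)[OF A(7), of a u] by (cases "u \<in> mball a r") (simp_all add: Phi_mult d_def)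
      qed
      finally show ?thesis .
    qed
    have int: "integrable (haar_GL \<mu>) (\<lambda>u. indicator (mball a r) u * \<psi> (trace (g ** u)))" if "a \<in> A" for a
      by (rule integrable_test_fun_GL[OF test_fun_ball_character[OF A(7)[OF that]]])
    have "(\<integral>u. Phi_GJ \<psi> (g ** u) * c u \<partial>haar_GL \<mu>) = (\<integral>u. (\<Sum>a\<in>A. d a * (indicator (mball a r) u * \<psi> (trace (g ** u)))) \<partial>haar_GL \<mu>)"
      by (simp only: pt)
    also have "\<dots> = (\<Sum>a\<in>A. d a * (\<integral>u. indicator (mball a r) u * \<psi> (trace (g ** u)) \<partial>haar_GL \<mu>))"
      using int by (subst Bochner_Integration.integral_sum) auto
    finally show ?thesis using zero by simp
  qed
  moreover have "psi_bound / r > 0" using psi_bound_pos A(1) by simp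
  ultimately show ?thesis using that by blast
qed

text \<open>Radii from which on the truncated kernel does not change, uniformly for \<open>u\<close> in \<open>K\<close> and for determinants of
  absolute value at most \<open>X\<close>. Uniformity in \<open>u\<close> is needed because the members of a delta sequence are only
  supported in a common compact set; uniformity in \<open>x\<close>, to test against functions on the field.\<close>

definition stable_radius :: "real \<Rightarrow> ('f^'n^'n) set \<Rightarrow> real \<Rightarrow> real \<Rightarrow> bool"
  where "stable_radius r K X R \<longleftrightarrow> 0 < R \<and> (\<exists>C>0. \<forall>u\<in>K. mnorm (matrix_inv u) \<le> C \<and> psi_bound / r * C \<le> R \<and>
    (\<forall>x. absv (x::'f) \<le> X \<longrightarrow> absv (det u) * absv x < (R / C) ^ CARD('n)))"

lemma stable_radius_exists:
  assumes K: "compact K" "K \<subseteq> GL" and r: "r > 0" and X: "X \<ge> 0"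
  obtains R where "stable_radius r K X R"
proof -
  obtain C where C: "C > 0" "\<And>u. u \<in> K \<Longrightarrow> mnorm (matrix_inv u) \<le> C"
    using locconst_GL_bounded[OF K locconst_GL_mnorm_inverse] by blast
  obtain D where D: "D > 0" "\<And>u. u \<in> K \<Longrightarrow> absv (det u) \<le> D"
    using locconst_GL_bounded[OF K locconst_GL_absv_det] by blast
  \<comment> \<open>in terms of \<open>S = R / C\<close> the conditions read \<open>psi_bound / r \<le> S\<close> and \<open>D * X < S ^ n\<close>; the summand 1 gives \<open>S \<le> S ^ n\<close>\<close>
  define S where "S = psi_bound / r + D * X + 1"
  have p: "psi_bound / r > 0" "D * X \<ge> 0" using psi_bound_pos r D X by simp_all
  have S: "S \<ge> 1" "psi_bound / r \<le> S" "D * X < S" using p unfolding S_def by linarith+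
  have "stable_radius r K X (S * C)" unfolding stable_radius_def
  proof (intro conjI exI[of _ C] ballI allI impI)
    show "0 < S * C" using S C by simp
    fix u assume u: "u \<in> K"
    show "mnorm (matrix_inv u) \<le> C" using C(2)[OF u] .
    show "psi_bound / r * C \<le> S * C" using S C by (intro mult_right_mono) auto
    fix x :: 'f assume "absv x \<le> X"
    then have "absv (det u) * absv x \<le> D * X" using D(2)[OF u] D(1) by (intro mult_mono) auto
    also have "\<dots> < S" by (rule S(3))
    also have "S \<le> S ^ CARD('n)" using S(1) by (intro self_le_power) auto
    finally show "absv (det u) * absv x < (S * C / C) ^ CARD('n)" using C(1) by simp
  qed (rule C(1))
  then show ?thesis using that by blast
qed

lemma truncated_kernel_stable_radius:
  assumes "stable_radius r K X R0" "R0 \<le> R" "x \<noteq> 0" "absv x \<le> X" "u \<in> K" "K \<subseteq> GL" "locconst_GL \<phi>" "right_level \<phi> r"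
  shows "truncated_kernel \<phi> R x u = truncated_kernel \<phi> R0 x u"
proof -
  obtain C where C: "C > 0" "mnorm (matrix_inv u) \<le> C" "psi_bound / r * C \<le> R0" "absv (det u) * absv x < (R0 / C) ^ CARD('n)"
    using assms(1,4,5) unfolding stable_radius_def by blast
  have "0 < R0" using assms(1) by (simp add: stable_radius_def)
  then show ?thesis using assms C by (intro truncated_kernel_stable[where r = r and C = C]) auto
qed

text \<open>Integrals over the group are finite sums here: \<open>K\<close> is partitioned into balls so small that, for \<open>mnorm g \<le> R\<close>, the
  function \<open>u \<mapsto> Phi_GJ \<psi> (g ** u) * c u\<close> is constant on each of them. The radius \<open>R\<close> depends on \<open>c\<close> through the
  support of the convolution; after the exchange of sum and integral, stability replaces it by \<open>R0\<close>,
  which does not.\<close>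

theorem kernel_integral_eq:
  fixes c :: "'f^'n^'n \<Rightarrow> complex"
  assumes c: "c \<in> test_fun GL" and K: "compact K" "K \<subseteq> GL" "support_in c K"
    and x: "x \<noteq> 0" "absv x \<le> X" and \<phi>: "locconst_GL \<phi>" "right_level \<phi> r"
    and R0: "stable_radius r K X R0"
  shows "integrable (\<nu> x) (kernel_integrand \<psi> \<mu> c \<phi>)"
    and "(\<integral>g. kernel_integrand \<psi> \<mu> c \<phi> g \<partial>\<nu> x) = (\<integral>u. c u * truncated_kernel \<phi> R0 x u \<partial>haar_GL \<mu>)"
proof -
  have R0pos: "R0 > 0" using R0 by (simp add: stable_radius_def)
  have lc: "locconst_GL c" using c by (simp add: test_fun_GL_iff)
  define F where "F g = (\<integral>u. Phi_GJ \<psi> (g ** u) * c u \<partial>haar_GL \<mu>)" for g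
  obtain R1 where R1: "R1 > 0" "\<And>g. R1 < mnorm g \<Longrightarrow> F g = 0"
    using Phi_transform_support[OF c] unfolding F_def by blast
  obtain D where D: "D > 0" "\<And>u. u \<in> K \<Longrightarrow> mnorm u \<le> D" using compact_imp_mnorm_bounded[OF K(1)] by blast
  have lF: "locconst_GL F" unfolding locconst_GL_def
  proof
    fix g :: "'f^'n^'n" assume "g \<in> GL"
    then obtain s where s: "s > 0" "\<forall>h\<in>mball g s. absv (det h) = absv (det g)"
      using locconst_GL_absv_det unfolding locconst_GL_def by blast
    have "F h = F g" if h: "h \<in> mball g (min s (1 / D))" for h
    proof -
      have "Phi_GJ \<psi> (h ** u) * c u = Phi_GJ \<psi> (g ** u) * c u" for u
      proof (cases "u \<in> K")
        case True
        have "Phi_GJ \<psi> (h ** u) = Phi_GJ \<psi> (g ** u)"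
        proof (rule Phi_mult_eq_left)
          have "mnorm (h - g) * mnorm u \<le> 1 / D * D" using h D True by (intro mult_mono) (auto simp: mem_mball)
          then show "mnorm (h - g) * mnorm u \<le> 1" using D(1) by simp
          show "absv (det h) = absv (det g)" using s(2) h by (simp add: mem_mball)
        qed
        then show ?thesis by simp
      qed (use K(3) in \<open>simp add: support_in_def\<close>)
      then show ?thesis by (simp only: F_def)
    qed
    moreover have "min s (1 / D) > 0" using s D by simp
    ultimately show "\<exists>r>0. \<forall>h\<in>mball g r. F h = F g" by blast
  qed
  have eq: "kernel_integrand \<psi> \<mu> c \<phi> g = F g * \<phi> g" if "g \<in> space (\<nu> x)" for g
    using that x convolution_Phi[OF c, of g]
    by (simp add: kernel_integrand_def F_def space_nu det_fibre_def GL_iff)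
  have int: "integrable (\<nu> x) (\<lambda>g. F g * \<phi> g)"
    by (rule integrable_fibre[OF x(1) locconst_GL_comp2[OF lF \<phi>(1)], of R1]) (simp add: R1)
  then show "integrable (\<nu> x) (kernel_integrand \<psi> \<mu> c \<phi>)"
    by (subst Bochner_Integration.integrable_cong[OF refl eq])
  define R where "R = max R0 R1"
  have R: "R0 \<le> R" "R1 \<le> R" "R > 0" using R0pos by (auto simp: R_def)
  have lf: "locconst_GL (\<lambda>u. (c u, truncated_kernel \<phi> R0 x u))"
    by (intro locconst_GL_Pair lc locconst_truncated_kernel R0pos)
  have "1 / R > 0" using R by simp
  then obtain s A where A: "0 < s" "s \<le> 1 / R" "finite A" "A \<subseteq> K" "K \<subseteq> (\<Union>a\<in>A. mball a s)"
    "disjoint_family_on (\<lambda>a. mball a s) A" "\<And>a. a \<in> A \<Longrightarrow> good_ball a s"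
    "\<And>a u. a \<in> A \<Longrightarrow> u \<in> mball a s \<Longrightarrow> (c u, truncated_kernel \<phi> R0 x u) = (c a, truncated_kernel \<phi> R0 x a)"
    using haar_GL_ball_partition[OF K(1,2) lf] by metis
  have out: "c u = 0" if "u \<notin> (\<Union>a\<in>A. mball a s)" for u
    using K(3) A(5) that by (auto simp: support_in_def)
  have Fsum: "F g = (\<Sum>a\<in>A. Phi_GJ \<psi> (g ** a) * c a * of_real (ball_measure a s))" if g: "mnorm g \<le> R" for g
    unfolding F_def
  proof (rule haar_GL_integral_partition(2)[OF A(3,6,7)])
    show "Phi_GJ \<psi> (g ** u) * c u = Phi_GJ \<psi> (g ** a) * c a" if au: "a \<in> A" "u \<in> mball a s" for a u
    proof -
      have "mnorm g * mnorm (u - a) \<le> R * (1 / R)"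
        using g au A(2) R(3) by (intro mult_mono) (auto simp: mem_mball)
      then have "Phi_GJ \<psi> (g ** u) = Phi_GJ \<psi> (g ** a)"
        using R(3) good_ballD(4)[OF A(7)[OF au(1)] au(2)] by (intro Phi_mult_eq) auto
      then show ?thesis using A(8)[OF au] by simp
    qed
  qed (assumption, rule mult_eq_0_iff[THEN iffD2], rule disjI2, rule out, assumption)
  have "(\<integral>g. kernel_integrand \<psi> \<mu> c \<phi> g \<partial>\<nu> x) = (\<integral>g. F g * \<phi> g \<partial>\<nu> x)"
    by (rule Bochner_Integration.integral_cong[OF refl eq])
  also have "\<dots> = (\<integral>g. (\<Sum>a\<in>A. c a * of_real (ball_measure a s) * (if mnorm g \<le> R then Phi_GJ \<psi> (g ** a) * \<phi> g else 0)) \<partial>\<nu> x)"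
  proof (rule Bochner_Integration.integral_cong[OF refl])
    fix g
    show "F g * \<phi> g = (\<Sum>a\<in>A. c a * of_real (ball_measure a s) * (if mnorm g \<le> R then Phi_GJ \<psi> (g ** a) * \<phi> g else 0))"
    proof (cases "mnorm g \<le> R")
      case True
      then show ?thesis by (simp add: Fsum sum_distrib_right) (simp add: mult_ac)
    next
      case False
      then have "R1 < mnorm g" using R(2) by linarith
      then show ?thesis using False by (simp add: R1(2))
    qed
  qed
  also have "\<dots> = (\<Sum>a\<in>A. c a * of_real (ball_measure a s) * truncated_kernel \<phi> R x a)"
  proof -
    have "integrable (\<nu> x) (\<lambda>g. if mnorm g \<le> R then Phi_GJ \<psi> (g ** a) * \<phi> g else 0)" if "a \<in> A" for a
      using that A(4) K(2) by (intro integrable_truncated[OF x(1) \<phi>(1) _ R(3)]) auto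
    then show ?thesis unfolding truncated_kernel_def by (subst Bochner_Integration.integral_sum) auto
  qed
  also have "\<dots> = (\<Sum>a\<in>A. (c a * truncated_kernel \<phi> R0 x a) * of_real (ball_measure a s))"
  proof (rule sum.cong[OF refl])
    fix a assume "a \<in> A"
    then have "truncated_kernel \<phi> R x a = truncated_kernel \<phi> R0 x a"
      using A(4) by (intro truncated_kernel_stable_radius[OF R0 R(1) x _ K(2) \<phi>]) auto
    then show "c a * of_real (ball_measure a s) * truncated_kernel \<phi> R x a = (c a * truncated_kernel \<phi> R0 x a) * of_real (ball_measure a s)"
      by simp
  qed
  also have "\<dots> = (\<integral>u. c u * truncated_kernel \<phi> R0 x u \<partial>haar_GL \<mu>)"
  proof (rule haar_GL_integral_partition(2)[OF A(3,6,7), symmetric])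
    show "c u * truncated_kernel \<phi> R0 x u = c a * truncated_kernel \<phi> R0 x a" if "a \<in> A" "u \<in> mball a s" for a u
      using A(8)[OF that] by simp
  qed (assumption, rule mult_eq_0_iff[THEN iffD2], rule disjI1, rule out, assumption)
  finally show "(\<integral>g. kernel_integrand \<psi> \<mu> c \<phi> g \<partial>\<nu> x) = (\<integral>u. c u * truncated_kernel \<phi> R0 x u \<partial>haar_GL \<mu>)" .
qed

text \<open>The truncated kernel is a smooth function of \<open>u\<close>, against which a delta sequence can be evaluated.\<close>

theorem kernel_limit:
  assumes c: "delta_sequence \<mu> (c :: nat \<Rightarrow> 'f^'n^'n \<Rightarrow> complex)" and \<phi>: "locconst_GL \<phi>" "right_level \<phi> r"
    and X: "X \<ge> 0"
  obtains R0 where "R0 > 0"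
    "\<And>x l. x \<noteq> 0 \<Longrightarrow> absv x \<le> X \<Longrightarrow> integrable (\<nu> x) (kernel_integrand \<psi> \<mu> (c l) \<phi>)"
    "\<And>x R. x \<noteq> 0 \<Longrightarrow> absv x \<le> X \<Longrightarrow> R0 \<le> R \<Longrightarrow>
      (\<lambda>l. \<integral>g. kernel_integrand \<psi> \<mu> (c l) \<phi> g \<partial>\<nu> x) \<longlonglongrightarrow> truncated_kernel \<phi> R x (mat 1)"
proof -
  obtain K where K: "compact K" "K \<subseteq> GL" "mat 1 \<in> interior K" "\<And>l. support_in (c l) K"
    using c unfolding delta_sequence_def support_in_def by blast
  have r: "r > 0" using \<phi>(2) by (simp add: right_level_def)
  obtain R0 where R0: "stable_radius r K X R0" using stable_radius_exists[OF K(1,2) r X] by blast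
  have R0pos: "R0 > 0" using R0 by (simp add: stable_radius_def)
  have c': "c l \<in> test_fun GL" for l using c by (simp add: delta_sequence_def)
  show ?thesis
  proof (rule that[OF R0pos])
    fix x :: 'f and l assume x: "x \<noteq> 0" "absv x \<le> X"
    show "integrable (\<nu> x) (kernel_integrand \<psi> \<mu> (c l) \<phi>)"
      by (rule kernel_integral_eq(1)[OF c' K(1,2,4) x \<phi> R0])
  next
    fix x :: 'f and R assume x: "x \<noteq> 0" "absv x \<le> X" and R: "R0 \<le> R"
    have "(\<lambda>u. truncated_kernel \<phi> R0 x u) \<in> smooth_fun GL"
      unfolding smooth_fun_GL_iff by (rule locconst_truncated_kernel[OF R0pos])
    then have "(\<lambda>l. \<integral>u. c l u * truncated_kernel \<phi> R0 x u \<partial>haar_GL \<mu>) \<longlonglongrightarrow> truncated_kernel \<phi> R0 x (mat 1)"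
      using c unfolding delta_sequence_def by blast
    moreover have "truncated_kernel \<phi> R x (mat 1) = truncated_kernel \<phi> R0 x (mat 1)"
      using interior_subset[of K] K(3) by (intro truncated_kernel_stable_radius[OF R0 R x _ K(2) \<phi>]) auto
    ultimately show "(\<lambda>l. \<integral>g. kernel_integrand \<psi> \<mu> (c l) \<phi> g \<partial>\<nu> x) \<longlonglongrightarrow> truncated_kernel \<phi> R x (mat 1)"
      unfolding kernel_integral_eq(2)[OF c' K(1,2,4) x \<phi> R0] by simp
  qed
qed

text \<open>The conjugation-invariant function \<open>Phi_GJ \<psi> g * f (det g)\<close>, made a test function by a cutoff. The
  cutoff is not invariant under conjugation.\<close>

definition truncated_distribution :: "('f \<Rightarrow> complex) \<Rightarrow> real \<Rightarrow> 'f^'n^'n \<Rightarrow> complex"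
  where "truncated_distribution f R g = (if mnorm g \<le> R then Phi_GJ \<psi> g * f (det g) else 0)"

lemma locconst_test_fun_det:
  assumes "f \<in> test_fun (- {0} :: 'f set)"
  shows "locconst_GL (\<lambda>g :: 'f^'n^'n. f (det g))"
proof (rule locconst_GL_det)
  fix x :: 'f assume "x \<noteq> 0"
  then obtain U where U: "open U" "x \<in> U" "\<forall>y\<in>U \<inter> - {0}. f y = f x"
    using assms unfolding test_fun_def smooth_fun_def by blast
  then show "\<exists>U. open U \<and> x \<in> U \<and> (\<forall>y\<in>U. f y = f x)"
    using \<open>x \<noteq> 0\<close> by (intro exI[of _ "U \<inter> - {0}"]) blast
qed

lemma test_fun_truncated_distribution:
  assumes f: "f \<in> test_fun (- {0} :: 'f set)" and R: "R > 0" and w: "locconst_GL w"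
  shows "(\<lambda>g. truncated_distribution f R g * w g) \<in> test_fun GL"
proof -
  obtain Kf where Kf: "compact Kf" "Kf \<subseteq> - {0}" "\<And>x. x \<notin> Kf \<Longrightarrow> f x = 0"
    using f unfolding test_fun_def by blast
  let ?K = "mball 0 R \<inter> (\<lambda>g. det g) -` Kf :: ('f^'n^'n) set"
  have "closed ((\<lambda>g. det g) -` Kf :: ('f^'n^'n) set)"
    by (intro closed_vimage continuous_intros compact_imp_closed Kf(1))
  then have K: "compact ?K" "?K \<subseteq> GL" using compact_mball Kf(2) by (auto simp: GL_iff intro!: compact_Int_closed)
  have "locconst_GL (\<lambda>g :: 'f^'n^'n. Phi_GJ \<psi> g * f (det g))"
    by (rule locconst_GL_comp2[OF locconst_Phi locconst_test_fun_det[OF f]])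
  then have "locconst_GL (truncated_distribution f R)" unfolding truncated_distribution_def[abs_def]
    by (rule locconst_GL_comp2[OF locconst_GL_mnorm_le[OF R]])
  then have "locconst_GL (\<lambda>g. truncated_distribution f R g * w g)" by (rule locconst_GL_comp2[OF _ w])
  moreover have "support_in (\<lambda>g. truncated_distribution f R g * w g) ?K"
    using Kf(3) by (auto simp: support_in_def truncated_distribution_def mem_mball)
  ultimately show ?thesis using K unfolding test_fun_GL_iff by blast
qed

text \<open>On the compact support of \<open>f\<close> one radius works for all determinants, so that the limit kernel times \<open>f\<close> is the
  fibre integral of a test function on the group. Integrability and the second claim are then
  the disintegration formula.\<close>

theorem pi_kernel_properties:
  assumes c: "delta_sequence \<mu> c" and \<phi>: "locconst_GL \<phi>" "right_level \<phi> r"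
  shows "pi_kernel_well_defined \<psi> \<mu> \<nu> c \<phi>"
    and "\<And>f. f \<in> test_fun (- {0}) \<Longrightarrow> \<exists>R0>0. \<forall>R\<ge>R0.
      pi_kernel_distribution \<psi> \<mu> \<nu> c \<phi> f = (\<integral>g. truncated_distribution f R g * \<phi> g \<partial>haar_GL \<mu>)"
proof -
  have main: "\<exists>R0>0. \<forall>R\<ge>R0. (\<forall>x. x \<noteq> 0 \<longrightarrow> pi_kernel \<psi> \<mu> \<nu> c \<phi> x * f x = (\<integral>g. truncated_distribution f R g * \<phi> g \<partial>\<nu> x))"
    if f: "f \<in> test_fun (- {0})" for f
  proof -
    obtain Kf where Kf: "compact Kf" "Kf \<subseteq> - {0}" "\<And>x. x \<notin> Kf \<Longrightarrow> f x = 0"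
      using f unfolding test_fun_def by blast
    obtain X where X: "\<forall>x\<in>Kf. dist 0 x \<le> X" using compact_imp_bounded[OF Kf(1)] bounded_any_center by blast
    have X': "absv x \<le> max 0 X" if "x \<in> Kf" for x using X that by (auto simp: dist_absv)
    obtain R0 where R0: "R0 > 0" "\<And>x R. x \<noteq> 0 \<Longrightarrow> absv x \<le> max 0 X \<Longrightarrow> R0 \<le> R \<Longrightarrow>
      (\<lambda>l. \<integral>g. kernel_integrand \<psi> \<mu> (c l) \<phi> g \<partial>\<nu> x) \<longlonglongrightarrow> truncated_kernel \<phi> R x (mat 1)"
      using kernel_limit[OF c \<phi>, of "max 0 X"] by (metis max.cobounded1)
    have "pi_kernel \<psi> \<mu> \<nu> c \<phi> x * f x = (\<integral>g. truncated_distribution f R g * \<phi> g \<partial>\<nu> x)"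
      if R: "R0 \<le> R" and x: "x \<noteq> 0" for R x
    proof -
      have "(\<integral>g. truncated_distribution f R g * \<phi> g \<partial>\<nu> x) = (\<integral>g. f x * (if mnorm g \<le> R then Phi_GJ \<psi> (g ** mat 1) * \<phi> g else 0) \<partial>\<nu> x)"
        by (rule Bochner_Integration.integral_cong) (auto simp: space_nu[OF x] det_fibre_def truncated_distribution_def)
      also have "\<dots> = f x * truncated_kernel \<phi> R x (mat 1)" unfolding truncated_kernel_def by simp
      also have "\<dots> = f x * pi_kernel \<psi> \<mu> \<nu> c \<phi> x"
      proof (cases "x \<in> Kf")
        case True
        then show ?thesis using limI[OF R0(2)[OF x X'[OF True] R]] by (simp add: pi_kernel_def)
      qed (simp add: Kf(3))
      finally show ?thesis by simp
    qed
    then show ?thesis using R0(1) by blast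
  qed
  show "pi_kernel_well_defined \<psi> \<mu> \<nu> c \<phi>" unfolding pi_kernel_well_defined_def
  proof (intro conjI allI impI ballI)
    fix x :: 'f assume x: "x \<noteq> 0"
    obtain R0 where R0: "\<And>l. integrable (\<nu> x) (kernel_integrand \<psi> \<mu> (c l) \<phi>)"
      "(\<lambda>l. \<integral>g. kernel_integrand \<psi> \<mu> (c l) \<phi> g \<partial>\<nu> x) \<longlonglongrightarrow> truncated_kernel \<phi> R0 x (mat 1)"
      using kernel_limit[OF c \<phi>, of "absv x"] x by (metis absv_nonneg order_refl)
    show "integrable (\<nu> x) (kernel_integrand \<psi> \<mu> (c l) \<phi>)" for l by (rule R0)
    show "convergent (\<lambda>l. \<integral>g. kernel_integrand \<psi> \<mu> (c l) \<phi> g \<partial>\<nu> x)" using R0(2) by (rule convergentI)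
  next
    fix f :: "'f \<Rightarrow> complex" assume f: "f \<in> test_fun (- {0})"
    obtain R where R: "R > 0" "\<And>x. x \<noteq> 0 \<Longrightarrow> pi_kernel \<psi> \<mu> \<nu> c \<phi> x * f x = (\<integral>g. truncated_distribution f R g * \<phi> g \<partial>\<nu> x)"
      using main[OF f] by blast
    have "integrable (haar_units \<mu>) (\<lambda>x. \<integral>g. truncated_distribution f R g * \<phi> g \<partial>\<nu> x)"
      by (rule integrable_fibre_integral[OF test_fun_truncated_distribution[OF f R(1) \<phi>(1)]])
    then show "integrable (haar_units \<mu>) (\<lambda>x. pi_kernel \<psi> \<mu> \<nu> c \<phi> x * f x)"
      by (rule Bochner_Integration.integrable_cong[OF refl, THEN iffD2, rotated]) (simp add: R(2))
  qed
  fix f :: "'f \<Rightarrow> complex" assume f: "f \<in> test_fun (- {0})"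
  obtain R0 where R0: "R0 > 0" "\<And>x R. R0 \<le> R \<Longrightarrow> x \<noteq> 0 \<Longrightarrow> pi_kernel \<psi> \<mu> \<nu> c \<phi> x * f x = (\<integral>g. truncated_distribution f R g * \<phi> g \<partial>\<nu> x)"
    using main[OF f] by blast
  have "pi_kernel_distribution \<psi> \<mu> \<nu> c \<phi> f = (\<integral>g. truncated_distribution f R g * \<phi> g \<partial>haar_GL \<mu>)" if R: "R0 \<le> R" for R
  proof -
    have "R > 0" using R R0(1) by linarith
    have "pi_kernel_distribution \<psi> \<mu> \<nu> c \<phi> f = (\<integral>x. (\<integral>g. truncated_distribution f R g * \<phi> g \<partial>\<nu> x) \<partial>haar_units \<mu>)"
      unfolding pi_kernel_distribution_def
      by (rule Bochner_Integration.integral_cong) (simp_all add: R0(2)[OF R])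
    then show ?thesis by (simp add: disintegration[OF test_fun_truncated_distribution[OF f \<open>R > 0\<close> \<phi>(1)]])
  qed
  then show "\<exists>R0>0. \<forall>R\<ge>R0. pi_kernel_distribution \<psi> \<mu> \<nu> c \<phi> f = (\<integral>g. truncated_distribution f R g * \<phi> g \<partial>haar_GL \<mu>)"
    using R0(1) by blast
qed

end

section \<open>Schur's lemma in countable dimension\<close>

locale linear_on_subspace = vector_space sc for sc :: "complex \<Rightarrow> 'v \<Rightarrow> 'v::ab_group_add" +
  fixes V :: "'v set" and T :: "'v \<Rightarrow> 'v"
  assumes V: "subspace V"
    and T_in: "v \<in> V \<Longrightarrow> T v \<in> V"
    and T_add: "v \<in> V \<Longrightarrow> w \<in> V \<Longrightarrow> T (v + w) = T v + T w"
    and T_scale: "v \<in> V \<Longrightarrow> T (sc a v) = sc a (T v)"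
begin

lemma T_0: "T 0 = 0"
  using T_add[of 0 0] subspace_0[OF V] by simp

text \<open>The value at \<open>v\<close> of the operator obtained by substituting \<open>T\<close> into a polynomial, by Horner's rule.\<close>

definition poly_op :: "complex poly \<Rightarrow> 'v \<Rightarrow> 'v"
  where "poly_op p v = fold_coeffs (\<lambda>a u. sc a v + T u) p 0"

lemma poly_op_0 [simp]: "poly_op 0 v = 0"
  by (simp add: poly_op_def)

lemma poly_op_pCons: "poly_op (pCons a p) v = sc a v + T (poly_op p v)"
  by (cases "p = 0 \<and> a = 0") (auto simp: poly_op_def T_0)

lemma poly_op_in: "v \<in> V \<Longrightarrow> poly_op p v \<in> V"
  by (induction p) (auto simp: poly_op_pCons intro!: subspace_0[OF V] subspace_add[OF V] subspace_scale[OF V] T_in)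

lemma poly_op_add: "v \<in> V \<Longrightarrow> poly_op (p + q) v = poly_op p v + poly_op q v"
  by (induction p q rule: poly_induct2) (auto simp: poly_op_pCons poly_op_in T_add scale_left_distrib)

lemma poly_op_smult: "v \<in> V \<Longrightarrow> poly_op (smult c p) v = sc c (poly_op p v)"
  by (induction p) (auto simp: poly_op_pCons poly_op_in T_scale scale_right_distrib)

lemma poly_op_sum: "v \<in> V \<Longrightarrow> poly_op (sum p Z) v = (\<Sum>z\<in>Z. poly_op (p z) v)"
  by (induction Z rule: infinite_finite_induct) (auto simp: poly_op_add)

lemma poly_op_linear_factor:
  assumes "v \<in> V"
  shows "poly_op ([:- z, 1:] * p) v = T (poly_op p v) - sc z (poly_op p v)"
proof -
  have eq: "[:- z, 1:] * p = smult (- z) p + pCons 0 p" by (simp add: mult_pCons_left)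
  show ?thesis unfolding eq using assms
    by (simp only: poly_op_add poly_op_smult poly_op_pCons poly_op_in) simp
qed

text \<open>Over the complex numbers a non-zero polynomial in \<open>T\<close> is a product of injective operators \<open>T - z\<close> and a
  non-zero constant.\<close>

lemma poly_op_nonzero:
  assumes inj: "\<And>z v. v \<in> V \<Longrightarrow> T v = sc z v \<Longrightarrow> v = 0"
  shows "p \<noteq> 0 \<Longrightarrow> v \<in> V \<Longrightarrow> v \<noteq> 0 \<Longrightarrow> poly_op p v \<noteq> 0"
proof (induction "degree p" arbitrary: p)
  case 0
  then obtain a where "p = [:a:]" using degree_eq_zeroE by metis
  then show ?case using 0 by (auto simp: poly_op_pCons T_0)
next
  case (Suc n)
  then have "\<not> constant (poly p)" by (simp add: constant_degree)
  then obtain z where "poly p z = 0" using fundamental_theorem_of_algebra by blast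
  then obtain q where q: "p = [:- z, 1:] * q" using poly_eq_0_iff_dvd by blast
  then have "q \<noteq> 0" using Suc by auto
  then have "degree p = Suc (degree q)" unfolding q by (subst degree_mult_eq) auto
  then have "poly_op q v \<noteq> 0" using Suc \<open>q \<noteq> 0\<close> by simp
  then show ?case using inj[of "poly_op q v" z] poly_op_in[OF Suc.prems(2), of q]
    unfolding q poly_op_linear_factor[OF Suc.prems(2)] by auto
qed

text \<open>If every \<open>T - z\<close> were bijective, the solutions \<open>w z\<close> of \<open>(T - z) (w z) = v0\<close> would be linearly
  independent: for finitely many \<open>z\<close> they are values at a common vector \<open>u\<close> of the
  polynomials \<open>Q (Z - {z})\<close> in \<open>T\<close>, so a linear relation is a polynomial in \<open>T\<close> that kills \<open>u\<close>. But there are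
  uncountably many complex numbers \<open>z\<close>, and only countably many independent vectors.\<close>

theorem not_bijective_shift_exists:
  assumes v0: "v0 \<in> V" "v0 \<noteq> 0" and B: "countable B" "V \<subseteq> span B"
  obtains z where "\<not> (inj_on (\<lambda>v. T v - sc z v) V \<and> (\<lambda>v. T v - sc z v) ` V = V)"
proof (rule ccontr)
  assume "\<not> thesis"
  then have inj: "inj_on (\<lambda>v. T v - sc z v) V" and surj: "(\<lambda>v. T v - sc z v) ` V = V" for z
    using that by blast+
  have inj': "v = 0" if "v \<in> V" "T v = sc z v" for z v
    using inj_onD[OF inj[of z], of v 0] that subspace_0[OF V] by (simp add: T_0)
  have preimage: "\<exists>u. u \<in> V \<and> T u - sc z u = v" if v: "v \<in> V" for z v
  proof -
    have "v \<in> (\<lambda>v. T v - sc z v) ` V" unfolding surj by (rule v)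
    then show ?thesis by blast
  qed
  define w where "w z = (SOME u. u \<in> V \<and> T u - sc z u = v0)" for z
  have w: "w z \<in> V" "T (w z) - sc z (w z) = v0" for z
    using someI_ex[OF preimage[OF v0(1), of z]] by (simp_all add: w_def)
  define Q where "Q Z = (\<Prod>z\<in>Z. [:- z, 1:] :: complex poly)" for Z
  have common: "\<exists>u\<in>V. poly_op (Q Z) u = v" if "finite Z" "v \<in> V" for Z v
    using that
  proof (induction Z arbitrary: v)
    case empty
    have "poly_op 1 v = v" by (simp add: one_pCons poly_op_pCons T_0)
    then show ?case using empty by (auto simp: Q_def)
  next
    case (insert z Z)
    obtain v1 where v1: "v1 \<in> V" "T v1 - sc z v1 = v" using preimage[OF insert.prems] by blast
    obtain u where u: "u \<in> V" "poly_op (Q Z) u = v1" using insert.IH v1(1) by blast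
    have "poly_op (Q (insert z Z)) u = v"
      using insert.hyps u v1(2) unfolding Q_def by (simp add: poly_op_linear_factor del: mult_pCons_left)
    then show ?case using u(1) by blast
  qed
  have indep: "a z0 = 0" if Z: "finite Z" "z0 \<in> Z" and rel: "(\<Sum>z\<in>Z. sc (a z) (w z)) = 0" for Z z0 a
  proof (rule ccontr)
    assume a: "a z0 \<noteq> 0"
    obtain u where u: "u \<in> V" "poly_op (Q Z) u = v0" using common[OF Z(1) v0(1)] by blast
    have "u \<noteq> 0" 
    proof
      assume "u = 0"
      have "poly_op p 0 = 0" for p by (induction p) (auto simp: poly_op_pCons T_0)
      then show False using u(2) v0(2) \<open>u = 0\<close> by simp
    qed
    define P where "P = (\<Sum>z\<in>Z. smult (a z) (Q (Z - {z})))"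
    have wz: "poly_op (Q (Z - {z})) u = w z" if "z \<in> Z" for z
    proof (rule inj_onD[OF inj[of z]])
      have "Q Z = [:- z, 1:] * Q (Z - {z})" unfolding Q_def using Z(1) that by (rule prod.remove)
      then show "T (poly_op (Q (Z - {z})) u) - sc z (poly_op (Q (Z - {z})) u) = T (w z) - sc z (w z)"
        using u poly_op_linear_factor[OF u(1), of z] w(2) by simp
    qed (use u(1) w(1) poly_op_in in auto)
    have "poly_op P u = (\<Sum>z\<in>Z. sc (a z) (w z))"
      unfolding P_def using u(1) wz by (simp add: poly_op_sum poly_op_smult)
    then have "poly_op P u = 0" using rel by simp
    moreover have "P \<noteq> 0"
    proof
      assume "P = 0"
      then have "0 = poly P z0" by simp
      also have "\<dots> = (\<Sum>z\<in>Z. a z * (\<Prod>y\<in>Z - {z}. z0 - y))"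
        by (simp add: P_def Q_def poly_sum poly_prod)
      also have "\<dots> = a z0 * (\<Prod>y\<in>Z - {z0}. z0 - y) + (\<Sum>z\<in>Z - {z0}. a z * (\<Prod>y\<in>Z - {z}. z0 - y))"
        by (rule sum.remove[OF Z])
      also have "(\<Sum>z\<in>Z - {z0}. a z * (\<Prod>y\<in>Z - {z}. z0 - y)) = 0"
        using Z by (intro sum.neutral ballI mult_eq_0_iff[THEN iffD2] disjI2) (auto simp: prod_zero_iff)
      finally show False using a Z(1) by (auto simp: prod_zero_iff)
    qed
    ultimately show False using poly_op_nonzero[of P u] inj' u(1) \<open>u \<noteq> 0\<close> by blast
  qed
  have "inj w"
  proof (rule injI)
    fix y z assume "w y = w z"
    then have "T (w z) - sc y (w z) = T (w z) - sc z (w z)" using w(2)[of y] w(2)[of z] by simp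
    then have "sc (y - z) (w z) = 0" by (simp add: scale_left_diff_distrib)
    moreover have "w z \<noteq> 0" using w(2)[of z] v0(2) by (auto simp: T_0)
    ultimately show "y = z" by simp
  qed
  obtain b :: "nat \<Rightarrow> 'v" where b: "B \<subseteq> range b"
    using B(1) by (metis countable_as_injective_image_subset subset_range_from_nat_into UNIV_I empty_subsetI)
  define S where "S n = {z. w z \<in> span (b ` {..<n})}" for n
  have "(\<Union>n. S n) = UNIV"
  proof -
    have "\<exists>n. z \<in> S n" for z
    proof -
      have "w z \<in> span B" using w(1) B(2) by blast
      then obtain t r where t: "finite t" "t \<subseteq> B" "w z = (\<Sum>a\<in>t. sc (r a) a)" unfolding span_explicit by blast
      then obtain n where "t \<subseteq> b ` {..<n}" using finite_subset_image[of t b UNIV] b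
        by (metis finite_nat_iff_bounded image_mono subset_trans)
      then have "w z \<in> span (b ` {..<n})" unfolding t(3)
        by (intro span_sum span_scale span_base) auto
      then show ?thesis by (auto simp: S_def)
    qed
    then show ?thesis by auto
  qed
  \<comment> \<open>the field is uncountable, so the countably many sets \<open>S n\<close> cannot all be finite\<close>
  then obtain n where n: "infinite (S n)"
    using uncountable_UNIV_complex by (metis countable_UN countable_finite uncountable_def UNIV_I countableI_type)
  obtain Z where Z: "finite Z" "card Z = Suc n" "Z \<subseteq> S n" using infinite_arbitrarily_large[OF n] by metis
  have "independent (w ` Z)"
  proof -
    have "u v = 0" if rel: "(\<Sum>v\<in>w ` Z. sc (u v) v) = 0" and v: "v \<in> w ` Z" for u v
    proof -
      have "(\<Sum>z\<in>Z. sc (u (w z)) (w z)) = 0"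
        using rel \<open>inj w\<close> by (subst (asm) sum.reindex) (auto intro: inj_on_subset simp: o_def)
      then show ?thesis using indep[OF Z(1), of _ "\<lambda>z. u (w z)"] v by auto
    qed
    then show ?thesis using Z(1) by (intro independent_if_scalars_zero) auto
  qed
  moreover have "w ` Z \<subseteq> span (b ` {..<n})" using Z(3) by (auto simp: S_def)
  ultimately have "card (w ` Z) \<le> card (b ` {..<n})" using independent_span_bound by blast
  also have "\<dots> \<le> n" using card_image_le[of "{..<n}" b] by simp
  finally show False using Z(2) card_image[of w Z] \<open>inj w\<close> by (simp add: inj_on_subset)
qed

end

section \<open>Cancellation on the group\<close>

definition left_level :: "('f::nonarch_local_field_0^'n^'n \<Rightarrow> 'b) \<Rightarrow> real \<Rightarrow> bool"
  where "left_level \<phi> r \<longleftrightarrow> 0 < r \<and> r < 1 \<and> (\<forall>g\<in>GL. \<forall>k. mnorm (k - mat 1) \<le> r \<longrightarrow> \<phi> (k ** g) = \<phi> g)"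

text \<open>A matrix \<open>h\<close> near \<open>g\<close> is \<open>g\<close> times a matrix near the identity.\<close>

lemma right_level_locconst:
  assumes "right_level \<phi> r"
  shows "locconst_GL \<phi>"
  unfolding locconst_GL_def
proof
  fix g :: "'a^'b^'b" assume g: "g \<in> GL"
  have r: "r > 0" using assms by (simp add: right_level_def)
  have pos: "mnorm (matrix_inv g) > 0" using g by (intro mnorm_pos_GL) simp
  have "\<phi> h = \<phi> g" if h: "h \<in> mball g (r / mnorm (matrix_inv g))" for h
  proof -
    have "matrix_inv g ** h - mat 1 = matrix_inv g ** (h - g)" using g by (simp add: matrix_sub_ldistrib')
    moreover have "mnorm (matrix_inv g ** (h - g)) \<le> mnorm (matrix_inv g) * (r / mnorm (matrix_inv g))"
      using h by (intro mnorm_mult_le') (auto simp: mem_mball)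
    moreover have "mnorm (matrix_inv g) * (r / mnorm (matrix_inv g)) = r" using pos by (simp add: less_imp_neq[symmetric] del: mnorm_eq_0)
    ultimately have "mnorm (matrix_inv g ** h - mat 1) \<le> r" by (simp only:)
    then have "\<phi> (g ** (matrix_inv g ** h)) = \<phi> g" using assms g unfolding right_level_def by blast
    then show ?thesis using g by simp
  qed
  moreover have "r / mnorm (matrix_inv g) > 0" using r pos by simp
  ultimately show "\<exists>r>0. \<forall>h\<in>mball g r. \<phi> h = \<phi> g" by blast
qed

lemma left_level_locconst:
  assumes "left_level \<phi> r"
  shows "locconst_GL \<phi>"
  unfolding locconst_GL_def
proof
  fix g :: "'a^'b^'b" assume g: "g \<in> GL"
  have r: "r > 0" using assms by (simp add: left_level_def)
  have pos: "mnorm (matrix_inv g) > 0" using g by (intro mnorm_pos_GL) simp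
  have "\<phi> h = \<phi> g" if h: "h \<in> mball g (r / mnorm (matrix_inv g))" for h
  proof -
    have "h ** matrix_inv g - mat 1 = (h - g) ** matrix_inv g" using g by (simp add: matrix_sub_rdistrib')
    moreover have "mnorm ((h - g) ** matrix_inv g) \<le> (r / mnorm (matrix_inv g)) * mnorm (matrix_inv g)"
      using h by (intro mnorm_mult_le') (auto simp: mem_mball)
    moreover have "r / mnorm (matrix_inv g) * mnorm (matrix_inv g) = r" using pos by (simp add: less_imp_neq[symmetric] del: mnorm_eq_0)
    ultimately have "mnorm (h ** matrix_inv g - mat 1) \<le> r" by (simp only:)
    then have "\<phi> ((h ** matrix_inv g) ** g) = \<phi> g" using assms g unfolding left_level_def by blast
    then show ?thesis using g by (simp flip: matrix_mul_assoc)
  qed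
  moreover have "r / mnorm (matrix_inv g) > 0" using r pos by simp
  ultimately show "\<exists>r>0. \<forall>h\<in>mball g r. \<phi> h = \<phi> g" by blast
qed

lemma mnorm_conj_unipotent:
  assumes h: "h \<in> GL" and N: "N \<in> nilp" and t: "absv t * (mnorm h * mnorm (matrix_inv h)) < 1"
  shows "mnorm (h ** ((mat 1 + mat t ** N) ** g) ** matrix_inv h) = mnorm (h ** g ** matrix_inv h)"
proof -
  let ?y = "h ** g ** matrix_inv h"
  have eq: "h ** ((mat 1 + mat t ** N) ** g) ** matrix_inv h = ?y + mat t ** ((h ** N ** matrix_inv h) ** ?y)"
    using h by (simp add: unipotent_mult matrix_add_ldistrib matrix_add_rdistrib' mult_mat_left_commute flip: matrix_mul_assoc)
  show ?thesis
  proof (cases "?y = 0")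
    case True
    then show ?thesis unfolding eq by simp
  next
    case False
    then have pos: "mnorm ?y > 0" using mnorm_nonneg[of ?y] mnorm_eq_0[of ?y] by linarith
    have "mnorm (h ** N ** matrix_inv h) \<le> mnorm h * mnorm (matrix_inv h) * mnorm N" by (rule mnorm_conj_le[OF h])
    also have "\<dots> \<le> mnorm h * mnorm (matrix_inv h)"
      using N by (intro mult_left_le) (auto simp: nilp_def)
    finally have "mnorm ((h ** N ** matrix_inv h) ** ?y) \<le> (mnorm h * mnorm (matrix_inv h)) * mnorm ?y"
      by (rule mnorm_mult_le'[OF _ order_refl])
    then have "mnorm (mat t ** ((h ** N ** matrix_inv h) ** ?y)) \<le> absv t * ((mnorm h * mnorm (matrix_inv h)) * mnorm ?y)"
      by (simp add: mult_left_mono)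
    also have "\<dots> = (absv t * (mnorm h * mnorm (matrix_inv h))) * mnorm ?y" by simp
    also have "\<dots> < mnorm ?y" using mult_strict_right_mono[OF t pos] by simp
    finally show ?thesis unfolding eq by (rule mnorm_add_eq)
  qed
qed

lemma mnorm_unipotent_mult:
  "N \<in> nilp \<Longrightarrow> absv t < 1 \<Longrightarrow> mnorm ((mat 1 + mat t ** N) ** g) = mnorm g"
  using mnorm_conj_unipotent[OF mat_1_GL, of N t g] by simp

context kernel_setting begin

text \<open>Cancellation on every fibre, now for a function with invariance from the left. The predicate \<open>P\<close> cuts out an
  arbitrary part of the matrices of large norm that is stable under the translations used.\<close>

lemma haar_GL_cancellation_left:
  fixes w :: "'f^'n^'n \<Rightarrow> complex"
  assumes f: "f \<in> test_fun (- {0})" "\<And>x. f x \<noteq> 0 \<Longrightarrow> absv x \<le> X"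
    and w: "left_level w r" and S: "psi_bound / r \<le> S" "1 \<le> S" "X \<le> S" and R: "R > 0"
    and P: "locconst_GL P" "\<And>g. P g \<Longrightarrow> S < mnorm g"
      "\<And>N t g. N \<in> nilp \<Longrightarrow> absv t \<le> r \<Longrightarrow> P ((mat 1 + mat t ** N) ** g) = P g"
  shows "(\<integral>g. truncated_distribution f R g * (if P g then w g else 0) \<partial>haar_GL \<mu>) = 0"
proof -
  have r: "0 < r" "r < 1" using w by (auto simp: left_level_def)
  have lw: "locconst_GL (\<lambda>g. if P g then w g else 0)"
    by (rule locconst_GL_comp2[OF P(1) left_level_locconst[OF w]])
  have "(\<integral>g. truncated_distribution f R g * (if P g then w g else 0) \<partial>\<nu> x) = 0" if x: "x \<noteq> 0" for x
  proof -
    define w' where "w' g = (if mnorm g \<le> R \<and> P g then of_real (absv (det g) powr (real CARD('n) / 2)) * f (det g) * w g else 0)" for g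
    have "(\<integral>g. \<psi> (trace g) * w' g \<partial>\<nu> x) = 0"
    proof (rule fibre_cancellation_left[OF x r, of _ R])
      have "locconst_GL (\<lambda>g :: 'f^'n^'n. complex_of_real (absv (det g) powr (real CARD('n) / 2)))"
        by (rule locconst_GL_comp[OF locconst_GL_absv_det])
      then have "locconst_GL (\<lambda>g :: 'f^'n^'n. of_real (absv (det g) powr (real CARD('n) / 2)) * f (det g))"
        by (rule locconst_GL_comp2[OF _ locconst_test_fun_det[OF f(1)]])
      then have "locconst_GL (\<lambda>g. of_real (absv (det g) powr (real CARD('n) / 2)) * f (det g) * w g)"
        by (rule locconst_GL_comp2[OF _ left_level_locconst[OF w]])
      moreover have "locconst_GL (\<lambda>g. mnorm g \<le> R \<and> P g)"
        by (rule locconst_GL_comp2[OF locconst_GL_mnorm_le[OF R] P(1)])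
      ultimately show "locconst_GL w'" unfolding w'_def[abs_def] by (rule locconst_GL_comp2[rotated])
      show "w' g = 0" if "R < mnorm g" for g using that by (simp add: w'_def)
      show "psi_bound / r \<le> mnorm g \<and> absv (det g) < mnorm g ^ CARD('n)" if "det g = x" "w' g \<noteq> 0" for g
      proof -
        have "P g" "f (det g) \<noteq> 0" using that(2) by (auto simp: w'_def split: if_splits)
        then have "S < mnorm g" "absv (det g) \<le> S" using P(2) f(2)[of "det g"] S(3) by force+
        moreover have "mnorm g \<le> mnorm g ^ CARD('n)" using calculation(1) S(2) by (intro self_le_power) auto
        ultimately show ?thesis using S(1) by linarith
      qed
      show "w' ((mat 1 + mat t ** N) ** g) = w' g" if "N \<in> nilp" "absv t \<le> r" "det g = x" for N t g
      proof -
        have "w ((mat 1 + mat t ** N) ** g) = w g"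
          using w mnorm_unipotent_diff[OF that(1,2)] that(3) x by (simp add: left_level_def GL_iff)
        moreover have "mnorm ((mat 1 + mat t ** N) ** g) = mnorm g"
          using that(1,2) r by (intro mnorm_unipotent_mult) auto
        moreover have "det ((mat 1 + mat t ** N) ** g) = det g" using that(1) by (simp add: det_mul nilp_def)
        ultimately show ?thesis using P(3)[OF that(1,2)] by (simp add: w'_def)
      qed
    qed
    moreover have "\<psi> (trace g) * w' g = truncated_distribution f R g * (if P g then w g else 0)" for g
      by (simp add: w'_def truncated_distribution_def Phi_GJ_def)
    ultimately show ?thesis by simp
  qed
  then have "(\<integral>x. (\<integral>g. truncated_distribution f R g * (if P g then w g else 0) \<partial>\<nu> x) \<partial>haar_units \<mu>) = (\<integral>x. 0 \<partial>haar_units \<mu>)"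
    by (intro Bochner_Integration.integral_cong) auto
  then show ?thesis
    by (simp add: disintegration[OF test_fun_truncated_distribution[OF f(1) R lw]])
qed

text \<open>The two cutoffs, by the norm of \<open>g\<close> and by that of its conjugate, differ by matrices of large norm only, and the
  condition on \<open>r\<close> ensures that small unipotent translations do not affect either norm. The
  truncated integral therefore behaves as if it were invariant under conjugation. The left-hand side does not depend
  on \<open>R\<close>; for \<open>h = mat 1\<close> this is the stability of the truncation.\<close>

lemma truncated_distribution_conj_left:
  fixes w :: "'f^'n^'n \<Rightarrow> complex"
  assumes f: "f \<in> test_fun (- {0})" "\<And>x. f x \<noteq> 0 \<Longrightarrow> absv x \<le> X" and h: "h \<in> GL"
    and w: "left_level w r" and S: "psi_bound / r \<le> S" "1 \<le> S" "X \<le> S"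
    and r: "r * (mnorm h * mnorm (matrix_inv h)) < 1" and R: "mnorm h * mnorm (matrix_inv h) * S \<le> R" "0 < R"
  shows "(\<integral>g. truncated_distribution f R (h ** g ** matrix_inv h) * w g \<partial>haar_GL \<mu>)
    = (\<integral>g. truncated_distribution f S g * w g \<partial>haar_GL \<mu>)"
proof -
  let ?C = "mnorm h * mnorm (matrix_inv h)"
  define R2 where "R2 = max S (?C * R)"
  have R2: "R2 > 0" "S \<le> R2" "?C * R \<le> R2" using S by (auto simp: R2_def)
  define P where "P g \<longleftrightarrow> mnorm (h ** g ** matrix_inv h) \<le> R \<and> \<not> mnorm g \<le> S" for g
  have lC: "locconst_GL (\<lambda>g. mnorm (h ** g ** matrix_inv h) \<le> R)"
    by (rule locconst_GL_precomp[OF locconst_GL_mnorm_le[OF R(2)]]) (use h in \<open>auto intro!: continuous_intros\<close>)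
  have lP: "locconst_GL P" unfolding P_def[abs_def]
    by (rule locconst_GL_comp2[OF lC locconst_GL_mnorm_le]) (use S in simp)
  have lw: "locconst_GL w" by (rule left_level_locconst[OF w])
  have zero: "(\<integral>g. truncated_distribution f R2 g * (if P g then w g else 0) \<partial>haar_GL \<mu>) = 0"
  proof (rule haar_GL_cancellation_left[OF f w S R2(1) lP])
    show "S < mnorm g" if "P g" for g using that by (simp add: P_def)
    fix N g :: "'f^'n^'n" and t :: 'f assume Nt: "N \<in> nilp" "absv t \<le> r"
    have "absv t * ?C \<le> r * ?C" using Nt by (intro mult_right_mono) auto
    then have 1: "mnorm (h ** ((mat 1 + mat t ** N) ** g) ** matrix_inv h) = mnorm (h ** g ** matrix_inv h)"
      using r by (intro mnorm_conj_unipotent[OF h Nt(1)]) simp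
    have "mnorm ((mat 1 + mat t ** N) ** g) = mnorm g"
      using Nt w by (intro mnorm_unipotent_mult) (auto simp: left_level_def)
    then show "P ((mat 1 + mat t ** N) ** g) = P g" using 1 by (simp add: P_def)
  qed
  have pt: "truncated_distribution f R (h ** g ** matrix_inv h) * w g
      = truncated_distribution f S g * w g + truncated_distribution f R2 g * (if P g then w g else 0)" for g
  proof -
    have d: "det (h ** g ** matrix_inv h) = det g" using h by (simp add: det_mul det_matrix_inv GL_iff)
    have "trace (h ** g ** matrix_inv h) = trace (matrix_inv h ** (h ** g))" by (rule trace_mul_sym)
    then have t: "trace (h ** g ** matrix_inv h) = trace g" using h by simp
    have le1: "mnorm (h ** g ** matrix_inv h) \<le> R" if "mnorm g \<le> S"
    proof -
      have "mnorm (h ** g ** matrix_inv h) \<le> ?C * mnorm g" by (rule mnorm_conj_le[OF h])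
      also have "\<dots> \<le> ?C * S" using that by (intro mult_left_mono) auto
      finally show ?thesis using R(1) by linarith
    qed
    have le2: "mnorm g \<le> R2" if "mnorm (h ** g ** matrix_inv h) \<le> R"
    proof -
      have "mnorm (matrix_inv h ** (h ** g ** matrix_inv h) ** matrix_inv (matrix_inv h)) \<le> mnorm (matrix_inv h) * mnorm (matrix_inv (matrix_inv h)) * mnorm (h ** g ** matrix_inv h)"
        by (rule mnorm_conj_le) (use h in simp)
      then have "mnorm g \<le> ?C * mnorm (h ** g ** matrix_inv h)"
        using h by (simp add: mult_ac flip: matrix_mul_assoc)
      also have "\<dots> \<le> ?C * R" using that by (intro mult_left_mono) auto
      finally show ?thesis using R2(3) by linarith
    qed
    show ?thesis
      using le1 le2 R2(2) by (auto simp: truncated_distribution_def Phi_GJ_def d t P_def)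
  qed
  have "(\<integral>g. truncated_distribution f R (h ** g ** matrix_inv h) * w g \<partial>haar_GL \<mu>)
      = (\<integral>g. truncated_distribution f S g * w g + truncated_distribution f R2 g * (if P g then w g else 0) \<partial>haar_GL \<mu>)"
    by (simp only: pt)
  also have "\<dots> = (\<integral>g. truncated_distribution f S g * w g \<partial>haar_GL \<mu>)"
    using S R2 by (subst Bochner_Integration.integral_add)
      (auto simp: zero intro!: integrable_test_fun_GL test_fun_truncated_distribution f(1) lw locconst_GL_comp2[OF lP lw])
  finally show ?thesis .
qed

lemma truncated_distribution_stable_left:
  fixes w :: "'f^'n^'n \<Rightarrow> complex"
  assumes f: "f \<in> test_fun (- {0})" "\<And>x. f x \<noteq> 0 \<Longrightarrow> absv x \<le> X"
    and w: "left_level w r" and S: "psi_bound / r \<le> S" "1 \<le> S" "X \<le> S" and R: "S \<le> R"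
  shows "(\<integral>g. truncated_distribution f R g * w g \<partial>haar_GL \<mu>) = (\<integral>g. truncated_distribution f S g * w g \<partial>haar_GL \<mu>)"
  using truncated_distribution_conj_left[OF f mat_1_GL w S, of R] w R S by (simp add: left_level_def)

text \<open>For invariance from the right stability has been established for the kernel at \<open>mat 1\<close>, and the
  disintegration formula carries it over to the group.\<close>

lemma truncated_distribution_stable_right:
  fixes w :: "'f^'n^'n \<Rightarrow> complex"
  assumes f: "f \<in> test_fun (- {0})" "\<And>x. f x \<noteq> 0 \<Longrightarrow> absv x \<le> X"
    and w: "right_level w r" and S: "stable_radius r {mat 1} X S" and R: "S \<le> R"
  shows "(\<integral>g. truncated_distribution f R g * w g \<partial>haar_GL \<mu>) = (\<integral>g. truncated_distribution f S g * w g \<partial>haar_GL \<mu>)"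
proof -
  have S0: "S > 0" "R > 0" using S R by (auto simp: stable_radius_def)
  have lw: "locconst_GL w" by (rule right_level_locconst[OF w])
  have fib: "(\<integral>g. truncated_distribution f R g * w g \<partial>\<nu> x) = f x * truncated_kernel w R x (mat 1)" if x: "x \<noteq> 0" for R x
  proof -
    have "(\<integral>g. truncated_distribution f R g * w g \<partial>\<nu> x) = (\<integral>g. f x * (if mnorm g \<le> R then Phi_GJ \<psi> (g ** mat 1) * w g else 0) \<partial>\<nu> x)"
      by (rule Bochner_Integration.integral_cong) (auto simp: space_nu[OF x] det_fibre_def truncated_distribution_def)
    then show ?thesis unfolding truncated_kernel_def by simp
  qed
  have "(\<integral>g. truncated_distribution f R g * w g \<partial>\<nu> x) = (\<integral>g. truncated_distribution f S g * w g \<partial>\<nu> x)" if x: "x \<noteq> 0" for x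
  proof (cases "f x = 0")
    case False
    then have "truncated_kernel w R x (mat 1) = truncated_kernel w S x (mat 1)"
      using f(2) by (intro truncated_kernel_stable_radius[OF S R x _ _ _ lw w]) auto
    then show ?thesis by (simp add: fib[OF x])
  qed (simp add: fib[OF x])
  then show ?thesis
    unfolding disintegration[OF test_fun_truncated_distribution[OF f(1) S0(1) lw]]
      disintegration[OF test_fun_truncated_distribution[OF f(1) S0(2) lw]]
    by (rule Bochner_Integration.integral_cong[OF refl]) simp
qed

end

section \<open>Representations and their contragredients\<close>

locale gl_rep = vector_space sc for sc :: "complex \<Rightarrow> 'v \<Rightarrow> 'v::ab_group_add" +
  fixes V :: "'v set" and \<rho> :: "'f::nonarch_local_field_0^'n^'n \<Rightarrow> 'v \<Rightarrow> 'v"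
  assumes rep: "GL_rep sc V \<rho>"
begin

lemma V_subspace: "subspace V"
  using rep by (simp add: GL_rep_def)

lemma rho_in [simp, intro]: "g \<in> GL \<Longrightarrow> v \<in> V \<Longrightarrow> \<rho> g v \<in> V"
  and rho_add: "g \<in> GL \<Longrightarrow> v \<in> V \<Longrightarrow> w \<in> V \<Longrightarrow> \<rho> g (v + w) = \<rho> g v + \<rho> g w"
  and rho_scale: "g \<in> GL \<Longrightarrow> v \<in> V \<Longrightarrow> \<rho> g (sc a v) = sc a (\<rho> g v)"
  and rho_1 [simp]: "v \<in> V \<Longrightarrow> \<rho> (mat 1) v = v"
  and rho_mult: "g \<in> GL \<Longrightarrow> h \<in> GL \<Longrightarrow> v \<in> V \<Longrightarrow> \<rho> (g ** h) v = \<rho> g (\<rho> h v)"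
  using rep by (simp_all add: GL_rep_def)

lemma dual_add: "\<xi> \<in> dual_space sc V \<Longrightarrow> v \<in> V \<Longrightarrow> w \<in> V \<Longrightarrow> \<xi> (v + w) = \<xi> v + \<xi> w"
  and dual_scaleE: "\<xi> \<in> dual_space sc V \<Longrightarrow> v \<in> V \<Longrightarrow> \<xi> (sc a v) = a * \<xi> v"
  and dual_outside: "\<xi> \<in> dual_space sc V \<Longrightarrow> v \<notin> V \<Longrightarrow> \<xi> v = 0"
  by (simp_all add: dual_space_def)

lemma dual_zero: "\<xi> \<in> dual_space sc V \<Longrightarrow> \<xi> 0 = 0"
  using dual_scaleE[of \<xi> 0 0] subspace_0[OF V_subspace] by simp

lemma dual_sum:
  assumes "\<xi> \<in> dual_space sc V" "\<And>a. a \<in> A \<Longrightarrow> q a \<in> V"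
  shows "\<xi> (\<Sum>a\<in>A. sc (b a) (q a)) = (\<Sum>a\<in>A. b a * \<xi> (q a))"
  using assms(2)
proof (induction A rule: infinite_finite_induct)
  case (insert a A)
  have "(\<Sum>a\<in>A. sc (b a) (q a)) \<in> V"
    using insert.prems by (intro subspace_sum[OF V_subspace] subspace_scale[OF V_subspace]) auto
  then show ?case using insert assms(1) subspace_scale[OF V_subspace]
    by (simp add: dual_add dual_scaleE)
qed (simp_all add: dual_zero[OF assms(1)])

lemma dual_separates:
  assumes "v \<in> V" "v \<noteq> 0"
  obtains \<xi> where "\<xi> \<in> dual_space sc V" "\<xi> v \<noteq> 0"
proof -
  interpret C: vector_space "(*) :: complex \<Rightarrow> complex \<Rightarrow> complex"
    by unfold_locales (simp_all add: algebra_simps)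
  interpret P: vector_space_pair sc "(*) :: complex \<Rightarrow> complex \<Rightarrow> complex" ..
  have "independent {v}" using assms(2) by simp
  then obtain g where g: "Vector_Spaces.linear sc (*) g" "g v = (1::complex)"
    using P.linear_independent_extend[of "{v}" "\<lambda>_. 1"] by auto
  interpret g: Vector_Spaces.linear sc "(*)" g by (rule g(1))
  have "(\<lambda>u. if u \<in> V then g u else 0) \<in> dual_space sc V"
    using subspace_add[OF V_subspace] subspace_scale[OF V_subspace]
    by (auto simp: dual_space_def g.add g.scale)
  then show ?thesis using that assms(1) g(2) by fastforce
qed

lemma dual_unique:
  assumes u: "u \<in> V" "u' \<in> V" and eq: "\<And>\<xi>. \<xi> \<in> dual_space sc V \<Longrightarrow> \<xi> u = \<xi> u'"
  shows "u = u'"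
proof (rule ccontr)
  assume "u \<noteq> u'"
  moreover have "u - u' \<in> V" by (rule subspace_diff[OF V_subspace u])
  ultimately obtain \<xi> where \<xi>: "\<xi> \<in> dual_space sc V" "\<xi> (u - u') \<noteq> 0" using dual_separates[of "u - u'"] by auto
  have "\<xi> ((u - u') + u') = \<xi> (u - u') + \<xi> u'" using \<xi>(1) \<open>u - u' \<in> V\<close> u(2) by (rule dual_add)
  then show False using \<xi>(2) eq[OF \<xi>(1)] by simp
qed

abbreviation "contra \<equiv> contragredient_space sc V \<rho>"
abbreviation "act \<equiv> dual_action V \<rho>"

lemma act_apply: "v \<in> V \<Longrightarrow> act g \<xi> v = \<xi> (\<rho> (matrix_inv g) v)"
  by (simp add: dual_action_def)

lemma act_dual: "\<xi> \<in> dual_space sc V \<Longrightarrow> g \<in> GL \<Longrightarrow> act g \<xi> \<in> dual_space sc V"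
  using subspace_add[OF V_subspace] subspace_scale[OF V_subspace]
  by (auto simp: dual_space_def dual_action_def rho_add rho_scale)

lemma act_1: "\<xi> \<in> dual_space sc V \<Longrightarrow> act (mat 1) \<xi> = \<xi>"
  by (auto simp: dual_action_def fun_eq_iff dual_outside)

lemma act_mult: "g \<in> GL \<Longrightarrow> h \<in> GL \<Longrightarrow> act (g ** h) \<xi> = act g (act h \<xi>)"
  by (auto simp: dual_action_def fun_eq_iff matrix_inv_mult rho_mult)

lemma contra_dual: "\<xi> \<in> contra \<Longrightarrow> \<xi> \<in> dual_space sc V"
  by (simp add: contragredient_space_def)

lemma contra_level:
  assumes "\<xi> \<in> contra"
  obtains r where "0 < r" "r < 1" "\<And>k. mnorm (k - mat 1) \<le> r \<Longrightarrow> k \<in> GL \<and> act k \<xi> = \<xi>"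
proof -
  have "open {g \<in> GL. act g \<xi> = \<xi>}" "mat 1 \<in> {g \<in> GL. act g \<xi> = \<xi>}"
    using assms act_1[OF contra_dual[OF assms]] by (simp_all add: contragredient_space_def)
  then obtain r where "r > 0" "mball (mat 1) r \<subseteq> {g \<in> GL. act g \<xi> = \<xi>}"
    unfolding open_mnorm_iff by blast
  then show ?thesis by (intro that[of "min r (1 / 2)"]) (auto simp: mem_mball subset_iff)
qed

text \<open>The stabilizer of a functional is a subgroup, so it is open as soon as it contains a ball around the
  identity.\<close>

lemma contraI:
  assumes \<xi>: "\<xi> \<in> dual_space sc V" and r: "0 < r" "\<And>k. mnorm (k - mat 1) \<le> r \<Longrightarrow> k \<in> GL \<and> act k \<xi> = \<xi>"
  shows "\<xi> \<in> contra"
proof -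
  have "open {g \<in> GL. act g \<xi> = \<xi>}" unfolding open_mnorm_iff
  proof
    fix g assume g: "g \<in> {g \<in> GL. act g \<xi> = \<xi>}"
    then have pos: "mnorm (matrix_inv g) > 0" by (intro mnorm_pos_GL) auto
    have "h \<in> {g \<in> GL. act g \<xi> = \<xi>}" if h: "h \<in> mball g (r / mnorm (matrix_inv g))" for h
    proof -
      have "mnorm (matrix_inv g ** (h - g)) \<le> mnorm (matrix_inv g) * (r / mnorm (matrix_inv g))"
        using h by (intro mnorm_mult_le') (auto simp: mem_mball)
      also have "\<dots> = r" using pos by (simp add: less_imp_neq[symmetric] del: mnorm_eq_0)
      finally have k: "matrix_inv g ** h \<in> GL \<and> act (matrix_inv g ** h) \<xi> = \<xi>"
        using g by (intro r(2)) (simp add: matrix_sub_ldistrib')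
      then have "g ** (matrix_inv g ** h) \<in> GL" "act (g ** (matrix_inv g ** h)) \<xi> = \<xi>"
        using g by (auto simp only: mem_Collect_eq GL_mult act_mult)
      then show ?thesis using g by simp
    qed
    moreover have "r / mnorm (matrix_inv g) > 0" using r(1) pos by simp
    ultimately show "\<exists>r>0. mball g r \<subseteq> {g \<in> GL. act g \<xi> = \<xi>}" by blast
  qed
  then show ?thesis using \<xi> by (simp add: contragredient_space_def)
qed

lemma contra_zero: "0 \<in> contra"
proof -
  obtain r where "r > 0" "mball (mat 1) r \<subseteq> (GL :: ('f^'n^'n) set)"
    using open_GL mat_1_GL unfolding open_mnorm_iff by blast
  then show ?thesis by (intro contraI[of 0 r]) (auto simp: dual_space_def dual_action_def fun_eq_iff mem_mball subset_iff)
qed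

lemma contra_add:
  assumes "\<xi> \<in> contra" "\<eta> \<in> contra"
  shows "\<xi> + \<eta> \<in> contra"
proof -
  obtain r where r: "0 < r" "\<And>k. mnorm (k - mat 1) \<le> r \<Longrightarrow> k \<in> GL \<and> act k \<xi> = \<xi>"
    using contra_level[OF assms(1)] by blast
  obtain s where s: "0 < s" "\<And>k. mnorm (k - mat 1) \<le> s \<Longrightarrow> k \<in> GL \<and> act k \<eta> = \<eta>"
    using contra_level[OF assms(2)] by blast
  show ?thesis
  proof (rule contraI[of _ "min r s"])
    show "\<xi> + \<eta> \<in> dual_space sc V"
      using contra_dual[OF assms(1)] contra_dual[OF assms(2)] by (simp add: dual_space_def algebra_simps)
    fix k :: "'f^'n^'n" assume "mnorm (k - mat 1) \<le> min r s"
    then have k: "k \<in> GL" "act k \<xi> = \<xi>" "act k \<eta> = \<eta>" using r(2)[of k] s(2)[of k] by auto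
    have "act k (\<xi> + \<eta>) = act k \<xi> + act k \<eta>" by (auto simp: dual_action_def fun_eq_iff)
    then show "k \<in> GL \<and> act k (\<xi> + \<eta>) = \<xi> + \<eta>" using k by simp
  qed (use r s in simp)
qed

lemma contra_scale:
  assumes "\<xi> \<in> contra"
  shows "dual_scale a \<xi> \<in> contra"
proof -
  obtain r where r: "0 < r" "\<And>k. mnorm (k - mat 1) \<le> r \<Longrightarrow> k \<in> GL \<and> act k \<xi> = \<xi>"
    using contra_level[OF assms] by blast
  show ?thesis
  proof (rule contraI[OF _ r(1)])
    show "dual_scale a \<xi> \<in> dual_space sc V"
      using contra_dual[OF assms] by (simp add: dual_space_def dual_scale_def algebra_simps)
    fix k :: "'f^'n^'n" assume "mnorm (k - mat 1) \<le> r"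
    then have k: "k \<in> GL" "act k \<xi> = \<xi>" using r(2)[of k] by auto
    have "act k (dual_scale a \<xi>) = dual_scale a (act k \<xi>)" by (auto simp: dual_action_def dual_scale_def fun_eq_iff)
    then show "k \<in> GL \<and> act k (dual_scale a \<xi>) = dual_scale a \<xi>" using k by simp
  qed
qed

lemma contra_act:
  assumes "\<xi> \<in> contra" "g \<in> GL"
  shows "act g \<xi> \<in> contra"
proof -
  obtain r where r: "0 < r" "\<And>k. mnorm (k - mat 1) \<le> r \<Longrightarrow> k \<in> GL \<and> act k \<xi> = \<xi>"
    using contra_level[OF assms(1)] by blast
  let ?C = "mnorm (matrix_inv g) * mnorm (matrix_inv (matrix_inv g))"
  have pos: "?C > 0" using assms(2) mnorm_pos_GL[of g] mnorm_pos_GL[of "matrix_inv g"] by simp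
  show ?thesis
  proof (rule contraI[of _ "r / ?C"])
    show "act g \<xi> \<in> dual_space sc V" using act_dual contra_dual assms by blast
    show "r / ?C > 0" using r(1) pos by simp
    fix k :: "'f^'n^'n" assume k: "mnorm (k - mat 1) \<le> r / ?C"
    have "matrix_inv g ** k ** g - mat 1 = matrix_inv g ** (k - mat 1) ** matrix_inv (matrix_inv g)"
      using assms(2) by (simp add: matrix_sub_ldistrib' matrix_sub_rdistrib')
    also have "mnorm \<dots> \<le> ?C * mnorm (k - mat 1)" by (rule mnorm_conj_le) (use assms(2) in simp)
    also have "\<dots> \<le> ?C * (r / ?C)" using k pos by (intro mult_left_mono) auto
    also have "?C * (r / ?C) = r" using pos by (simp only: nonzero_mult_div_cancel_left times_divide_eq_right less_imp_neq[symmetric] not_False_eq_True)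
    finally have "matrix_inv g ** k ** g \<in> GL \<and> act (matrix_inv g ** k ** g) \<xi> = \<xi>" by (rule r(2))
    then have h: "matrix_inv g ** k ** g \<in> GL" "act (matrix_inv g ** k ** g) \<xi> = \<xi>" by auto
    have "k = g ** (matrix_inv g ** k ** g) ** matrix_inv g" using assms(2) by (simp flip: matrix_mul_assoc)
    then have "k \<in> GL" using h(1) assms(2) GL_mult matrix_inv_GL by metis
    have "k ** g = g ** (matrix_inv g ** k ** g)" using assms(2) by (simp flip: matrix_mul_assoc)
    then have "act k (act g \<xi>) = act g (act (matrix_inv g ** k ** g) \<xi>)"
      using act_mult[OF \<open>k \<in> GL\<close> assms(2), of \<xi>] act_mult[OF assms(2) h(1), of \<xi>] by simp
    then show "k \<in> GL \<and> act k (act g \<xi>) = act g \<xi>" using h(2) \<open>k \<in> GL\<close> by simp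
  qed
qed

text \<open>The combination is taken of functions on the representation space, and membership in the contragredient has to
  be carried along since \<open>\<Xi>\<close> is additive only there.\<close>

lemma contra_combination:
  assumes "\<Xi> \<in> dual_space dual_scale contra" "\<xi> \<in> contra" "\<And>a. a \<in> A \<Longrightarrow> h a \<in> GL"
  shows "(\<Sum>a\<in>A. dual_scale (b a) (act (h a) \<xi>)) \<in> contra \<and>
    \<Xi> (\<Sum>a\<in>A. dual_scale (b a) (act (h a) \<xi>)) = (\<Sum>a\<in>A. b a * \<Xi> (act (h a) \<xi>))"
proof -
  have "dual_scale 0 (0 :: 'v \<Rightarrow> complex) = 0" by (simp add: dual_scale_def fun_eq_iff)
  then have "\<Xi> 0 = 0 * \<Xi> 0"
    using assms(1) contra_zero unfolding dual_space_def by (metis (mono_tags, lifting) mem_Collect_eq)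
  then have zero: "\<Xi> (\<lambda>_. 0) = 0" by (simp add: zero_fun_def)
  show ?thesis
    using assms(3)
  proof (induction A rule: infinite_finite_induct)
    case (insert a A)
    let ?S = "\<Sum>a\<in>A. dual_scale (b a) (act (h a) \<xi>)"
    have S: "?S \<in> contra" "\<Xi> ?S = (\<Sum>a\<in>A. b a * \<Xi> (act (h a) \<xi>))" using insert by blast+
    have x: "act (h a) \<xi> \<in> contra" using contra_act assms(2) insert.prems by blast
    have y: "dual_scale (b a) (act (h a) \<xi>) \<in> contra" by (rule contra_scale[OF x])
    have "\<Xi> (dual_scale (b a) (act (h a) \<xi>) + ?S) = \<Xi> (dual_scale (b a) (act (h a) \<xi>)) + \<Xi> ?S"
      using assms(1) y S(1) unfolding dual_space_def by blast
    moreover have "\<Xi> (dual_scale (b a) (act (h a) \<xi>)) = b a * \<Xi> (act (h a) \<xi>)"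
      using assms(1) x unfolding dual_space_def by blast
    ultimately show ?case using contra_add[OF y S(1)] S(2) by (simp only: sum.insert[OF insert.hyps] simp_thms)
  qed (simp_all add: contra_zero[unfolded zero_fun_def] zero zero_fun_def)
qed

end

lemma contragredient_coefficientE:
  assumes "contragredient_coefficient sc V \<rho> \<phi>"
  obtains \<xi> \<Xi> where "\<xi> \<in> contragredient_space sc V \<rho>"
    "\<Xi> \<in> dual_space dual_scale (contragredient_space sc V \<rho>)"
    "\<And>g. g \<in> GL \<Longrightarrow> \<phi> g = \<Xi> (dual_action V \<rho> g \<xi>)"
  using assms unfolding contragredient_coefficient_def matrix_coefficient_def
    contragredient_space_def[of dual_scale] by blast

section \<open>The scalar by which the distribution acts\<close>

locale irreducible_setting = kernel_setting \<mu> \<psi> \<nu> + gl_rep sc V \<rho>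
  for \<mu> :: "'f::nonarch_local_field_0 measure" and \<psi> and \<nu> :: "'f \<Rightarrow> ('f^'n^'n) measure"
    and sc :: "complex \<Rightarrow> 'v \<Rightarrow> 'v::ab_group_add" and V and \<rho> :: "'f^'n^'n \<Rightarrow> 'v \<Rightarrow> 'v" +
  assumes smooth: "smooth_GL_rep sc V \<rho>" and irreducible: "irreducible_GL_rep sc V \<rho>"
begin

lemma vector_level:
  assumes "v \<in> V"
  obtains r where "0 < r" "r < 1" "\<And>k. mnorm (k - mat 1) \<le> r \<Longrightarrow> k \<in> GL \<and> \<rho> k v = v"
proof -
  have "open {g \<in> GL. \<rho> g v = v}" "mat 1 \<in> {g \<in> GL. \<rho> g v = v}"
    using assms smooth by (simp_all add: smooth_GL_rep_def)
  then obtain r where "r > 0" "mball (mat 1) r \<subseteq> {g \<in> GL. \<rho> g v = v}"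
    unfolding open_mnorm_iff by blast
  then show ?thesis by (intro that[of "min r (1 / 2)"]) (auto simp: mem_mball subset_iff)
qed

text \<open>A smooth irreducible representation has countable dimension, since the group is separable and
  the stabilizer of a vector is open.\<close>

lemma countably_spanned:
  obtains v0 B where "v0 \<in> V" "v0 \<noteq> 0" "countable B" "V \<subseteq> span B"
proof -
  have "V \<noteq> {0}" using irreducible by (simp add: irreducible_GL_rep_def)
  then obtain v0 where v0: "v0 \<in> V" "v0 \<noteq> 0" using subspace_0[OF V_subspace] by blast
  let ?O = "{\<rho> g v0 | g. g \<in> GL}"
  have O: "?O \<subseteq> V" using v0 by auto
  obtain D :: "('f^'n^'n) set" where D: "countable D" "\<And>x e. e > 0 \<Longrightarrow> \<exists>d\<in>D. dist x d < e"
    using heine_borel_countable_dense by blast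
  have orbit: "?O \<subseteq> (\<lambda>d. \<rho> d v0) ` D"
  proof
    fix w assume "w \<in> ?O"
    then obtain g where g: "g \<in> GL" "w = \<rho> g v0" by blast
    have "open {h \<in> GL. \<rho> h v0 = v0}" using smooth v0 by (simp add: smooth_GL_rep_def)
    then have "open ((\<lambda>h. matrix_inv g ** h) -` {h \<in> GL. \<rho> h v0 = v0})"
      by (intro open_vimage) (auto intro!: continuous_intros)
    moreover have "g \<in> (\<lambda>h. matrix_inv g ** h) -` {h \<in> GL. \<rho> h v0 = v0}" using g v0 by simp
    ultimately obtain e where e: "e > 0" "ball g e \<subseteq> (\<lambda>h. matrix_inv g ** h) -` {h \<in> GL. \<rho> h v0 = v0}"
      using open_contains_ball by blast
    obtain d where d: "d \<in> D" "dist g d < e" using D(2)[OF e(1)] by blast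
    then have "d \<in> (\<lambda>h. matrix_inv g ** h) -` {h \<in> GL. \<rho> h v0 = v0}" using e(2) by (intro subsetD[OF e(2)]) simp
    then have d': "matrix_inv g ** d \<in> GL" "\<rho> (matrix_inv g ** d) v0 = v0" by simp_all
    have "\<rho> (g ** (matrix_inv g ** d)) v0 = \<rho> g (\<rho> (matrix_inv g ** d) v0)"
      by (rule rho_mult[OF g(1) d'(1) v0(1)])
    then have "\<rho> d v0 = w" using g d'(2) by simp
    then show "w \<in> (\<lambda>d. \<rho> d v0) ` D" using d(1) by blast
  qed
  have count: "countable ?O" by (rule countable_subset[OF orbit countable_image[OF D(1)]])
  have sub: "span ?O \<subseteq> V" using O V_subspace by (rule span_minimal)
  have "\<rho> g w \<in> span ?O" if g: "g \<in> GL" and w: "w \<in> span ?O" for g w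
  proof -
    let ?W = "{w \<in> V. \<rho> g w \<in> span ?O}"
    have "\<rho> g 0 = sc 0 (\<rho> g 0)" using rho_scale[OF g subspace_0[OF V_subspace], of 0] by simp
    then have "subspace ?W"
      using V_subspace g by (auto simp: rho_add rho_scale span_zero span_add span_scale subspace_add
          subspace_scale subspace_0 intro!: subspaceI)
    moreover have "?O \<subseteq> ?W"
    proof
      fix x assume "x \<in> ?O"
      then obtain h where h: "h \<in> GL" "x = \<rho> h v0" by blast
      then have "\<rho> g x = \<rho> (g ** h) v0" using g v0 by (simp add: rho_mult)
      then have "\<rho> g x \<in> span ?O" using g h by (intro span_base) blast
      then show "x \<in> ?W" using h v0 by simp
    qed
    ultimately have "span ?O \<subseteq> ?W" by (intro span_minimal)
    then show ?thesis using w by blast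
  qed
  moreover have "v0 \<in> span ?O" using v0 by (intro span_base) (metis (mono_tags, lifting) mat_1_GL mem_Collect_eq rho_1)
  ultimately have "span ?O = V"
    using irreducible sub v0(2) subspace_span[of ?O] unfolding irreducible_GL_rep_def by blast
  then show ?thesis using that[OF v0 count] by simp
qed

lemma orbit_left_level:
  assumes v: "v \<in> V"
  obtains r where "left_level (\<lambda>g. \<rho> (matrix_inv g) v) r"
proof -
  obtain r where r: "0 < r" "r < 1" "\<And>k. mnorm (k - mat 1) \<le> r \<Longrightarrow> k \<in> GL \<and> \<rho> k v = v"
    using vector_level[OF v] by blast
  have "\<rho> (matrix_inv (k ** g)) v = \<rho> (matrix_inv g) v" if g: "g \<in> GL" and k: "mnorm (k - mat 1) \<le> r" for g k
  proof -
    have kv: "k \<in> GL" "\<rho> k v = v" using r(3)[OF k] by auto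
    have "\<rho> (matrix_inv k) v = \<rho> (matrix_inv k ** k) v" using kv v by (simp only: rho_mult matrix_inv_GL)
    then have "\<rho> (matrix_inv k) v = v" using kv v by simp
    then show ?thesis using g kv v by (simp add: matrix_inv_mult rho_mult)
  qed
  then show ?thesis using that[of r] r by (simp add: left_level_def)
qed

lemma left_level_comp: "left_level q r \<Longrightarrow> left_level (\<lambda>g. h (q g)) r"
  unfolding left_level_def by metis

lemma left_level_mono: "left_level q r \<Longrightarrow> 0 < s \<Longrightarrow> s \<le> r \<Longrightarrow> left_level q s"
  unfolding left_level_def by force

lemma test_fun_support_bound:
  assumes "f \<in> test_fun (- {0} :: 'f set)"
  obtains X where "X \<ge> 0" "\<And>x. f x \<noteq> 0 \<Longrightarrow> absv x \<le> X"
proof -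
  obtain Kf where Kf: "compact Kf" "\<And>x. x \<notin> Kf \<Longrightarrow> f x = 0" using assms unfolding test_fun_def by blast
  obtain X where X: "\<forall>x\<in>Kf. dist 0 x \<le> X" using compact_imp_bounded[OF Kf(1)] bounded_any_center by blast
  have "absv x \<le> max 0 X" if "f x \<noteq> 0" for x
  proof -
    have "x \<in> Kf" using Kf(2) that by blast
    then show ?thesis using X by (auto simp: dist_absv)
  qed
  then show ?thesis using that[of "max 0 X"] by simp
qed

text \<open>Matrix coefficients are evaluated at the inverse, as in the action on the dual.\<close>

definition pairing :: "('f \<Rightarrow> complex) \<Rightarrow> real \<Rightarrow> ('v \<Rightarrow> complex) \<Rightarrow> 'v \<Rightarrow> complex"
  where "pairing f R \<xi> v = (\<integral>g. truncated_distribution f R g * \<xi> (\<rho> (matrix_inv g) v) \<partial>haar_GL \<mu>)"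

text \<open>\<open>u\<close> is the image of \<open>v\<close> under the operator defined by the distribution. It is characterized by all
  functionals, so that linearity and equivariance can be read off from integrals of scalar functions. The radius may
  depend on \<open>v\<close>.\<close>

definition represents :: "('f \<Rightarrow> complex) \<Rightarrow> 'v \<Rightarrow> 'v \<Rightarrow> bool"
  where "represents f v u \<longleftrightarrow> u \<in> V \<and> (\<exists>S. \<forall>R\<ge>S. \<forall>\<xi>\<in>dual_space sc V. pairing f R \<xi> v = \<xi> u)"

lemma pairing_test_fun:
  assumes "f \<in> test_fun (- {0} :: 'f set)" "R > 0" "v \<in> V"
  shows "(\<lambda>g. truncated_distribution f R g * \<xi> (\<rho> (matrix_inv g) v)) \<in> test_fun GL"
proof -
  obtain r where r: "left_level (\<lambda>g. \<rho> (matrix_inv g) v) r" using orbit_left_level[OF assms(3)] .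
  show ?thesis
    by (rule test_fun_truncated_distribution[OF assms(1,2) left_level_locconst[OF left_level_comp[OF r]]])
qed

text \<open>The orbit function \<open>g \<mapsto> \<rho> (matrix_inv g) v\<close> is invariant under left translation by the open stabilizer of \<open>v\<close>, so the
  truncation stabilizes at a radius that does not depend on the functional, and the integral is a
  finite combination of vectors in the orbit.\<close>

lemma represents_exists:
  assumes f: "f \<in> test_fun (- {0} :: 'f set)" and v: "v \<in> V"
  obtains u where "represents f v u"
proof -
  obtain X where X: "X \<ge> 0" "\<And>x. f x \<noteq> 0 \<Longrightarrow> absv x \<le> X" using test_fun_support_bound[OF f] by blast
  let ?q = "\<lambda>g. \<rho> (matrix_inv g) v"
  obtain r where q: "left_level ?q r" using orbit_left_level[OF v] .
  define S where "S = max 1 (max X (psi_bound / r))"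
  have S: "psi_bound / r \<le> S" "1 \<le> S" "X \<le> S" by (auto simp: S_def)
  let ?F = "truncated_distribution f S"
  have F: "?F \<in> test_fun GL" using test_fun_truncated_distribution[OF f, of S "\<lambda>_. 1"] S by simp
  obtain A c where A: "finite A" "A \<subseteq> GL"
    "\<And>h. (\<integral>g. ?F g * h (?q g) \<partial>haar_GL \<mu>) = (\<Sum>a\<in>A. c a * h (?q a))"
    by (rule test_fun_weighted_sum[OF F left_level_locconst[OF q]]) (rule that; assumption)
  define u where "u = (\<Sum>a\<in>A. sc (c a) (?q a))"
  have qV: "?q a \<in> V" if "a \<in> A" for a using that A(2) v by auto
  have "represents f v u" unfolding represents_def
  proof (intro conjI exI allI impI ballI)
    show "u \<in> V" unfolding u_def using qV by (intro subspace_sum[OF V_subspace] subspace_scale[OF V_subspace])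
    fix R and \<xi> :: "'v \<Rightarrow> complex" assume R: "S \<le> R" and \<xi>: "\<xi> \<in> dual_space sc V"
    have "pairing f R \<xi> v = (\<integral>g. ?F g * \<xi> (?q g) \<partial>haar_GL \<mu>)"
      unfolding pairing_def by (rule truncated_distribution_stable_left[OF f X(2) left_level_comp[OF q] S R])
    also have "\<dots> = \<xi> u" unfolding u_def A(3) by (rule dual_sum[OF \<xi> qV, symmetric])
    finally show "pairing f R \<xi> v = \<xi> u" .
  qed
  then show ?thesis using that by blast
qed

lemma represents_unique:
  assumes "represents f v u" "represents f v u'"
  shows "u = u'"
proof -
  obtain S S' where S: "\<And>R \<xi>. S \<le> R \<Longrightarrow> \<xi> \<in> dual_space sc V \<Longrightarrow> pairing f R \<xi> v = \<xi> u"
      "\<And>R \<xi>. S' \<le> R \<Longrightarrow> \<xi> \<in> dual_space sc V \<Longrightarrow> pairing f R \<xi> v = \<xi> u'"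
    using assms unfolding represents_def by metis
  show ?thesis
  proof (rule dual_unique)
    show "\<xi> u = \<xi> u'" if "\<xi> \<in> dual_space sc V" for \<xi>
      using S(1)[of "max S S'" \<xi>] S(2)[of "max S S'" \<xi>] that by simp
  qed (use assms in \<open>auto simp: represents_def\<close>)
qed

lemma represents_add:
  assumes f: "f \<in> test_fun (- {0} :: 'f set)" and v: "v \<in> V" "v' \<in> V" and u: "represents f v u" "represents f v' u'"
  shows "represents f (v + v') (u + u')"
proof -
  obtain S S' where S: "\<And>R \<xi>. S \<le> R \<Longrightarrow> \<xi> \<in> dual_space sc V \<Longrightarrow> pairing f R \<xi> v = \<xi> u"
      "\<And>R \<xi>. S' \<le> R \<Longrightarrow> \<xi> \<in> dual_space sc V \<Longrightarrow> pairing f R \<xi> v' = \<xi> u'"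
    using u unfolding represents_def by metis
  have uV: "u \<in> V" "u' \<in> V" using u by (auto simp: represents_def)
  show ?thesis unfolding represents_def
  proof (intro conjI exI allI impI ballI)
    show "u + u' \<in> V" using uV by (intro subspace_add[OF V_subspace])
    fix R \<xi> assume R: "max 1 (max S S') \<le> R" and \<xi>: "\<xi> \<in> dual_space sc V"
    have R0: "R > 0" using R by linarith
    have "pairing f R \<xi> (v + v') = (\<integral>g. truncated_distribution f R g * \<xi> (\<rho> (matrix_inv g) v)
        + truncated_distribution f R g * \<xi> (\<rho> (matrix_inv g) v') \<partial>haar_GL \<mu>)"
      unfolding pairing_def using v \<xi>
      by (intro Bochner_Integration.integral_cong) (auto simp: rho_add dual_add distrib_left)
    also have "\<dots> = pairing f R \<xi> v + pairing f R \<xi> v'"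
      unfolding pairing_def
      by (intro Bochner_Integration.integral_add integrable_test_fun_GL pairing_test_fun f R0 v)
    finally show "pairing f R \<xi> (v + v') = \<xi> (u + u')" using S R \<xi> uV by (simp add: dual_add)
  qed
qed

lemma represents_scale:
  assumes v: "v \<in> V" and u: "represents f v u"
  shows "represents f (sc a v) (sc a u)"
proof -
  obtain S where S: "\<And>R \<xi>. S \<le> R \<Longrightarrow> \<xi> \<in> dual_space sc V \<Longrightarrow> pairing f R \<xi> v = \<xi> u" and uV: "u \<in> V"
    using u unfolding represents_def by metis
  show ?thesis unfolding represents_def
  proof (intro conjI exI allI impI ballI)
    show "sc a u \<in> V" using uV by (intro subspace_scale[OF V_subspace])
    fix R \<xi> assume R: "S \<le> R" and \<xi>: "\<xi> \<in> dual_space sc V"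
    have "pairing f R \<xi> (sc a v) = (\<integral>g. a * (truncated_distribution f R g * \<xi> (\<rho> (matrix_inv g) v)) \<partial>haar_GL \<mu>)"
      unfolding pairing_def using v \<xi>
      by (intro Bochner_Integration.integral_cong) (auto simp: rho_scale dual_scaleE)
    also have "\<dots> = a * pairing f R \<xi> v" unfolding pairing_def by simp
    finally show "pairing f R \<xi> (sc a v) = \<xi> (sc a u)" using S[OF R \<xi>] \<xi> uV by (simp add: dual_scaleE)
  qed
qed

text \<open>Conjugating the variable by \<open>h\<close> moves \<open>\<rho> h\<close> from the vector to the functional.\<close>

lemma represents_act:
  assumes f: "f \<in> test_fun (- {0} :: 'f set)" and v: "v \<in> V" and h: "h \<in> GL" and u: "represents f v u"
  shows "represents f (\<rho> h v) (\<rho> h u)"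
proof -
  obtain S0 where S0: "\<And>R \<xi>. S0 \<le> R \<Longrightarrow> \<xi> \<in> dual_space sc V \<Longrightarrow> pairing f R \<xi> v = \<xi> u" and uV: "u \<in> V"
    using u unfolding represents_def by metis
  obtain X where X: "X \<ge> 0" "\<And>x. f x \<noteq> 0 \<Longrightarrow> absv x \<le> X" using test_fun_support_bound[OF f] by blast
  obtain r0 where r0: "left_level (\<lambda>g. \<rho> (matrix_inv g) v) r0" using orbit_left_level[OF v] .
  let ?C = "mnorm h * mnorm (matrix_inv h)"
  have C: "?C > 0" using h mnorm_pos_GL[of h] mnorm_pos_GL[of "matrix_inv h"] by simp
  \<comment> \<open>a smaller level, so that conjugation by \<open>h\<close> keeps the unipotent translations close to the identity\<close>
  define r where "r = min r0 (1 / (2 * ?C))"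
  have r: "0 < r" "r \<le> r0" using r0 C by (auto simp: r_def left_level_def)
  have "r * ?C \<le> 1 / (2 * ?C) * ?C" using C by (intro mult_right_mono) (auto simp: r_def)
  also have "\<dots> = 1 / 2" using C by (simp only: times_divide_eq_left mult_1 nonzero_divide_mult_cancel_right less_imp_neq[symmetric] not_False_eq_True)
  finally have rC: "r * ?C < 1" by simp
  have lev: "left_level (\<lambda>g. \<rho> (matrix_inv g) v) r" by (rule left_level_mono[OF r0 r])
  define S where "S = max S0 (max 1 (max X (psi_bound / r)))"
  have S: "psi_bound / r \<le> S" "1 \<le> S" "X \<le> S" "S0 \<le> S" by (auto simp: S_def)
  show ?thesis unfolding represents_def
  proof (intro conjI exI allI impI ballI)
    show "\<rho> h u \<in> V" using h uV by simp
    fix R \<xi> assume R: "max 1 (?C * S) \<le> R" and \<xi>: "\<xi> \<in> dual_space sc V"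
    have R': "R > 0" "?C * S \<le> R" using R by linarith+
    define \<xi>' where "\<xi>' = act (matrix_inv h) \<xi>"
    have \<xi>': "\<xi>' \<in> dual_space sc V" unfolding \<xi>'_def using act_dual[OF \<xi>] h by simp
    have ap: "\<xi>' w = \<xi> (\<rho> h w)" if "w \<in> V" for w using that h by (simp add: \<xi>'_def act_apply)
    have hv: "\<rho> h v \<in> V" using h v by simp
    have "pairing f R \<xi> (\<rho> h v) = (\<integral>g. truncated_distribution f R (h ** g ** matrix_inv h) *
        \<xi> (\<rho> (matrix_inv (h ** g ** matrix_inv h)) (\<rho> h v)) \<partial>haar_GL \<mu>)"
      unfolding pairing_def by (rule haar_GL_conj[OF pairing_test_fun[OF f R'(1) hv] h, symmetric])
    also have "\<dots> = (\<integral>g. truncated_distribution f R (h ** g ** matrix_inv h) * \<xi>' (\<rho> (matrix_inv g) v) \<partial>haar_GL \<mu>)"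
    proof (rule Bochner_Integration.integral_cong[OF refl])
      fix g :: "'f^'n^'n" assume "g \<in> space (haar_GL \<mu>)"
      then have g: "g \<in> GL" by simp
      have "\<rho> (matrix_inv (h ** g ** matrix_inv h)) (\<rho> h v) = \<rho> (matrix_inv (h ** g ** matrix_inv h) ** h) v"
        using g h v by (simp add: rho_mult)
      also have "matrix_inv (h ** g ** matrix_inv h) ** h = h ** matrix_inv g"
        using g h by (simp add: matrix_inv_mult flip: matrix_mul_assoc)
      also have "\<rho> (h ** matrix_inv g) v = \<rho> h (\<rho> (matrix_inv g) v)" using g h v by (simp add: rho_mult)
      finally show "truncated_distribution f R (h ** g ** matrix_inv h) * \<xi> (\<rho> (matrix_inv (h ** g ** matrix_inv h)) (\<rho> h v))
          = truncated_distribution f R (h ** g ** matrix_inv h) * \<xi>' (\<rho> (matrix_inv g) v)"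
        using g v by (simp add: ap)
    qed
    also have "\<dots> = pairing f S \<xi>' v"
      unfolding pairing_def
      by (rule truncated_distribution_conj_left[OF f X(2) h left_level_comp[OF lev] S(1-3) rC R'(2,1)])
    also have "\<dots> = \<xi> (\<rho> h u)" using S0[OF S(4) \<xi>'] ap[OF uV] by simp
    finally show "pairing f R \<xi> (\<rho> h v) = \<xi> (\<rho> h u)" .
  qed
qed

text \<open>Schur's lemma: some \<open>T - z\<close> is not bijective, and its kernel and image are invariant subspaces.\<close>

theorem represents_scalar:
  assumes f: "f \<in> test_fun (- {0} :: 'f set)"
  obtains z where "\<And>v. v \<in> V \<Longrightarrow> represents f v (sc z v)"
proof -
  define T where "T v = (SOME u. represents f v u)" for v
  have T: "represents f v (T v)" if v: "v \<in> V" for v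
    unfolding T_def by (rule someI_ex) (use represents_exists[OF f v] in blast)
  have Teq: "T v = u" if "v \<in> V" "represents f v u" for v u
    using represents_unique[OF T[OF that(1)] that(2)] .
  have TV: "T v \<in> V" if "v \<in> V" for v using T[OF that] by (simp add: represents_def)
  have Tadd: "T (v + w) = T v + T w" if "v \<in> V" "w \<in> V" for v w
    using that by (intro Teq represents_add[OF f] T subspace_add[OF V_subspace])
  have Tscale: "T (sc a v) = sc a (T v)" if "v \<in> V" for a v
    using that by (intro Teq represents_scale T subspace_scale[OF V_subspace])
  have Tact: "T (\<rho> h v) = \<rho> h (T v)" if "v \<in> V" "h \<in> GL" for h v
    using that by (intro Teq represents_act[OF f] T rho_in)
  interpret T: linear_on_subspace sc V T
    by unfold_locales (use V_subspace TV Tadd Tscale in auto)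
  obtain v0 B where B: "v0 \<in> V" "v0 \<noteq> 0" "countable B" "V \<subseteq> span B" using countably_spanned by blast
  obtain z where z: "\<not> (inj_on (\<lambda>v. T v - sc z v) V \<and> (\<lambda>v. T v - sc z v) ` V = V)"
    using T.not_bijective_shift_exists[OF B] by blast
  define D where "D v = T v - sc z v" for v
  have DV: "D v \<in> V" if "v \<in> V" for v
    unfolding D_def using that TV by (intro subspace_diff[OF V_subspace] subspace_scale[OF V_subspace])
  have Dadd: "D (v + w) = D v + D w" if "v \<in> V" "w \<in> V" for v w
    using that by (simp add: D_def Tadd scale_right_distrib)
  have Dscale: "D (sc a v) = sc a (D v)" if "v \<in> V" for a v
    using that by (simp add: D_def Tscale scale_right_diff_distrib mult.commute)
  have rho_diff: "\<rho> h (v - w) = \<rho> h v - \<rho> h w" if "v \<in> V" "w \<in> V" "h \<in> GL" for h v w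
    using rho_add[of h "v - w" w] that subspace_diff[OF V_subspace] by simp
  have Dact: "D (\<rho> h v) = \<rho> h (D v)" if "v \<in> V" "h \<in> GL" for h v
    using that TV subspace_scale[OF V_subspace] by (simp add: D_def Tact rho_diff rho_scale)
  have D0: "D 0 = 0" using Dscale[OF B(1), of 0] by simp
  have irr: "W = {0} \<or> W = V" if "subspace W" "W \<subseteq> V" "\<And>g w. g \<in> GL \<Longrightarrow> w \<in> W \<Longrightarrow> \<rho> g w \<in> W" for W
    using irreducible that unfolding irreducible_GL_rep_def by blast
  have "{v \<in> V. D v = 0} = {0} \<or> {v \<in> V. D v = 0} = V"
  proof (rule irr)
    show "subspace {v \<in> V. D v = 0}"
      using V_subspace by (auto simp: Dadd Dscale D0 subspace_0 subspace_add subspace_scale intro!: subspaceI)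
    show "\<rho> g w \<in> {v \<in> V. D v = 0}" if "g \<in> GL" "w \<in> {v \<in> V. D v = 0}" for g w
    proof -
      have "\<rho> g 0 = 0" using rho_scale[OF that(1) subspace_0[OF V_subspace], of 0] by simp
      then show ?thesis using that by (simp add: Dact)
    qed
  qed auto
  moreover have "D ` V = {0} \<or> D ` V = V"
  proof (rule irr)
    show "subspace (D ` V)"
    proof (rule subspaceI)
      show "0 \<in> D ` V" using D0 subspace_0[OF V_subspace] by (metis imageI)
      show "x + y \<in> D ` V" if "x \<in> D ` V" "y \<in> D ` V" for x y
      proof -
        obtain v w where vw: "v \<in> V" "w \<in> V" "x = D v" "y = D w" using \<open>x \<in> D ` V\<close> \<open>y \<in> D ` V\<close> by blast
        then have "x + y = D (v + w)" by (simp add: Dadd)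
        then show ?thesis using vw subspace_add[OF V_subspace] by blast
      qed
      show "sc c x \<in> D ` V" if "x \<in> D ` V" for c x
      proof -
        obtain v where vw: "v \<in> V" "x = D v" using \<open>x \<in> D ` V\<close> by blast
        then have "sc c x = D (sc c v)" by (simp add: Dscale)
        then show ?thesis using vw subspace_scale[OF V_subspace] by blast
      qed
    qed
    show "D ` V \<subseteq> V" using DV by blast
    show "\<rho> g w \<in> D ` V" if "g \<in> GL" "w \<in> D ` V" for g w
    proof -
      obtain v where vw: "v \<in> V" "w = D v" using \<open>w \<in> D ` V\<close> by blast
      then have "\<rho> g w = D (\<rho> g v)" using that(1) by (simp add: Dact)
      then show ?thesis using vw that(1) by blast
    qed
  qed
  moreover have "inj_on D V" if "{v \<in> V. D v = 0} = {0}"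
  proof (rule inj_onI)
    fix v w assume vw: "v \<in> V" "w \<in> V" "D v = D w"
    have "v - w \<in> V" by (rule subspace_diff[OF V_subspace vw(1,2)])
    moreover have "D (v - w) = 0" using Dadd[OF \<open>v - w \<in> V\<close> vw(2)] vw(3) by simp
    ultimately have "v - w = 0" using that by blast
    then show "v = w" by simp
  qed
  ultimately have "D v = 0" if "v \<in> V" for v
    using z that unfolding D_def[abs_def, symmetric] by blast
  then have "T v = sc z v" if "v \<in> V" for v using that by (simp add: D_def)
  then show ?thesis using that T by metis
qed

text \<open>As functions on the representation space, the distribution applied to the functional \<open>\<xi>\<close> is \<open>z\<close> times \<open>\<xi>\<close>, since at a
  vector \<open>v\<close> it is \<open>\<xi>\<close> applied to the image of \<open>v\<close>. The vector \<open>v\<close> requires a radius of its own; right invariance of the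
  coefficients of \<open>\<xi>\<close> shows that the integral up to the radius \<open>R\<close>, chosen for \<open>\<xi>\<close> alone, is the same. A coefficient
  of the contragredient is a functional \<open>\<Xi>\<close> applied to this identity.\<close>

theorem coefficient_integral:
  assumes f: "f \<in> test_fun (- {0} :: 'f set)" and z: "\<And>v. v \<in> V \<Longrightarrow> represents f v (sc z v)"
    and \<phi>: "contragredient_coefficient sc V \<rho> \<phi>"
  obtains S where "\<And>R. S \<le> R \<Longrightarrow> (\<integral>g. truncated_distribution f R g * \<phi> g \<partial>haar_GL \<mu>) = z * \<phi> (mat 1)"
proof -
  obtain \<xi> \<Xi> where \<xi>: "\<xi> \<in> contra" and \<Xi>: "\<Xi> \<in> dual_space dual_scale contra"
    and \<phi>_eq: "\<And>g. g \<in> GL \<Longrightarrow> \<phi> g = \<Xi> (act g \<xi>)"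
    by (rule contragredient_coefficientE[OF \<phi>]) (rule that; assumption)
  have \<xi>d: "\<xi> \<in> dual_space sc V" by (rule contra_dual[OF \<xi>])
  obtain r where r: "0 < r" "r < 1" "\<And>k. mnorm (k - mat 1) \<le> r \<Longrightarrow> k \<in> GL \<and> act k \<xi> = \<xi>"
    using contra_level[OF \<xi>] by blast
  let ?q = "\<lambda>g. act g \<xi>"
  have lev: "right_level ?q r"
    using r act_mult unfolding right_level_def by metis
  have levh: "right_level (\<lambda>g. h (?q g)) r" for h :: "('v \<Rightarrow> complex) \<Rightarrow> complex"
    using lev unfolding right_level_def by metis
  obtain X where X: "X \<ge> 0" "\<And>x. f x \<noteq> 0 \<Longrightarrow> absv x \<le> X" using test_fun_support_bound[OF f] by blast
  obtain S where S: "stable_radius r {mat 1 :: 'f^'n^'n} X S"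
    using stable_radius_exists[of "{mat 1}" r X] r(1) X(1) by auto
  have main: "(\<integral>g. truncated_distribution f R g * \<phi> g \<partial>haar_GL \<mu>) = z * \<phi> (mat 1)" if R: "S \<le> R" for R
  proof -
    let ?F = "truncated_distribution f R"
    have R0: "R > 0" using R S by (auto simp: stable_radius_def)
    have F: "?F \<in> test_fun GL" using test_fun_truncated_distribution[OF f R0, of "\<lambda>_. 1"] by simp
    obtain A c where A: "finite A" "A \<subseteq> GL"
      and sum: "\<And>h. (\<integral>g. ?F g * h (?q g) \<partial>haar_GL \<mu>) = (\<Sum>a\<in>A. c a * h (?q a))"
      by (rule test_fun_weighted_sum[OF F right_level_locconst[OF lev]]) (rule that; assumption)
    have AG: "a \<in> GL" if "a \<in> A" for a using that A(2) by blast
    define \<eta> where "\<eta> = (\<Sum>a\<in>A. dual_scale (c a) (?q a))"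
    have \<eta>: "\<Xi> \<eta> = (\<Sum>a\<in>A. c a * \<Xi> (?q a))"
      unfolding \<eta>_def using contra_combination[OF \<Xi> \<xi> AG] by (rule conjunct2)
    have "\<eta> v = dual_scale z \<xi> v" for v
    proof -
      have "(\<Sum>a\<in>B. dual_scale (c a) (?q a)) v = (\<Sum>a\<in>B. c a * ?q a v)" for B
        by (induction B rule: infinite_finite_induct) (auto simp: dual_scale_def)
      then have \<eta>v: "\<eta> v = (\<integral>g. ?F g * ?q g v \<partial>haar_GL \<mu>)"
        unfolding \<eta>_def using sum[of "\<lambda>x. x v"] by simp
      show ?thesis
      proof (cases "v \<in> V")
        case True
        obtain S' where S': "\<And>R. S' \<le> R \<Longrightarrow> pairing f R \<xi> v = \<xi> (sc z v)"
          using z[OF True] \<xi>d unfolding represents_def by blast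
        \<comment> \<open>large enough both for \<open>v\<close> and for \<open>\<xi>\<close>\<close>
        define R' where "R' = max R S'"
        have st: "(\<integral>g. truncated_distribution f R'' g * ?q g v \<partial>haar_GL \<mu>) = (\<integral>g. truncated_distribution f S g * ?q g v \<partial>haar_GL \<mu>)"
          if "S \<le> R''" for R''
          by (rule truncated_distribution_stable_right[OF f X(2) levh S that])
        have "\<eta> v = (\<integral>g. truncated_distribution f R' g * ?q g v \<partial>haar_GL \<mu>)"
          unfolding \<eta>v using st[OF R] st[of R'] R by (simp add: R'_def)
        also have "\<dots> = pairing f R' \<xi> v" using True by (simp add: pairing_def act_apply)
        also have "\<dots> = z * \<xi> v" using S'[of R'] True by (simp add: R'_def dual_scaleE[OF \<xi>d])
        finally show ?thesis by (simp add: dual_scale_def)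
      next
        case False
        then show ?thesis unfolding \<eta>v by (simp add: dual_action_def dual_scale_def dual_outside[OF \<xi>d])
      qed
    qed
    then have "\<eta> = dual_scale z \<xi>" by (rule ext)
    have "(\<integral>g. ?F g * \<phi> g \<partial>haar_GL \<mu>) = (\<integral>g. ?F g * \<Xi> (?q g) \<partial>haar_GL \<mu>)"
      by (rule Bochner_Integration.integral_cong) (auto simp: \<phi>_eq)
    also have "\<dots> = \<Xi> (dual_scale z \<xi>)" unfolding sum \<eta>[symmetric] \<open>\<eta> = dual_scale z \<xi>\<close> ..
    also have "\<dots> = z * \<Xi> \<xi>" using \<Xi> \<xi> by (simp add: dual_space_def)
    also have "\<Xi> \<xi> = \<phi> (mat 1)" using \<phi>_eq[OF mat_1_GL] act_1[OF \<xi>d] by simp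
    finally show ?thesis .
  qed
  show ?thesis using that main by blast
qed

lemma coefficient_right_level:
  assumes "contragredient_coefficient sc V \<rho> \<phi>"
  obtains r where "right_level \<phi> r"
proof -
  obtain \<xi> \<Xi> where \<xi>: "\<xi> \<in> contra" and \<Xi>: "\<Xi> \<in> dual_space dual_scale contra"
    and \<phi>_eq: "\<And>g. g \<in> GL \<Longrightarrow> \<phi> g = \<Xi> (act g \<xi>)"
    by (rule contragredient_coefficientE[OF assms]) (rule that; assumption)
  obtain r where r: "0 < r" "r < 1" "\<And>k. mnorm (k - mat 1) \<le> r \<Longrightarrow> k \<in> GL \<and> act k \<xi> = \<xi>"
    using contra_level[OF \<xi>] by blast
  have "\<phi> (g ** k) = \<phi> g" if "g \<in> GL" "mnorm (k - mat 1) \<le> r" for g k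
    using r(3)[OF that(2)] that(1) by (simp add: \<phi>_eq act_mult)
  then show ?thesis using that[of r] r by (simp add: right_level_def)
qed

end

section \<open>Independence of the choices\<close>

theorem corollary3p7:
  fixes \<psi> :: "'f::nonarch_local_field_0 \<Rightarrow> complex"
    and \<mu> :: "'f measure"
    and \<nu> :: "'f \<Rightarrow> ('f^'n^'n) measure"
    and sc :: "complex \<Rightarrow> 'v \<Rightarrow> 'v::ab_group_add"
    and V :: "'v set"
    and \<pi> :: "'f^'n^'n \<Rightarrow> 'v \<Rightarrow> 'v"
  assumes "unramified_additive_character \<psi>"
    and "self_dual_haar \<psi> \<mu>"
    and "det_fibre_measures \<mu> \<nu>"
    and "smooth_GL_rep sc V \<pi>"
    and "irreducible_GL_rep sc V \<pi>"
  shows "(\<forall>\<phi> c. contragredient_coefficient sc V \<pi> \<phi> \<and> \<phi> (mat 1) = 1 \<and> delta_sequence \<mu> c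
            \<longrightarrow> pi_kernel_well_defined \<psi> \<mu> \<nu> c \<phi>) \<and>
         (\<forall>\<phi> \<phi>' c c'. contragredient_coefficient sc V \<pi> \<phi> \<and> \<phi> (mat 1) = 1 \<and> delta_sequence \<mu> c \<and>
            contragredient_coefficient sc V \<pi> \<phi>' \<and> \<phi>' (mat 1) = 1 \<and> delta_sequence \<mu> c'
            \<longrightarrow> (\<forall>f\<in>test_fun (- {0}).
                   pi_kernel_distribution \<psi> \<mu> \<nu> c \<phi> f = pi_kernel_distribution \<psi> \<mu> \<nu> c' \<phi>' f))"
proof -
  have rep: "GL_rep sc V \<pi>" using assms(4) by (simp add: smooth_GL_rep_def)
  then have vs: "vector_space sc" by (simp add: GL_rep_def)
  interpret irreducible_setting \<mu> \<psi> \<nu> sc V \<pi>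
    using assms rep vs
    by (intro irreducible_setting.intro kernel_setting.intro field_haar.intro gl_rep.intro
        kernel_setting_axioms.intro gl_rep_axioms.intro irreducible_setting_axioms.intro)
      (auto simp: self_dual_haar_def)
  have wd: "pi_kernel_well_defined \<psi> \<mu> \<nu> c \<phi>"
    if \<phi>: "contragredient_coefficient sc V \<pi> \<phi>" and c: "delta_sequence \<mu> c" for \<phi> c
  proof -
    obtain r where r: "right_level \<phi> r" using coefficient_right_level[OF \<phi>] .
    show ?thesis by (rule pi_kernel_properties(1)[OF c right_level_locconst[OF r] r])
  qed
  have scalar: "pi_kernel_distribution \<psi> \<mu> \<nu> c \<phi> f = z"
    if \<phi>: "contragredient_coefficient sc V \<pi> \<phi>" "\<phi> (mat 1) = 1" and c: "delta_sequence \<mu> c"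
      and f: "f \<in> test_fun (- {0})" and z: "\<And>v. v \<in> V \<Longrightarrow> represents f v (sc z v)" for \<phi> c f z
  proof -
    obtain r where r: "right_level \<phi> r" using coefficient_right_level[OF \<phi>(1)] .
    obtain R0 where R0: "\<And>R. R0 \<le> R \<Longrightarrow> pi_kernel_distribution \<psi> \<mu> \<nu> c \<phi> f = (\<integral>g. truncated_distribution f R g * \<phi> g \<partial>haar_GL \<mu>)"
      using pi_kernel_properties(2)[OF c right_level_locconst[OF r] r f] by blast
    obtain S where S: "\<And>R. S \<le> R \<Longrightarrow> (\<integral>g. truncated_distribution f R g * \<phi> g \<partial>haar_GL \<mu>) = z * \<phi> (mat 1)"
      using coefficient_integral[OF f z \<phi>(1)] by blast
    show ?thesis using R0[of "max R0 S"] S[of "max R0 S"] \<phi>(2) by simp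
  qed
  have "pi_kernel_distribution \<psi> \<mu> \<nu> c \<phi> f = pi_kernel_distribution \<psi> \<mu> \<nu> c' \<phi>' f"
    if "contragredient_coefficient sc V \<pi> \<phi>" "\<phi> (mat 1) = 1" "delta_sequence \<mu> c"
      "contragredient_coefficient sc V \<pi> \<phi>'" "\<phi>' (mat 1) = 1" "delta_sequence \<mu> c'" and f: "f \<in> test_fun (- {0})"
    for \<phi> \<phi>' c c' f
  proof -
    obtain z where z: "\<And>v. v \<in> V \<Longrightarrow> represents f v (sc z v)" using represents_scalar[OF f] by blast
    show ?thesis using scalar[OF that(1-3) f z] scalar[OF that(4-6) f z] by simp
  qed
  then show ?thesis using wd by blast
qed

end
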